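(* Let $\sigma$ be a triangulation of a polygon $P$ with $n\ge3$ vertices and $\Gamma_\sigma$ its frozen Jacobian algebra. Let $T_\sigma:=e_F\Gamma_\sigma$, regarded as a left module over $\Lambda\cong e_F\Gamma_\sigma e_F$; then $T_\sigma\cong\bigoplus_{(P_s,P_t)\in\sigma,\ s<t}(s,t)$, the sum running over all sides and diagonals of $\sigma$. Moreover, right multiplication induces an isomorphism of algebras $\operatorname{End}_\Lambda(T_\sigma)\cong\Gamma_\sigma^{\mathrm{op}}$.
   Context: Let $K$ be a field, $R=K[x]$. $P$ is a regular polygon with vertices $P_1,\dots,P_n$ counterclockwise, $\sigma$ a triangulation (maximal set of non-crossing diagonals), with edges the sides of $P$ and the diagonals of $\sigma$. $Q_\sigma$ has vertices the edges of $\sigma$; internal arrows $a\to b$ when $a,b$ are sides of a common triangle and $a$ precedes $b$ anticlockwise around their common vertex; external arrows $a\to b$ between the two sides of $P$ at each polygon vertex incident to a diagonal, $a$ preceding $b$ anticlockwise. $W_\sigma=\sum$(cyclic triangles: three internal arrows in a triangle) $-\sum$(big cycles: internal arrows plus one external arrow around a vertex of $P$); $F$ = vertices corresponding to sides; $\Gamma_\sigma=KQ_\sigma/J$ where $J$ is generated by cyclic derivatives $\partial_aW_\sigma$ ($\partial_a(a_1\cdots a_d)=\sum_{a_i=a}a_{i+1}\cdots a_da_1\cdots a_{i-1}$) for arrows with source or target not in $F$. $e_F=\sum_{i\in F}e_i$. $R$ acts on $\Gamma_\sigma$ via $x\mapsto C=\sum_iC_i$, $C_i$ the common class in $\Gamma_\sigma$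 of the minimal cycles through $i$. $\Lambda$ is the tiled $R$-order in $M_n(K(x))$ with $(i,j)$ entry $x^{c_{ij}}R$, $c_{ij}=0$ if $i\le j$ except $c_{1n}=-1$, $c_{ij}=1$ if $i=j+1$, $c_{ij}=2$ if $i\ge j+2$; it is isomorphic as $R$-order to $e_F\Gamma_\sigma e_F$, and $e_F\Gamma_\sigma$ is a $\Lambda$-module through a suitable such isomorphism. $(s,t)$ ($1\le s<t\le n$) is the $\Lambda$-module $[R^{s}\,(x)^{t-s}\,(x^2)^{n-t}]^t\subset K(x)^n$ (column vectors with $s$ entries in $R$, $t-s$ in $xR$, $n-t$ in $x^2R$). *)

theory Defs
  imports "HOL-Algebra.QuotRing" "HOL-Computational_Algebra.Polynomial"
          "HOL-Computational_Algebra.Fraction_Field"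
begin

type_synonym edge = "nat \<times> nat"      \<comment> \<open>edge (P_i,P_j) stored as (i,j), i<j\<close>
type_synonym arrow = "edge \<times> edge"    \<comment> \<open>arrow = (source, target)\<close>
type_synonym qpath = "edge \<times> arrow list" \<comment> \<open>(start vertex, arrows in order)\<close>
type_synonym 'k kq = "qpath \<Rightarrow> 'k"

definition ed :: "nat \<Rightarrow> nat \<Rightarrow> edge" where "ed u v = (min u v, max u v)"

definition is_side :: "nat \<Rightarrow> edge \<Rightarrow> bool" where
  "is_side n e \<longleftrightarrow> (1 \<le> fst e \<and> snd e = fst e + 1 \<and> snd e \<le> n) \<or> e = (1, n)"

definition sides :: "nat \<Rightarrow> edge set" where "sides n = {e. is_side n e}"

definition is_diag :: "nat \<Rightarrow> edge \<Rightarrow> bool" where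
  "is_diag n e \<longleftrightarrow> 1 \<le> fst e \<and> fst e + 2 \<le> snd e \<and> snd e \<le> n \<and> e \<noteq> (1, n)"

definition crosses :: "edge \<Rightarrow> edge \<Rightarrow> bool" where
  "crosses d d' \<longleftrightarrow> (fst d < fst d' \<and> fst d' < snd d \<and> snd d < snd d')
                 \<or> (fst d' < fst d \<and> fst d < snd d' \<and> snd d' < snd d)"

definition triangulation :: "nat \<Rightarrow> edge set \<Rightarrow> bool" where
  "triangulation n \<sigma> \<longleftrightarrow> \<sigma> \<subseteq> {d. is_diag n d}
     \<and> (\<forall>d\<in>\<sigma>. \<forall>d'\<in>\<sigma>. \<not> crosses d d')
     \<and> (\<forall>d. is_diag n d \<and> d \<notin> \<sigma> \<longrightarrow> (\<exists>d'\<in>\<sigma>. crosses d d'))"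

definition edges :: "nat \<Rightarrow> edge set \<Rightarrow> edge set" where
  "edges n \<sigma> = sides n \<union> \<sigma>"

definition triangles :: "nat \<Rightarrow> edge set \<Rightarrow> (nat \<times> nat \<times> nat) set" where
  "triangles n \<sigma> = {(i,j,k). i < j \<and> j < k \<and> (i,j) \<in> edges n \<sigma> \<and> (j,k) \<in> edges n \<sigma>
                          \<and> (i,k) \<in> edges n \<sigma>}"

text \<open>Internal arrows of the triangle P_i P_j P_k (i<j<k, anticlockwise), as a cycle.\<close>
fun tri_cycle :: "nat \<times> nat \<times> nat \<Rightarrow> arrow list" where
  "tri_cycle (i,j,k) = [((i,j),(i,k)), ((i,k),(j,k)), ((j,k),(i,j))]"

definition int_arrows :: "nat \<Rightarrow> edge set \<Rightarrow> arrow set" where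
  "int_arrows n \<sigma> = (\<Union>T\<in>triangles n \<sigma>. set (tri_cycle T))"

definition prv :: "nat \<Rightarrow> nat \<Rightarrow> nat" where "prv n v = (if v = 1 then n else v - 1)"
definition nxt :: "nat \<Rightarrow> nat \<Rightarrow> nat" where "nxt n v = (if v = n then 1 else v + 1)"

definition diag_vertices :: "edge set \<Rightarrow> nat set" where
  "diag_vertices \<sigma> = {v. \<exists>d\<in>\<sigma>. v = fst d \<or> v = snd d}"

definition ext_arrow :: "nat \<Rightarrow> nat \<Rightarrow> arrow" where
  "ext_arrow n v = (ed (prv n v) v, ed v (nxt n v))"

definition arrows :: "nat \<Rightarrow> edge set \<Rightarrow> arrow set" where
  "arrows n \<sigma> = int_arrows n \<sigma> \<union> ext_arrow n ` diag_vertices \<sigma>"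

text \<open>Neighbours of v, listed in anticlockwise order starting after v.\<close>
definition nbrs :: "nat \<Rightarrow> edge set \<Rightarrow> nat \<Rightarrow> nat list" where
  "nbrs n \<sigma> v = filter (\<lambda>u. ed v u \<in> edges n \<sigma>) (map (\<lambda>d. (v - 1 + d) mod n + 1) [1..<n])"

definition big_cycle :: "nat \<Rightarrow> edge set \<Rightarrow> nat \<Rightarrow> arrow list" where
  "big_cycle n \<sigma> v = (let us = nbrs n \<sigma> v in
      map (\<lambda>m. (ed v (us ! m), ed v (us ! Suc m))) [0..<length us - 1] @ [ext_arrow n v])"

section \<open>The path algebra KQ (paths composed left to right) and the frozen Jacobian algebra\<close>

fun path_ok :: "arrow set \<Rightarrow> edge \<Rightarrow> arrow list \<Rightarrow> bool" where
  "path_ok A e [] = True"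
| "path_ok A e (a # as) = (a \<in> A \<and> fst a = e \<and> path_ok A (snd a) as)"

fun path_end :: "edge \<Rightarrow> arrow list \<Rightarrow> edge" where
  "path_end e [] = e"
| "path_end e (a # as) = path_end (snd a) as"

definition kq_carrier :: "nat \<Rightarrow> edge set \<Rightarrow> ('k::field) kq set" where
  "kq_carrier n \<sigma> = {f. finite {p. f p \<noteq> 0}
      \<and> (\<forall>p. f p \<noteq> 0 \<longrightarrow> fst p \<in> edges n \<sigma> \<and> path_ok (arrows n \<sigma>) (fst p) (snd p))}"

definition kq_mult :: "('k::field) kq \<Rightarrow> 'k kq \<Rightarrow> 'k kq" where
  "kq_mult f g = (\<lambda>(e, cs). \<Sum>k\<in>{..length cs}.
       f (e, take k cs) * g (path_end e (take k cs), drop k cs))"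

definition kq_one :: "nat \<Rightarrow> edge set \<Rightarrow> ('k::field) kq" where
  "kq_one n \<sigma> = (\<lambda>(e, cs). if cs = [] \<and> e \<in> edges n \<sigma> then 1 else 0)"

definition KQ :: "nat \<Rightarrow> edge set \<Rightarrow> ('k::field) kq ring" where
  "KQ n \<sigma> = \<lparr>carrier = kq_carrier n \<sigma>, monoid.mult = kq_mult, one = kq_one n \<sigma>,
              zero = (\<lambda>_. 0), add = (\<lambda>f g p. f p + g p)\<rparr>"

definition cyc_deriv :: "arrow \<Rightarrow> arrow list \<Rightarrow> ('k::field) kq" where
  "cyc_deriv a ws = (\<lambda>p. of_nat (card {m. m < length ws \<and> ws ! m = a
                          \<and> p = (snd a, drop (Suc m) ws @ take m ws)}))"

definition dW :: "nat \<Rightarrow> edge set \<Rightarrow> arrow \<Rightarrow> ('k::field) kq" where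
  "dW n \<sigma> a = (\<lambda>p. (\<Sum>T\<in>triangles n \<sigma>. cyc_deriv a (tri_cycle T) p)
                   - (\<Sum>v\<in>diag_vertices \<sigma>. cyc_deriv a (big_cycle n \<sigma> v) p))"

definition Jac_ideal :: "nat \<Rightarrow> edge set \<Rightarrow> ('k::field) kq set" where
  "Jac_ideal n \<sigma> = genideal (KQ n \<sigma>)
      {dW n \<sigma> a | a. a \<in> arrows n \<sigma> \<and> (fst a \<notin> sides n \<or> snd a \<notin> sides n)}"

definition Gamma :: "nat \<Rightarrow> edge set \<Rightarrow> ('k::field) kq set ring" where
  "Gamma n \<sigma> = KQ n \<sigma> Quot Jac_ideal n \<sigma>"

definition cls :: "nat \<Rightarrow> edge set \<Rightarrow> ('k::field) kq \<Rightarrow> 'k kq set" where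
  "cls n \<sigma> f = Jac_ideal n \<sigma> +>\<^bsub>KQ n \<sigma>\<^esub> f"

definition eF :: "nat \<Rightarrow> ('k::field) kq" where
  "eF n = (\<lambda>(e, cs). if cs = [] \<and> e \<in> sides n then 1 else 0)"

definition eF_Gamma :: "nat \<Rightarrow> edge set \<Rightarrow> ('k::field) kq set set" where
  "eF_Gamma n \<sigma> = {cls n \<sigma> (eF n) \<otimes>\<^bsub>Gamma n \<sigma>\<^esub> g | g. g \<in> carrier (Gamma n \<sigma>)}"

definition eF_Gamma_eF :: "nat \<Rightarrow> edge set \<Rightarrow> ('k::field) kq set set" where
  "eF_Gamma_eF n \<sigma> = {cls n \<sigma> (eF n) \<otimes>\<^bsub>Gamma n \<sigma>\<^esub> g \<otimes>\<^bsub>Gamma n \<sigma>\<^esub> cls n \<sigma> (eF n)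
                        | g. g \<in> carrier (Gamma n \<sigma>)}"

subsection \<open>The R = K[x]-structure: x acts by C = sum of minimal cycles\<close>

definition min_cycle :: "nat \<Rightarrow> edge set \<Rightarrow> edge \<Rightarrow> qpath" where
  "min_cycle n \<sigma> e = (let T = (SOME T. T \<in> triangles n \<sigma> \<and> e \<in> fst ` set (tri_cycle T))
     in (e, rotate (THE m. m < 3 \<and> fst (tri_cycle T ! m) = e) (tri_cycle T)))"

definition Csum :: "nat \<Rightarrow> edge set \<Rightarrow> ('k::field) kq" where
  "Csum n \<sigma> = (\<lambda>p. if \<exists>e\<in>edges n \<sigma>. p = min_cycle n \<sigma> e then 1 else 0)"

definition polyact :: "nat \<Rightarrow> edge set \<Rightarrow> ('k::field) poly \<Rightarrow> 'k kq set" where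
  "polyact n \<sigma> q = cls n \<sigma> (finsum (KQ n \<sigma>)
      (\<lambda>k. (\<lambda>p. coeff q k * (Csum n \<sigma> [^]\<^bsub>KQ n \<sigma>\<^esub> k) p)) {..degree q})"

type_synonym 'k mat = "nat \<Rightarrow> nat \<Rightarrow> 'k poly fract"
type_synonym 'k vec = "nat \<Rightarrow> 'k poly fract"

definition Xf :: "('k::field) poly fract" where "Xf = Fract [:0, 1:] 1"

definition xpowR :: "int \<Rightarrow> ('k::field) poly fract set" where
  "xpowR c = {a. \<exists>p. a = Fract p 1 * Xf powi c}"

definition cexp :: "nat \<Rightarrow> nat \<Rightarrow> nat \<Rightarrow> int" where
  "cexp n i j = (if i \<le> j then (if i = 1 \<and> j = n then -1 else 0)
                 else if i = j + 1 then 1 else 2)"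

definition Lambda :: "nat \<Rightarrow> ('k::field) mat set" where
  "Lambda n = {A. (\<forall>i j. i \<notin> {1..n} \<or> j \<notin> {1..n} \<longrightarrow> A i j = 0)
                 \<and> (\<forall>i\<in>{1..n}. \<forall>j\<in>{1..n}. A i j \<in> xpowR (cexp n i j))}"

definition mat_mul :: "nat \<Rightarrow> ('k::field) mat \<Rightarrow> 'k mat \<Rightarrow> 'k mat" where
  "mat_mul n A B = (\<lambda>i j. \<Sum>k\<in>{1..n}. A i k * B k j)"

definition mat_one :: "nat \<Rightarrow> ('k::field) mat" where
  "mat_one n = (\<lambda>i j. if i = j \<and> i \<in> {1..n} then 1 else 0)"

definition mat_smult :: "('k::field) poly \<Rightarrow> 'k mat \<Rightarrow> 'k mat" where
  "mat_smult q A = (\<lambda>i j. Fract q 1 * A i j)"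

definition mat_vec :: "nat \<Rightarrow> ('k::field) mat \<Rightarrow> 'k vec \<Rightarrow> 'k vec" where
  "mat_vec n A v = (\<lambda>i. \<Sum>k\<in>{1..n}. A i k * v k)"

definition st_mod :: "nat \<Rightarrow> nat \<times> nat \<Rightarrow> ('k::field) vec set" where
  "st_mod n st = {v. (\<forall>i. i \<notin> {1..n} \<longrightarrow> v i = 0)
      \<and> (\<forall>i\<in>{1..n}. v i \<in> xpowR (if i \<le> fst st then 0 else if i \<le> snd st then 1 else 2))}"

definition DS :: "nat \<Rightarrow> edge set \<Rightarrow> (edge \<Rightarrow> ('k::field) vec) set" where
  "DS n \<sigma> = {m. (\<forall>e\<in>edges n \<sigma>. m e \<in> st_mod n e) \<and> (\<forall>e. e \<notin> edges n \<sigma> \<longrightarrow> m e = (\<lambda>_. 0))}"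

definition DS_add :: "(edge \<Rightarrow> ('k::field) vec) \<Rightarrow> (edge \<Rightarrow> 'k vec) \<Rightarrow> edge \<Rightarrow> 'k vec" where
  "DS_add m m' = (\<lambda>e i. m e i + m' e i)"

definition DS_act :: "nat \<Rightarrow> ('k::field) mat \<Rightarrow> (edge \<Rightarrow> 'k vec) \<Rightarrow> edge \<Rightarrow> 'k vec" where
  "DS_act n A m = (\<lambda>e. mat_vec n A (m e))"

definition order_iso :: "nat \<Rightarrow> edge set \<Rightarrow> (('k::field) mat \<Rightarrow> 'k kq set) \<Rightarrow> bool" where
  "order_iso n \<sigma> \<phi> \<longleftrightarrow> bij_betw \<phi> (Lambda n) (eF_Gamma_eF n \<sigma>)
     \<and> (\<forall>A\<in>Lambda n. \<forall>B\<in>Lambda n. \<phi> (\<lambda>i j. A i j + B i j) = \<phi> A \<oplus>\<^bsub>Gamma n \<sigma>\<^esub> \<phi> B)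
     \<and> (\<forall>A\<in>Lambda n. \<forall>B\<in>Lambda n. \<phi> (mat_mul n A B) = \<phi> A \<otimes>\<^bsub>Gamma n \<sigma>\<^esub> \<phi> B)
     \<and> \<phi> (mat_one n) = cls n \<sigma> (eF n)
     \<and> (\<forall>q. \<forall>A\<in>Lambda n. \<phi> (mat_smult q A) = polyact n \<sigma> q \<otimes>\<^bsub>Gamma n \<sigma>\<^esub> \<phi> A)"

definition module_iso :: "nat \<Rightarrow> edge set \<Rightarrow> (('k::field) mat \<Rightarrow> 'k kq set)
                          \<Rightarrow> ('k kq set \<Rightarrow> edge \<Rightarrow> 'k vec) \<Rightarrow> bool" where
  "module_iso n \<sigma> \<phi> \<psi> \<longleftrightarrow> bij_betw \<psi> (eF_Gamma n \<sigma>) (DS n \<sigma>)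
     \<and> (\<forall>a\<in>eF_Gamma n \<sigma>. \<forall>b\<in>eF_Gamma n \<sigma>. \<psi> (a \<oplus>\<^bsub>Gamma n \<sigma>\<^esub> b) = DS_add (\<psi> a) (\<psi> b))
     \<and> (\<forall>A\<in>Lambda n. \<forall>a\<in>eF_Gamma n \<sigma>. \<psi> (\<phi> A \<otimes>\<^bsub>Gamma n \<sigma>\<^esub> a) = DS_act n A (\<psi> a))"

definition End_T :: "nat \<Rightarrow> edge set \<Rightarrow> (('k::field) mat \<Rightarrow> 'k kq set)
                     \<Rightarrow> ('k kq set \<Rightarrow> 'k kq set) set" where
  "End_T n \<sigma> \<phi> = {f. f \<in> extensional (eF_Gamma n \<sigma>) \<and> f \<in> eF_Gamma n \<sigma> \<rightarrow> eF_Gamma n \<sigma>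
     \<and> (\<forall>a\<in>eF_Gamma n \<sigma>. \<forall>b\<in>eF_Gamma n \<sigma>. f (a \<oplus>\<^bsub>Gamma n \<sigma>\<^esub> b) = f a \<oplus>\<^bsub>Gamma n \<sigma>\<^esub> f b)
     \<and> (\<forall>A\<in>Lambda n. \<forall>a\<in>eF_Gamma n \<sigma>. f (\<phi> A \<otimes>\<^bsub>Gamma n \<sigma>\<^esub> a) = \<phi> A \<otimes>\<^bsub>Gamma n \<sigma>\<^esub> f a)}"

definition rmult :: "nat \<Rightarrow> edge set \<Rightarrow> ('k::field) kq set \<Rightarrow> 'k kq set \<Rightarrow> 'k kq set" where
  "rmult n \<sigma> g = (\<lambda>t\<in>eF_Gamma n \<sigma>. t \<otimes>\<^bsub>Gamma n \<sigma>\<^esub> g)"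

definition rmult_op_iso :: "nat \<Rightarrow> edge set \<Rightarrow> (('k::field) mat \<Rightarrow> 'k kq set) \<Rightarrow> bool" where
  "rmult_op_iso n \<sigma> \<phi> \<longleftrightarrow> bij_betw (rmult n \<sigma>) (carrier (Gamma n \<sigma>)) (End_T n \<sigma> \<phi>)
     \<and> (\<forall>g::'k kq set\<in>carrier (Gamma n \<sigma>). \<forall>h\<in>carrier (Gamma n \<sigma>).
          rmult n \<sigma> (g \<oplus>\<^bsub>Gamma n \<sigma>\<^esub> h)
            = (\<lambda>t\<in>eF_Gamma n \<sigma>. rmult n \<sigma> g t \<oplus>\<^bsub>Gamma n \<sigma>\<^esub> rmult n \<sigma> h t))
     \<and> (\<forall>g::'k kq set\<in>carrier (Gamma n \<sigma>). \<forall>h\<in>carrier (Gamma n \<sigma>).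
          rmult n \<sigma> (g \<otimes>\<^bsub>Gamma n \<sigma>\<^esub> h) = compose (eF_Gamma n \<sigma>) (rmult n \<sigma> h) (rmult n \<sigma> g))
     \<and> rmult n \<sigma> \<one>\<^bsub>Gamma n \<sigma> :: 'k kq set ring\<^esub> = (\<lambda>t\<in>eF_Gamma n \<sigma>. t)
     \<and> (\<forall>q::'k poly. \<forall>g\<in>carrier (Gamma n \<sigma>).
          rmult n \<sigma> (polyact n \<sigma> q \<otimes>\<^bsub>Gamma n \<sigma>\<^esub> g)
            = (\<lambda>t\<in>eF_Gamma n \<sigma>. polyact n \<sigma> q \<otimes>\<^bsub>Gamma n \<sigma>\<^esub> rmult n \<sigma> g t))"

end

theory Submission
  imports Defs
begin

text \<open>
  Give a path of the quiver the weight \<open>\<Sum> ddeg a\<close>, where \<open>ddeg (i,j) (p,q)\<close> is the least power of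
  \<open>x\<close> that maps the column \<open>(i,j)\<close> into the column \<open>(p,q)\<close>; every cyclic triangle and every big cycle
  then has weight \<open>1\<close>. By the triangle inequality for \<open>ddeg\<close>, for a fixed target \<open>f\<close> each such cycle has
  exactly one arrow that does not lie on a path of minimal weight to \<open>f\<close>. Hence two minimal
  continuations from the same edge can be joined by a relation of the Jacobian ideal, minimal paths
  are unique modulo the ideal, and a non-minimal arrow splits off a central minimal cycle. So two
  parallel paths agree in \<open>\<Gamma>\<close> iff they have the same weight, and \<open>\<Gamma>\<close> is the ring of matrices with
  entries \<open>(e,f)\<close> in \<open>x^(ddeg e f) K[x]\<close>. Both claims become matrix computations: the rows of
  \<open>e\<^sub>F \<Gamma>\<close> are indexed by the sides, column \<open>e\<close> is the module \<open>e\<close>, and a \<open>\<Lambda>\<close>-endomorphism is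
  determined by its effect on one row, where \<open>ddeg e f\<close> is attained as \<open>ddeg s f - ddeg s e\<close> for some side \<open>s\<close>.
\<close>

subsection \<open>Triangulations of the polygon\<close>

text \<open>The triangulation is arbitrary, so minimal paths have no closed formula; their existence
  and uniqueness come from a rewriting argument. An arrow turns an edge anticlockwise and moves its
  endpoints by a positive number of steps along the polygon, and a closed path of weight w makes n w
  steps in all. Hence no nonempty closed path has weight 0, and the displacement still to be covered
  serves as termination measure (\<open>edist\<close>). The local step is a diamond: two arrows that
  both start minimal paths to f continue to congruent paths, because f does not cross the edge they
  leave. The obstacle is freezing. Only an arrow lying both in a triangle and in a big cycle yields
  a relation with two terms, so each diamond has to exhibit such an arrow together with a vertex
  that meets a diagonal. All of this happens on bare arrow lists. The field enters only when
  congruent paths are shown to differ by an element of the ideal; conversely the matrix entries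
  record weights, and so they separate the classes of parallel paths.\<close>

lemma ed_less: "u < v \<Longrightarrow> ed u v = (u, v)" "u < v \<Longrightarrow> ed v u = (u, v)"
  by (auto simp: ed_def)

lemma ed_inj: "u \<noteq> v \<Longrightarrow> u' \<noteq> v \<Longrightarrow> ed v u = ed v u' \<longleftrightarrow> u = u'"
  by (auto simp: ed_def min_def max_def)

section \<open>Degrees of arrows and weights of paths\<close>

definition incident :: "nat \<Rightarrow> edge \<Rightarrow> bool" where
  "incident v e \<longleftrightarrow> v = fst e \<or> v = snd e"

text \<open>Row i of the column (s,t) carries the exponent [s < i] + [t < i]. The degree is the
  largest excess of the exponent of \<open>f\<close> over that of \<open>e\<close>. A positive
  excess is largest at row \<open>fst e\<close> or at row \<open>snd e\<close>, which gives the
  three cases.\<close>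

definition ddeg :: "edge \<Rightarrow> edge \<Rightarrow> nat" where
  "ddeg e f = (if snd f < fst e then 2 else if fst f < fst e \<or> snd f < snd e then 1 else 0)"

definition weight :: "arrow list \<Rightarrow> nat" where
  "weight p = (\<Sum>a\<leftarrow>p. ddeg (fst a) (snd a))"

lemma weight_simps [simp]:
  "weight [] = 0"
  "weight (a # p) = ddeg (fst a) (snd a) + weight p"
  "weight (p @ q) = weight p + weight q"
  by (simp_all add: weight_def)

lemma path_ok_append [simp]:
  "path_ok A e (p @ q) \<longleftrightarrow> path_ok A e p \<and> path_ok A (path_end e p) q"
  by (induction p arbitrary: e) auto

lemma path_end_append [simp]: "path_end e (p @ q) = path_end (path_end e p) q"
  by (induction p arbitrary: e) auto

lemma closed_path_rotate:
  assumes "path_ok A s (us @ a # vs)" "path_end s (us @ a # vs) = s"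
  shows "path_ok A (snd a) (vs @ us)" "path_end (snd a) (vs @ us) = fst a"
  using assms by auto

lemma path_ok_consecutive:
  assumes "\<And>m. m < k \<Longrightarrow> (g m, g (Suc m)) \<in> A"
  shows "path_ok A (g 0) (map (\<lambda>m. (g m, g (Suc m))) [0..<k])
       \<and> path_end (g 0) (map (\<lambda>m. (g m, g (Suc m))) [0..<k]) = g k"
  using assms by (induction k) auto

lemma sorted_wrt_consecutive:
  assumes "sorted_wrt R xs" and irr: "\<And>a. a \<in> set xs \<Longrightarrow> \<not> R a a"
    and asym: "\<And>a b. a \<in> set xs \<Longrightarrow> b \<in> set xs \<Longrightarrow> R a b \<Longrightarrow> \<not> R b a"
    and "x \<in> set xs" "y \<in> set xs" "R x y" "\<And>z. z \<in> set xs \<Longrightarrow> R x z \<Longrightarrow> R z y \<Longrightarrow> False"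
  shows "\<exists>m. Suc m < length xs \<and> xs ! m = x \<and> xs ! Suc m = y"
proof -
  obtain i j where i: "i < length xs" "xs ! i = x" and j: "j < length xs" "xs ! j = y"
    using assms(4,5) by (metis in_set_conv_nth)
  have ij: "i < j"
  proof (rule ccontr)
    assume "\<not> i < j"
    then have "i = j \<or> j < i" by auto
    then show False
      using sorted_wrt_nth_less[OF assms(1)] irr asym i j assms(4-6) by metis
  qed
  have "j = Suc i"
  proof (rule ccontr)
    assume "j \<noteq> Suc i"
    then have "Suc i < j" using ij by auto
    then have "R x (xs ! Suc i)" "R (xs ! Suc i) y"
      using sorted_wrt_nth_less[OF assms(1)] i j by auto
    then show False using assms(7) \<open>Suc i < j\<close> j by (metis nth_mem order_less_trans)
  qed
  then show ?thesis using i j by auto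
qed

locale triangulated_polygon =
  fixes n :: nat and \<sigma> :: "edge set"
  assumes n3: "n \<ge> 3" and tri: "triangulation n \<sigma>"
begin

abbreviation "E \<equiv> edges n \<sigma>"
abbreviation "Ar \<equiv> arrows n \<sigma>"
abbreviation "bc \<equiv> big_cycle n \<sigma>"

section \<open>Noncrossing edges and the triangles on an edge\<close>

lemma edge_cases:
  assumes "(i, j) \<in> E"
  shows "1 \<le> i" "i < j" "j \<le> n"
  using assms tri n3
  by (auto simp: edges_def sides_def is_side_def triangulation_def is_diag_def)

lemma edge_bounds: "e \<in> E \<Longrightarrow> 1 \<le> fst e \<and> fst e < snd e \<and> snd e \<le> n"
  using edge_cases by (cases e) auto

lemma side_edge: "1 \<le> i \<Longrightarrow> i < n \<Longrightarrow> (i, Suc i) \<in> E" "(1, n) \<in> E" "(Suc 0, n) \<in> E"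
  by (auto simp: edges_def sides_def is_side_def)

text \<open>A side of the polygon leaves no vertex on one of its two sides and so crosses nothing;
  only pairs of diagonals need the hypothesis on \<sigma>.\<close>

lemma nocross:
  assumes "e \<in> E" "f \<in> E" shows "\<not> crosses e f"
proof -
  have b: "1 \<le> fst e" "fst e < snd e" "snd e \<le> n" "1 \<le> fst f" "fst f < snd f" "snd f \<le> n"
    using edge_bounds assms by auto
  show ?thesis
  proof (cases "e \<in> \<sigma> \<and> f \<in> \<sigma>")
    case True
    then show ?thesis using tri by (auto simp: triangulation_def)
  next
    case False
    then have "is_side n e \<or> is_side n f" using assms by (auto simp: edges_def sides_def)
    then show ?thesis using b by (cases e; cases f) (auto simp: crosses_def is_side_def)
  qed
qed

lemma nocross_pair:
  assumes "(i, j) \<in> E" "(p, q) \<in> E" shows "\<not> (i < p \<and> p < j \<and> j < q)"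
  using nocross[OF assms] by (auto simp: crosses_def)

text \<open>Maximality of the triangulation, in the form that produces the third side of a
  triangle.\<close>

lemma edge_maximal:
  assumes "1 \<le> i" "i < j" "j \<le> n" "\<And>p q. (p, q) \<in> E \<Longrightarrow> \<not> crosses (i, j) (p, q)"
  shows "(i, j) \<in> E"
proof (cases "is_side n (i, j)")
  case True then show ?thesis by (auto simp: edges_def sides_def)
next
  case False
  then have "is_diag n (i, j)" using assms(1-3) by (auto simp: is_diag_def is_side_def)
  moreover have "\<not> crosses (i, j) d" if "d \<in> \<sigma>" for d
    using assms(4)[of "fst d" "snd d"] that by (simp add: edges_def)
  ultimately show ?thesis using tri unfolding triangulation_def edges_def by blast
qed

text \<open>The apex is the largest neighbour \<open>j\<close> of \<open>i\<close> below
  \<open>k\<close>. An edge crossing (j,k) would cross (i,k) or (i,j), or would join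
  \<open>i\<close> to a vertex strictly between \<open>j\<close> and \<open>k\<close>; so maximality
  makes (j,k) an edge.\<close>

lemma inner_apex:
  assumes e: "(i, k) \<in> E" and l: "i + 2 \<le> k"
  obtains j where "i < j" "j < k" "(i, j) \<in> E" "(j, k) \<in> E"
proof -
  let ?S = "{j. j < k \<and> (i, j) \<in> E}"
  have b: "1 \<le> i" "k \<le> n" using edge_cases[OF e] by auto
  have ne: "Suc i \<in> ?S" using side_edge(1)[of i] b l by auto
  have fin: "finite ?S" by (rule finite_subset[of _ "{..<k}"]) auto
  define j where "j = Max ?S"
  have j: "j < k" "(i, j) \<in> E" using Max_in[OF fin] ne unfolding j_def by blast+
  have mx: "\<And>b. (i, b) \<in> E \<Longrightarrow> b < k \<Longrightarrow> b \<le> j" using Max_ge[OF fin] unfolding j_def by auto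
  have "(j, k) \<in> E"
  proof (rule edge_maximal)
    show "1 \<le> j" "j < k" "k \<le> n" using edge_cases[OF j(2)] j b by auto
    fix p q assume pq: "(p, q) \<in> E"
    have "\<not> (i < p \<and> p < k \<and> k < q)" "\<not> (p < i \<and> i < q \<and> q < k)"
         "\<not> (i < p \<and> p < j \<and> j < q)"
      using nocross_pair[OF e pq] nocross_pair[OF pq e] nocross_pair[OF j(2) pq] by auto
    moreover have "p = i \<Longrightarrow> \<not> (j < q \<and> q < k)" using mx[of q] pq by auto
    moreover have "i < j" using edge_cases[OF j(2)] by auto
    ultimately show "\<not> crosses (j, k) (p, q)" unfolding crosses_def fst_conv snd_conv by linarith
  qed
  with j edge_cases[OF j(2)] that show ?thesis by blast
qed

text \<open>Take a shortest edge (a,b) that properly spans (i,j), and its inner apex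
  \<open>c\<close>. Noncrossing keeps \<open>c\<close> out of the open interval from
  \<open>i\<close> to \<open>j\<close>, so one of (a,c), (c,b) still spans (i,j); being shorter than
  (a,b), it is (i,j) itself.\<close>

lemma outer_apex:
  assumes e: "(i, j) \<in> E" and ne: "(i, j) \<noteq> (1, n)"
  obtains (right) k where "j < k" "(i, k) \<in> E" "(j, k) \<in> E"
        | (left) k where "k < i" "(k, i) \<in> E" "(k, j) \<in> E"
proof -
  let ?S = "{(a, b). (a, b) \<in> E \<and> a \<le> i \<and> j \<le> b \<and> (a, b) \<noteq> (i, j)}"
  have b: "1 \<le> i" "i < j" "j \<le> n" using edge_cases[OF e] by auto
  have "(1, n) \<in> ?S" using side_edge(2) b ne by auto
  then obtain x where x: "x \<in> ?S" "\<And>y. y \<in> ?S \<Longrightarrow> snd x - fst x \<le> snd y - fst y"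
    using ex_has_least_nat[of "\<lambda>y. y \<in> ?S" "(1, n)" "\<lambda>y. snd y - fst y"] by blast
  obtain a b where ab: "x = (a, b)" by (cases x)
  have 1: "(a, b) \<in> E" "a \<le> i" "j \<le> b" "(a, b) \<noteq> (i, j)" using x(1) ab by auto
  have 2: "b - a \<le> b' - a'" if "(a', b') \<in> E" "a' \<le> i" "j \<le> b'" "(a', b') \<noteq> (i, j)" for a' b'
    using x(2)[of "(a', b')"] that ab by auto
  have "a + 2 \<le> b" using 1 b by auto
  then obtain c where c: "a < c" "c < b" "(a, c) \<in> E" "(c, b) \<in> E" using inner_apex[OF 1(1)] by blast
  have "c \<le> i \<or> j \<le> c"
    using nocross_pair[OF c(3) e] nocross_pair[OF e c(4)] 1 c b by fastforce
  then show ?thesis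
  proof
    assume "c \<le> i"
    then have "(c, b) = (i, j)" using 2[of c b] c 1 b by (cases "(c, b) = (i, j)") auto
    then show ?thesis using left[of a] c 1 by auto
  next
    assume "j \<le> c"
    then have "(a, c) = (i, j)" using 2[of a c] c 1 b by (cases "(a, c) = (i, j)") auto
    then show ?thesis using right[of b] c 1 by auto
  qed
qed

text \<open>The cyclic order seen from \<open>v\<close>: walking anticlockwise from
  \<open>v\<close>, one meets \<open>u\<close> before \<open>u'\<close>.\<close>

definition aft :: "nat \<Rightarrow> nat \<Rightarrow> nat \<Rightarrow> bool" where
  "aft v u u' \<longleftrightarrow> (v < u \<and> u < u') \<or> (v < u \<and> u' < v) \<or> (u < u' \<and> u' < v)"

lemma polygon_from:
  assumes "1 \<le> v" "v \<le> n"
  shows "map (\<lambda>d. (v - 1 + d) mod n + 1) [1..<n] = [Suc v..<Suc n] @ [1..<v]"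
proof (rule nth_equalityI)
  show "length (map (\<lambda>d. (v - 1 + d) mod n + 1) [1..<n]) = length ([Suc v..<Suc n] @ [1..<v])"
    using assms by auto
  fix i assume i: "i < length (map (\<lambda>d. (v - 1 + d) mod n + 1) [1..<n])"
  show "map (\<lambda>d. (v - 1 + d) mod n + 1) [1..<n] ! i = ([Suc v..<Suc n] @ [1..<v]) ! i"
  proof (cases "v + i < n")
    case True
    then show ?thesis using assms i by (auto simp: nth_append)
  next
    case False
    then have "(v + i) mod n = v + i - n" using assms i by (subst mod_if) auto
    then show ?thesis using assms i False by (auto simp: nth_append)
  qed
qed

text \<open>Walking around from \<open>v\<close> passes first the vertices above \<open>v\<close>,
  then those below. An edge at \<open>v\<close> is stored with \<open>v\<close> in front in the
  first block and with \<open>v\<close> behind in the second.\<close>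

lemma nbrs_eq:
  assumes "1 \<le> v" "v \<le> n"
  shows "nbrs n \<sigma> v = filter (\<lambda>u. (v, u) \<in> E) [Suc v..<Suc n] @ filter (\<lambda>u. (u, v) \<in> E) [1..<v]"
  unfolding nbrs_def polygon_from[OF assms] filter_append
  by (intro arg_cong2[where f="(@)"] filter_cong) (auto simp: ed_less)

lemma set_nbrs:
  assumes "1 \<le> v" "v \<le> n"
  shows "set (nbrs n \<sigma> v) = {u. u \<noteq> v \<and> ed v u \<in> E}"
proof -
  have "u \<in> set (nbrs n \<sigma> v) \<longleftrightarrow> u \<noteq> v \<and> ed v u \<in> E" for u
    using edge_cases[of u v] edge_cases[of v u]
    by (cases "u < v"; cases "u = v") (auto simp: nbrs_eq[OF assms] ed_less)
  then show ?thesis by auto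
qed

lemma sorted_nbrs:
  assumes "1 \<le> v" "v \<le> n"
  shows "sorted_wrt (aft v) (nbrs n \<sigma> v)"
  unfolding nbrs_eq[OF assms] sorted_wrt_append
  by (intro conjI sorted_wrt_filter sorted_wrt_mono_rel[OF _ sorted_wrt_upt]) (auto simp: aft_def)

lemma aft_irrefl: "\<not> aft v u u" and aft_asym: "aft v u u' \<Longrightarrow> \<not> aft v u' u"
  by (auto simp: aft_def)

lemma distinct_nbrs:
  assumes "1 \<le> v" "v \<le> n" shows "distinct (nbrs n \<sigma> v)"
  unfolding nbrs_eq[OF assms] by auto

lemma nxt_nbr: 
  assumes "1 \<le> v" "v \<le> n" shows "nxt n v \<in> set (nbrs n \<sigma> v)"
  using n3 assms side_edge(1)[of v] side_edge(2)
  by (auto simp: set_nbrs nxt_def ed_def min_def max_def)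

lemma prv_nbr: 
  assumes "1 \<le> v" "v \<le> n" shows "prv n v \<in> set (nbrs n \<sigma> v)"
  using n3 assms side_edge(1)[of "v - 1"] side_edge(2)
  by (auto simp: set_nbrs prv_def ed_def min_def max_def)

lemma sorted_wrt_hd:
  "sorted_wrt R xs \<Longrightarrow> x \<in> set xs \<Longrightarrow> (\<And>z. z \<in> set xs \<Longrightarrow> \<not> R z x) \<Longrightarrow> xs ! 0 = x"
  by (cases xs) auto

lemma sorted_wrt_lst:
  "sorted_wrt R xs \<Longrightarrow> x \<in> set xs \<Longrightarrow> (\<And>z. z \<in> set xs \<Longrightarrow> \<not> R x z) \<Longrightarrow> xs ! (length xs - 1) = x"
  by (cases xs rule: rev_cases) (auto simp: sorted_wrt_append)

lemma hd_nbrs: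
  assumes "1 \<le> v" "v \<le> n" shows "nbrs n \<sigma> v ! 0 = nxt n v"
proof (rule sorted_wrt_hd[OF sorted_nbrs[OF assms] nxt_nbr[OF assms]])
  fix z assume "z \<in> set (nbrs n \<sigma> v)"
  then have "1 \<le> z" "z \<le> n" "z \<noteq> v" using assms by (auto simp: nbrs_eq)
  then show "\<not> aft v z (nxt n v)" using assms by (auto simp: aft_def nxt_def split: if_splits)
qed

lemma last_nbrs:
  assumes "1 \<le> v" "v \<le> n" shows "nbrs n \<sigma> v ! (length (nbrs n \<sigma> v) - 1) = prv n v"
proof (rule sorted_wrt_lst[OF sorted_nbrs[OF assms] prv_nbr[OF assms]])
  fix z assume "z \<in> set (nbrs n \<sigma> v)"
  then have "1 \<le> z" "z \<le> n" "z \<noteq> v" using assms by (auto simp: nbrs_eq)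
  then show "\<not> aft v (prv n v) z" using assms by (auto simp: aft_def prv_def split: if_splits)
qed

section \<open>Internal arrows and the big cycles around vertices\<close>

lemma internal_arrowI:
  assumes "(i, j) \<in> E" "(j, k) \<in> E" "(i, k) \<in> E"
  shows "((i, j), (i, k)) \<in> int_arrows n \<sigma>" "((i, k), (j, k)) \<in> int_arrows n \<sigma>"
        "((j, k), (i, j)) \<in> int_arrows n \<sigma>"
proof -
  have "(i, j, k) \<in> triangles n \<sigma>" using assms edge_cases by (auto simp: triangles_def)
  then show "((i, j), (i, k)) \<in> int_arrows n \<sigma>" "((i, k), (j, k)) \<in> int_arrows n \<sigma>"
        "((j, k), (i, j)) \<in> int_arrows n \<sigma>"
    unfolding int_arrows_def by force+
qed

lemma internal_arrowE:
  assumes "a \<in> int_arrows n \<sigma>"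
  obtains i j k where "(i, j, k) \<in> triangles n \<sigma>" "i < j" "j < k" "(i, j) \<in> E" "(j, k) \<in> E" "(i, k) \<in> E"
    "a \<in> set (tri_cycle (i, j, k))"
  using assms unfolding int_arrows_def by (auto simp: triangles_def)

text \<open>The edge from \<open>v\<close> to \<open>u\<close> bounds a triangle on the side facing
  \<open>u'\<close>. Its third vertex is again a neighbour of \<open>v\<close> after
  \<open>u\<close>, and it cannot lie beyond \<open>u'\<close> because edges do not cross. Hence it
  is \<open>u'\<close>.\<close>

lemma consecutive_nbrs_arrow:
  assumes v: "1 \<le> v" "v \<le> n" and m: "Suc m < length (nbrs n \<sigma> v)"
  shows "(ed v (nbrs n \<sigma> v ! m), ed v (nbrs n \<sigma> v ! Suc m)) \<in> int_arrows n \<sigma>"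
proof -
  let ?us = "nbrs n \<sigma> v"
  define u u' where uu: "u = ?us ! m" "u' = ?us ! Suc m"
  have mem: "u \<in> set ?us" "u' \<in> set ?us" using m uu by auto
  have auu: "aft v u u'" using sorted_wrt_nth_less[OF sorted_nbrs[OF v], of m "Suc m"] m uu by auto
  have nb: "z = u'" if z: "z \<in> set ?us" "aft v u z" "\<not> aft v u' z" for z
  proof -
    obtain k where k: "k < length ?us" "?us ! k = z" using z(1) by (metis in_set_conv_nth)
    have "\<not> k < m" using sorted_wrt_nth_less[OF sorted_nbrs[OF v], of k m] k m uu z(2) aft_asym by auto
    moreover have "k \<noteq> m" using k uu z(2) aft_irrefl by auto
    moreover have "\<not> Suc m < k" using sorted_wrt_nth_less[OF sorted_nbrs[OF v], of "Suc m" k] k m uu z(3) by auto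
    ultimately have "k = Suc m" by auto
    then show ?thesis using k uu by auto
  qed
  have ub: "u \<noteq> v" "u' \<noteq> v" "ed v u \<in> E" "ed v u' \<in> E" using mem set_nbrs[OF v] by auto
  have ur: "1 \<le> u" "u \<le> n" "1 \<le> u'" "u' \<le> n" using mem v by (auto simp: nbrs_eq[OF v])
  consider (gt) "v < u" | (lt) "u < v" using ub by fastforce
  then show ?thesis
  proof cases
    case gt
    have e: "(v, u) \<in> E" using ub gt by (simp add: ed_less)
    \<comment> \<open>Seen from vertex 1, vertex n comes last, but \<open>u'\<close> comes after
      \<open>u\<close>.\<close>
    have "(v, u) \<noteq> (1, n)" using auu ur by (auto simp: aft_def)
    from e this show ?thesis
    proof (cases rule: outer_apex)
      case (right z)
      then have "z \<in> set ?us" "aft v u z" using gt by (auto simp: set_nbrs[OF v] ed_less aft_def)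
      moreover have "\<not> aft v u' z"
        using nocross_pair[OF _ right(3), of v u'] ub auu gt right(1) by (auto simp: aft_def ed_less)
      ultimately have "z = u'" using nb by auto
      then show ?thesis using internal_arrowI(1)[OF e right(3) right(2)] gt right(1)
        by (simp flip: uu add: ed_less)
    next
      case (left z)
      then have "z \<in> set ?us" "aft v u z" using gt by (auto simp: set_nbrs[OF v] ed_less aft_def)
      moreover have "\<not> aft v u' z"
        using nocross_pair[OF left(3), of v u'] nocross_pair[OF _ left(3), of u' v] ub auu gt left(1)
        by (auto simp: aft_def ed_less)
      ultimately have "z = u'" using nb by auto
      then show ?thesis using internal_arrowI(3)[OF left(2) e left(3)] gt left(1)
        by (simp flip: uu add: ed_less)
    qed
  next
    case lt
    have e: "(u, v) \<in> E" using ub lt by (simp add: ed_less)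
    have "u + 2 \<le> v" using auu lt by (auto simp: aft_def)
    then obtain z where z: "u < z" "z < v" "(u, z) \<in> E" "(z, v) \<in> E" using inner_apex[OF e] by blast
    then have "z \<in> set ?us" "aft v u z" using lt by (auto simp: set_nbrs[OF v] ed_less aft_def)
    moreover have "\<not> aft v u' z"
      using nocross_pair[OF z(3), of u' v] ub auu lt z by (auto simp: aft_def ed_less)
    ultimately have "z = u'" using nb by auto
    then show ?thesis using internal_arrowI(2)[OF z(3,4) e] lt z
      by (simp flip: uu add: ed_less)
  qed
qed

lemma diag_vertex_bounds: "v \<in> diag_vertices \<sigma> \<Longrightarrow> 1 \<le> v \<and> v \<le> n"
  using tri by (auto simp: diag_vertices_def triangulation_def is_diag_def)

lemma arrows_edges:
  assumes "a \<in> Ar" shows "fst a \<in> E" "snd a \<in> E"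
proof -
  have "fst a \<in> E \<and> snd a \<in> E"
    using assms unfolding arrows_def
  proof
    assume "a \<in> int_arrows n \<sigma>"
    then show ?thesis by (auto elim!: internal_arrowE)
  next
    assume "a \<in> ext_arrow n ` diag_vertices \<sigma>"
    then obtain v where "v \<in> diag_vertices \<sigma>" "a = ext_arrow n v" by auto
    then show ?thesis using nxt_nbr[of v] prv_nbr[of v] diag_vertex_bounds[of v]
      by (auto simp: ext_arrow_def set_nbrs ed_def min.commute max.commute)
  qed
  then show "fst a \<in> E" "snd a \<in> E" by auto
qed

lemma nbrs_length:
  assumes "1 \<le> v" "v \<le> n" shows "length (nbrs n \<sigma> v) \<ge> 2"
proof -
  have "card {nxt n v, prv n v} = 2" using assms n3 by (auto simp: nxt_def prv_def)
  moreover have "{nxt n v, prv n v} \<subseteq> set (nbrs n \<sigma> v)" using nxt_nbr prv_nbr assms by auto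
  ultimately show ?thesis using card_length[of "nbrs n \<sigma> v"] card_mono[of "set (nbrs n \<sigma> v)"] 
    by (metis List.finite_set le_trans)
qed

text \<open>A step around \<open>v\<close> has degree 1 exactly when the other endpoint passes from
  above \<open>v\<close> to below \<open>v\<close>. So degrees are drops of an indicator, the sum
  over the internal arrows telescopes, and the external arrow supplies what is missing to 1.\<close>

lemma big_cycle_path:
  assumes v: "v \<in> diag_vertices \<sigma>"
  shows "path_ok Ar (ed v (nxt n v)) (bc v)" "path_end (ed v (nxt n v)) (bc v) = ed v (nxt n v)"
    "weight (bc v) = 1" "map fst (bc v) = map (ed v) (nbrs n \<sigma> v)"
proof -
  let ?us = "nbrs n \<sigma> v" and ?L = "length (nbrs n \<sigma> v)"
  have vb: "1 \<le> v" "v \<le> n" using diag_vertex_bounds[OF v] by auto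
  have L: "?L \<ge> 2" by (rule nbrs_length[OF vb])
  define g where "g m = ed v (?us ! m)" for m
  have g0: "g 0 = ed v (nxt n v)" "g (?L - 1) = ed (prv n v) v"
    using hd_nbrs[OF vb] last_nbrs[OF vb] by (auto simp: g_def ed_def min.commute max.commute)
  have bceq: "bc v = map (\<lambda>m. (g m, g (Suc m))) [0..<?L - 1] @ [ext_arrow n v]"
    by (simp add: big_cycle_def g_def Let_def)
  have "\<And>m. m < ?L - 1 \<Longrightarrow> (g m, g (Suc m)) \<in> Ar"
    using consecutive_nbrs_arrow[OF vb] by (auto simp: arrows_def g_def)
  note P = path_ok_consecutive[of "?L - 1" g, OF this]
  show "path_ok Ar (ed v (nxt n v)) (bc v)"
    using P g0 v unfolding bceq path_ok_append by (auto simp: arrows_def ext_arrow_def)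
  show "path_end (ed v (nxt n v)) (bc v) = ed v (nxt n v)"
    unfolding bceq path_end_append by (simp add: ext_arrow_def)
  have sr: "aft v (?us ! m) (?us ! Suc m)" if "Suc m < ?L" for m
    using sorted_wrt_nth_less[OF sorted_nbrs[OF vb], of m "Suc m"] that by auto
  \<comment> \<open>The indicator that the current neighbour exceeds \<open>v\<close> is the
    invariant; together with the weight so far it keeps its initial value.\<close>
  have "weight (map (\<lambda>m. (g m, g (Suc m))) [0..<k]) + of_bool (?us ! k > v) = of_bool (?us ! 0 > v)"
    if "k < ?L" for k using that
  proof (induction k)
    case (Suc k)
    have "ddeg (g k) (g (Suc k)) + of_bool (?us ! Suc k > v) = of_bool (?us ! k > v)"
      using sr[OF Suc.prems] by (auto simp: g_def aft_def ed_less ddeg_def)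
    then show ?case using Suc by simp
  qed simp
  from this[of "?L - 1"] have "weight (map (\<lambda>m. (g m, g (Suc m))) [0..<?L - 1])
      + of_bool (prv n v > v) = of_bool (nxt n v > v)"
    using L hd_nbrs[OF vb] last_nbrs[OF vb] by simp
  moreover have "ddeg (ed (prv n v) v) (ed v (nxt n v)) + of_bool (nxt n v > v) = of_bool (prv n v > v) + 1"
    using vb n3 by (auto simp: ddeg_def prv_def nxt_def ed_def min_def max_def)
  ultimately show "weight (bc v) = 1" unfolding bceq by (simp add: ext_arrow_def)
  have "map fst (bc v) = map g [0..<?L - 1] @ [g (?L - 1)]"
    unfolding bceq using g0 by (simp add: ext_arrow_def)
  also have "\<dots> = map g [0..<?L]" using L
    by (metis One_nat_def Suc_pred list.map(1) list.map(2) map_append upt_Suc_append zero_le less_le_trans zero_less_numeral)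
  also have "\<dots> = map (ed v) ?us" by (rule nth_equalityI) (auto simp: g_def)
  finally show "map fst (bc v) = map (ed v) (nbrs n \<sigma> v)" .
qed

lemma big_cycle_distinct:
  assumes v: "v \<in> diag_vertices \<sigma>" shows "distinct (map fst (bc v))"
proof -
  have vb: "1 \<le> v" "v \<le> n" using diag_vertex_bounds[OF v] by auto
  show ?thesis unfolding big_cycle_path(4)[OF v] distinct_map
    using distinct_nbrs[OF vb] by (auto simp: inj_on_def set_nbrs[OF vb] ed_inj)
qed

lemma big_cycle_arrow:
  assumes v: "v \<in> diag_vertices \<sigma>" and a: "a \<in> set (bc v)"
  shows "a \<in> Ar" "incident v (fst a)" "incident v (snd a)"
proof -
  have vb: "1 \<le> v" "v \<le> n" using diag_vertex_bounds[OF v] by auto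
  have c: "a \<in> int_arrows n \<sigma> \<or> a = ext_arrow n v" "incident v (fst a)" "incident v (snd a)"
    using a consecutive_nbrs_arrow[OF vb]
    by (auto simp: big_cycle_def Let_def incident_def ext_arrow_def ed_def min_def max_def split: if_splits)
  show "a \<in> Ar" "incident v (fst a)" "incident v (snd a)" using c v by (auto simp: arrows_def)
qed

lemma ext_arrow_last: "ext_arrow n v \<in> set (bc v)"
  by (simp add: big_cycle_def Let_def)

text \<open>Converse of \<open>consecutive_nbrs_arrow\<close>: an edge from \<open>v\<close> into
  the open angle of a triangle at \<open>v\<close> would cross the opposite side, so the two sides
  of the triangle at \<open>v\<close> are consecutive around \<open>v\<close>.\<close>

lemma internal_in_big_cycle:
  assumes v: "1 \<le> v" "v \<le> n" and a: "a \<in> int_arrows n \<sigma>" "incident v (fst a)" "incident v (snd a)"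
  shows "a \<in> set (bc v)"
proof -
  let ?us = "nbrs n \<sigma> v"
  obtain i j k where T: "i < j" "j < k" "(i, j) \<in> E" "(j, k) \<in> E" "(i, k) \<in> E"
    "a \<in> set (tri_cycle (i, j, k))" using internal_arrowE[OF a(1)] by metis
  have "\<exists>u u'. a = (ed v u, ed v u') \<and> u \<in> set ?us \<and> u' \<in> set ?us \<and> aft v u u'
     \<and> (\<forall>z \<in> set ?us. aft v u z \<longrightarrow> aft v z u' \<longrightarrow> False)"
  proof -
    consider (1) "a = ((i, j), (i, k))" "v = i" | (2) "a = ((i, k), (j, k))" "v = k"
      | (3) "a = ((j, k), (i, j))" "v = j"
      using T a by (auto simp: incident_def)
    then show ?thesis
    proof cases
      case 1
      show ?thesis
        by (rule exI[of _ j], rule exI[of _ k],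
            use 1 T nocross_pair[OF _ T(4), of i] v in \<open>auto simp: set_nbrs ed_less aft_def\<close>)
    next
      case 2
      show ?thesis
        by (rule exI[of _ i], rule exI[of _ j],
            use 2 T nocross_pair[OF T(3), of _ k] v in \<open>auto simp: set_nbrs ed_less aft_def\<close>)
    next
      case 3
      have "\<forall>z\<in>set ?us. aft j k z \<longrightarrow> aft j z i \<longrightarrow> False"
      proof (intro ballI impI)
        fix z assume "z \<in> set ?us" "aft j k z" "aft j z i"
        then show False using nocross_pair[OF T(5), of j z] nocross_pair[OF _ T(5), of z j] T(1,2) v 3
          by (auto simp: aft_def ed_less set_nbrs)
      qed
      moreover have "k \<in> set ?us" "i \<in> set ?us" "aft j k i"
        using 3 T v by (auto simp: set_nbrs ed_less aft_def)
      ultimately show ?thesis using 3 T(1,2) by (force simp: ed_less)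
    qed
  qed
  then obtain u u' where u: "a = (ed v u, ed v u')" "u \<in> set ?us" "u' \<in> set ?us" "aft v u u'"
     "\<And>z. z \<in> set ?us \<Longrightarrow> aft v u z \<Longrightarrow> aft v z u' \<Longrightarrow> False" by blast
  obtain m where "Suc m < length ?us" "?us ! m = u" "?us ! Suc m = u'"
    using sorted_wrt_consecutive[of "aft v" ?us u u', OF sorted_nbrs[OF v]] u(2-5) aft_irrefl aft_asym by blast
  then show ?thesis using u(1) by (force simp: big_cycle_def Let_def)
qed

lemma diag_vertex_iff: "(i, j) \<in> E \<Longrightarrow> (i, j) \<notin> sides n \<Longrightarrow> i \<in> diag_vertices \<sigma> \<and> j \<in> diag_vertices \<sigma>"
  by (force simp: edges_def diag_vertices_def)

lemma diag_vertex_n: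
  assumes "v \<in> diag_vertices \<sigma>" shows "n \<ge> 4"
proof -
  obtain d where "is_diag n d" using assms tri by (auto simp: diag_vertices_def triangulation_def)
  then show ?thesis by (cases d) (auto simp: is_diag_def)
qed

lemma arrow_in_big_cycle:
  assumes v: "v \<in> diag_vertices \<sigma>" and a: "a \<in> Ar" "incident v (fst a)" "incident v (snd a)"
  shows "a \<in> set (bc v)"
  using a(1) unfolding arrows_def
proof
  assume "a \<in> int_arrows n \<sigma>"
  then show ?thesis using internal_in_big_cycle a diag_vertex_bounds[OF v] by blast
next
  assume "a \<in> ext_arrow n ` diag_vertices \<sigma>"
  then obtain x where x: "x \<in> diag_vertices \<sigma>" "a = ext_arrow n x" by auto
  have "v = x" using a(2,3) diag_vertex_bounds[OF x(1)] diag_vertex_bounds[OF v] diag_vertex_n[OF v]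
    unfolding x(2) by (auto simp: incident_def ext_arrow_def ed_def prv_def nxt_def min_def max_def split: if_splits)
  then show ?thesis using x ext_arrow_last by auto
qed

text \<open>A triangle with two polygon sides cuts off their common vertex, and a diagonal at that
  vertex would cross the third side. Hence an internal arrow between two frozen vertices lies on no
  big cycle.\<close>

lemma side_side_not_diag_vertex:
  assumes T: "(i, j, k) \<in> triangles n \<sigma>" and a: "a \<in> set (tri_cycle (i, j, k))"
    and s: "fst a \<in> sides n" "snd a \<in> sides n" and v: "incident v (fst a)" "incident v (snd a)"
  shows "v \<notin> diag_vertices \<sigma>"
proof
  assume "v \<in> diag_vertices \<sigma>"
  then obtain d where d: "d \<in> \<sigma>" "incident v d" by (auto simp: diag_vertices_def incident_def)
  obtain p q where pq: "d = (p, q)" by (cases d)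
  have dE: "(p, q) \<in> E" and dd: "is_diag n (p, q)" using d pq tri by (auto simp: edges_def triangulation_def)
  have T': "i < j" "j < k" "(i, j) \<in> E" "(j, k) \<in> E" "(i, k) \<in> E" using T by (auto simp: triangles_def)
  note b = edge_cases[OF T'(3)] edge_cases[OF T'(4)]
  have dv: "p = v \<or> q = v" "1 \<le> p" "p + 2 \<le> q" "q \<le> n" "p = 1 \<Longrightarrow> q \<noteq> n"
    using d(2) dd by (auto simp: pq is_diag_def incident_def)
  consider (1) "a = ((i, j), (i, k))" "v = i" | (2) "a = ((i, k), (j, k))" "v = k"
    | (3) "a = ((j, k), (i, j))" "v = j"
    using T'(1,2) a v by (auto simp: incident_def)
  then show False
  proof cases
    case 1
    then have "i = 1" "k = n" "j = 2" using s T'(1,2) b by (auto simp: sides_def is_side_def)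
    then show False using nocross_pair[OF dE T'(4)] dv 1 by auto
  next
    case 2
    then have "i = 1" "k = n" "Suc j = n" using s T'(1,2) b by (auto simp: sides_def is_side_def)
    then show False using nocross_pair[OF T'(3) dE] dv 2 by auto
  next
    case 3
    then have "k = Suc j" "Suc i = j" using s T'(1,2) b by (auto simp: sides_def is_side_def)
    then show False using nocross_pair[OF T'(5) dE] nocross_pair[OF dE T'(5)] dv 3 by auto
  qed
qed

text \<open>Deleting \<open>a\<close> from its triangle and reading on from the end of
  \<open>a\<close> leaves \<open>r\<close>. This is the triangle term of the cyclic derivative by
  \<open>a\<close>; \<open>big_rest\<close> describes the big-cycle term.\<close>

definition tri_rest :: "arrow \<Rightarrow> arrow list \<Rightarrow> bool" where
  "tri_rest a r \<longleftrightarrow> (\<exists>T\<in>triangles n \<sigma>. \<exists>us vs. tri_cycle T = us @ a # vs \<and> r = vs @ us)"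

definition big_rest :: "nat \<Rightarrow> arrow \<Rightarrow> arrow list \<Rightarrow> bool" where
  "big_rest v a r \<longleftrightarrow> v \<in> diag_vertices \<sigma> \<and> (\<exists>us vs. bc v = us @ a # vs \<and> r = vs @ us)"

end

subsection \<open>Geodesic paths in the quiver\<close>

text \<open>Passes from the complement of one arrow in a cyclic word to the complement of the next
  arrow in the same word.\<close>

lemma rotate_step:
  assumes "ws = us @ a # vs" "vs @ us = b # t"
  shows "\<exists>us' vs'. ws = us' @ b # vs' \<and> t @ [a] = vs' @ us'"
proof (cases vs)
  case Nil
  then have "ws = [] @ b # (t @ [a])" using assms by simp
  then show ?thesis by fastforce
next
  case (Cons c vs')
  then have "ws = (us @ [a]) @ b # vs'" "t @ [a] = vs' @ (us @ [a])" using assms by auto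
  then show ?thesis by blast
qed

lemma ddeg_self [simp]: "ddeg e e = 0" if "fst e < snd e"
  using that by (auto simp: ddeg_def)

text \<open>A shift that carries column \<open>e\<close> into \<open>f\<close>, followed by one that
  carries \<open>f\<close> into \<open>g\<close>, carries \<open>e\<close> into
  \<open>g\<close>.\<close>

lemma ddeg_triangle:
  assumes "fst e < snd e" "fst f < snd f" "fst g < snd g"
  shows "ddeg e g \<le> ddeg e f + ddeg f g"
  using assms unfolding ddeg_def by auto

context triangulated_polygon
begin

section \<open>The two cyclic complements of an arrow\<close>

lemma tri_rest_iff:
  "tri_rest a r \<longleftrightarrow> (\<exists>i j k. (i, j) \<in> E \<and> (j, k) \<in> E \<and> (i, k) \<in> E \<and>
     (a = ((i, j), (i, k)) \<and> r = [((i, k), (j, k)), ((j, k), (i, j))]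
    \<or> a = ((i, k), (j, k)) \<and> r = [((j, k), (i, j)), ((i, j), (i, k))]
    \<or> a = ((j, k), (i, j)) \<and> r = [((i, j), (i, k)), ((i, k), (j, k))]))" (is "_ = ?R")
proof
  assume "tri_rest a r"
  then obtain i j k us vs where T: "(i, j, k) \<in> triangles n \<sigma>" "tri_cycle (i, j, k) = us @ a # vs" "r = vs @ us"
    by (auto simp: tri_rest_def)
  have "(i, j) \<in> E" "(j, k) \<in> E" "(i, k) \<in> E" using T(1) by (auto simp: triangles_def)
  moreover have "a = ((i, j), (i, k)) \<and> r = [((i, k), (j, k)), ((j, k), (i, j))]
    \<or> a = ((i, k), (j, k)) \<and> r = [((j, k), (i, j)), ((i, j), (i, k))]
    \<or> a = ((j, k), (i, j)) \<and> r = [((i, j), (i, k)), ((i, k), (j, k))]"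
    using T(2,3) by (auto simp: Cons_eq_append_conv)
  ultimately show ?R by blast
next
  assume ?R
  then obtain i j k where e: "(i, j) \<in> E" "(j, k) \<in> E" "(i, k) \<in> E"
    and c: "a = ((i, j), (i, k)) \<and> r = [((i, k), (j, k)), ((j, k), (i, j))]
    \<or> a = ((i, k), (j, k)) \<and> r = [((j, k), (i, j)), ((i, j), (i, k))]
    \<or> a = ((j, k), (i, j)) \<and> r = [((i, j), (i, k)), ((i, k), (j, k))]" by blast
  have T: "(i, j, k) \<in> triangles n \<sigma>" using e edge_cases by (auto simp: triangles_def)
  from c show "tri_rest a r"
  proof (elim disjE conjE)
    assume "a = ((i, j), (i, k))" "r = [((i, k), (j, k)), ((j, k), (i, j))]"
    then have "tri_cycle (i, j, k) = [] @ a # r \<and> r = r @ []" by simp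
    then show ?thesis unfolding tri_rest_def using T by blast
  next
    assume "a = ((i, k), (j, k))" "r = [((j, k), (i, j)), ((i, j), (i, k))]"
    then have "tri_cycle (i, j, k) = [((i, j), (i, k))] @ a # [((j, k), (i, j))]
      \<and> r = [((j, k), (i, j))] @ [((i, j), (i, k))]" by simp
    then show ?thesis unfolding tri_rest_def using T by blast
  next
    assume "a = ((j, k), (i, j))" "r = [((i, j), (i, k)), ((i, k), (j, k))]"
    then have "tri_cycle (i, j, k) = [((i, j), (i, k)), ((i, k), (j, k))] @ a # []
      \<and> r = [] @ [((i, j), (i, k)), ((i, k), (j, k))]" by simp
    then show ?thesis unfolding tri_rest_def using T by blast
  qed
qed

lemma tri_restI:
  assumes "(i, j) \<in> E" "(j, k) \<in> E" "(i, k) \<in> E"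
  shows "tri_rest ((i, j), (i, k)) [((i, k), (j, k)), ((j, k), (i, j))]"
    "tri_rest ((i, k), (j, k)) [((j, k), (i, j)), ((i, j), (i, k))]"
    "tri_rest ((j, k), (i, j)) [((i, j), (i, k)), ((i, k), (j, k))]"
  unfolding tri_rest_iff using assms by blast+

lemma tri_rest_path:
  assumes "tri_rest a r"
  shows "a \<in> int_arrows n \<sigma>" "path_ok Ar (snd a) r" "path_end (snd a) r = fst a"
    "ddeg (fst a) (snd a) + weight r = 1" "r \<noteq> []"
proof -
  obtain i j k where e: "(i, j) \<in> E" "(j, k) \<in> E" "(i, k) \<in> E"
    and c: "a = ((i, j), (i, k)) \<and> r = [((i, k), (j, k)), ((j, k), (i, j))]
    \<or> a = ((i, k), (j, k)) \<and> r = [((j, k), (i, j)), ((i, j), (i, k))]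
    \<or> a = ((j, k), (i, j)) \<and> r = [((i, j), (i, k)), ((i, k), (j, k))]"
    using assms unfolding tri_rest_iff by blast
  have "i < j" "j < k" using e edge_cases by auto
  then show "a \<in> int_arrows n \<sigma>" "path_ok Ar (snd a) r" "path_end (snd a) r = fst a"
    "ddeg (fst a) (snd a) + weight r = 1" "r \<noteq> []"
    using c internal_arrowI[OF e] by (auto simp: arrows_def ddeg_def)
qed

lemma big_rest_path:
  assumes "big_rest v a r"
  shows "a \<in> Ar" "path_ok Ar (snd a) r" "path_end (snd a) r = fst a"
    "ddeg (fst a) (snd a) + weight r = 1" "r \<noteq> []" "incident v (fst a)" "incident v (snd a)"
    "v \<in> diag_vertices \<sigma>" "set r \<subseteq> set (bc v)" "a \<in> set (bc v)"
proof -
  obtain us vs where v: "v \<in> diag_vertices \<sigma>" and d: "bc v = us @ a # vs" "r = vs @ us"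
    using assms by (auto simp: big_rest_def)
  note P = big_cycle_path[OF v]
  show "path_ok Ar (snd a) r" "path_end (snd a) r = fst a"
    using closed_path_rotate P(1,2) unfolding d by blast+
  show "a \<in> Ar" "incident v (fst a)" "incident v (snd a)" "set r \<subseteq> set (bc v)" "a \<in> set (bc v)"
    using big_cycle_arrow[OF v] d by auto
  show "ddeg (fst a) (snd a) + weight r = 1" using P(3) d by simp
  have "length (bc v) \<ge> 2"
    using arg_cong[OF P(4), of length] nbrs_length diag_vertex_bounds[OF v] by auto
  then show "r \<noteq> []" using d by auto
qed (use assms in \<open>auto simp: big_rest_def\<close>)

lemma big_rest_exists:
  assumes "v \<in> diag_vertices \<sigma>" "a \<in> Ar" "incident v (fst a)" "incident v (snd a)"
  shows "\<exists>r. big_rest v a r"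
  using split_list[OF arrow_in_big_cycle[OF assms]] assms(1) unfolding big_rest_def by blast

text \<open>The arrows of a big cycle have distinct sources, so the source of the deleted arrow
  determines both the arrow and the complement.\<close>

lemma big_rest_unique:
  assumes "big_rest v a r" "big_rest v b s" "fst a = fst b"
  shows "a = b" "r = s"
proof -
  have v: "v \<in> diag_vertices \<sigma>" using assms(1) big_rest_path(8) by blast
  note dis = big_cycle_distinct[OF v]
  show ab: "a = b" using big_rest_path(10)[OF assms(1)] big_rest_path(10)[OF assms(2)] assms(3) dis
    by (auto simp: distinct_map inj_on_def)
  obtain us vs where d: "bc v = us @ a # vs" "r = vs @ us"
    using assms(1) by (auto simp: big_rest_def)
  obtain us' vs' where d': "bc v = us' @ a # vs'" "s = vs' @ us'"
    using assms(2) ab by (auto simp: big_rest_def)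
  have "distinct (bc v)" using dis by (simp add: distinct_map)
  then have "us = us' \<and> vs = vs'" using d(1) d'(1)
    by (metis append_Cons_eq_iff distinct_append not_distinct_conv_prefix distinct.simps(2) disjoint_iff list.set_intros(1))
  then show "r = s" using d d' by simp
qed

lemma tri_rest_step: "tri_rest a (b # t) \<Longrightarrow> tri_rest b (t @ [a])"
  unfolding tri_rest_def using rotate_step by metis

lemma big_rest_step: "big_rest v a (b # t) \<Longrightarrow> big_rest v b (t @ [a])"
  unfolding big_rest_def using rotate_step by metis

text \<open>Rule \<open>rel\<close> equates the two terms of one cyclic derivative. The words carry
  no starting edge; that validity and endpoints are respected is established in
  \<open>pcong_sound\<close>.\<close>

inductive pcong :: "arrow list \<Rightarrow> arrow list \<Rightarrow> bool" where
  rel: "tri_rest a r \<Longrightarrow> big_rest v a s \<Longrightarrow> pcong r s"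
| refl [simp, intro!]: "pcong p p"
| sym: "pcong p q \<Longrightarrow> pcong q p"
| trans [trans]: "pcong p q \<Longrightarrow> pcong q r \<Longrightarrow> pcong p r"
| ctxt: "pcong p q \<Longrightarrow> pcong (u @ p @ v) (u @ q @ v)"

lemma pcong_left: "pcong p q \<Longrightarrow> pcong (u @ p) (u @ q)"
  and pcong_right: "pcong p q \<Longrightarrow> pcong (p @ v) (q @ v)"
  and pcong_Cons: "pcong p q \<Longrightarrow> pcong (a # p) (a # q)"
  using pcong.ctxt[of p q u "[]"] pcong.ctxt[of p q "[]" v] pcong.ctxt[of p q "[a]" "[]"] by auto

lemma path_edges:
  assumes "path_ok Ar e p" "e \<in> E" shows "path_end e p \<in> E"
  using assms by (induction p arbitrary: e) (auto simp: arrows_edges)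

lemma ddeg_tri: "e \<in> E \<Longrightarrow> f \<in> E \<Longrightarrow> g \<in> E \<Longrightarrow> ddeg e g \<le> ddeg e f + ddeg f g"
  using ddeg_triangle edge_bounds by blast

lemma ddeg_edge_self [simp]: "e \<in> E \<Longrightarrow> ddeg e e = 0"
  using edge_bounds by simp

lemma ddeg_le_weight:
  assumes "path_ok Ar e p" "e \<in> E" shows "ddeg e (path_end e p) \<le> weight p"
  using assms
proof (induction p arbitrary: e)
  case (Cons a p)
  then have "ddeg (snd a) (path_end e (a # p)) \<le> weight p" "snd a \<in> E" "path_end e (a # p) \<in> E"
    using arrows_edges path_edges by auto
  moreover have "ddeg e (path_end e (a # p)) \<le> ddeg e (snd a) + ddeg (snd a) (path_end e (a # p))"
    using ddeg_tri Cons.prems calculation by blast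
  ultimately show ?case using Cons.prems by simp
qed simp

text \<open>An arrow turning an edge anticlockwise from \<open>(i,j)\<close> to \<open>(i',j')\<close> moves its endpoints by
  \<open>n ddeg + i' + j' - i - j > 0\<close> steps along the polygon.\<close>

lemma arrow_displacement:
  assumes "a \<in> Ar"
  shows "fst (fst a) + snd (fst a) < n * ddeg (fst a) (snd a) + fst (snd a) + snd (snd a)"
  using assms unfolding arrows_def
proof
  assume "a \<in> int_arrows n \<sigma>"
  then obtain i j k where T: "i < j" "j < k" "(i, j) \<in> E" "(j, k) \<in> E" "(i, k) \<in> E"
    "a \<in> set (tri_cycle (i, j, k))" using internal_arrowE by metis
  then show ?thesis using edge_cases[OF T(5)] by (auto simp: ddeg_def)
next
  assume "a \<in> ext_arrow n ` diag_vertices \<sigma>"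
  then obtain v where v: "v \<in> diag_vertices \<sigma>" "a = ext_arrow n v" by auto
  then show ?thesis using diag_vertex_bounds[OF v(1)] n3
    by (auto simp: ext_arrow_def ddeg_def prv_def nxt_def ed_def min_def max_def)
qed

text \<open>Every arrow contributes at least one step, so displacement bounds length. In particular
  a closed path of weight 0 is empty.\<close>

lemma path_displacement:
  assumes "path_ok Ar e p"
  shows "fst e + snd e + length p \<le> n * weight p + fst (path_end e p) + snd (path_end e p)"
  using assms
proof (induction p arbitrary: e)
  case (Cons a p)
  then have "fst (snd a) + snd (snd a) + length p
      \<le> n * weight p + fst (path_end e (a # p)) + snd (path_end e (a # p))" by auto
  then show ?case using arrow_displacement[of a] Cons.prems by (auto simp: distrib_left)
qed simp

section \<open>Paths of minimal weight and the arrows on them\<close>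

definition geodesic :: "edge \<Rightarrow> edge \<Rightarrow> arrow list \<Rightarrow> bool" where
  "geodesic e f p \<longleftrightarrow> path_ok Ar e p \<and> path_end e p = f \<and> weight p = ddeg e f"

text \<open>Equality in the triangle inequality: by \<open>geodesic_Cons\<close> and
  \<open>geodesic_exists\<close> these are the arrows that can begin a minimal path to
  \<open>f\<close>.\<close>

definition good :: "edge \<Rightarrow> arrow \<Rightarrow> bool" where
  "good f a \<longleftrightarrow> ddeg (fst a) f = ddeg (fst a) (snd a) + ddeg (snd a) f"

text \<open>The displacement still to be made on the way to \<open>f\<close>, up to a constant
  depending on \<open>f\<close>. As both endpoints are at most n, the summand 2 n keeps the
  subtraction from being truncated.\<close>

definition edist :: "edge \<Rightarrow> edge \<Rightarrow> nat" where
  "edist f e = n * ddeg e f + 2 * n - (fst e + snd e)"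

lemma good_edist:
  assumes "a \<in> Ar" "good f a" shows "edist f (snd a) < edist f (fst a)"
proof -
  have "fst (fst a) + snd (fst a) \<le> 2 * n" "fst (snd a) + snd (snd a) \<le> 2 * n"
    using edge_bounds arrows_edges[OF assms(1)] by fastforce+
  moreover have "n * ddeg (fst a) f = n * ddeg (fst a) (snd a) + n * ddeg (snd a) f"
    using assms(2) by (simp add: good_def distrib_left)
  ultimately show ?thesis using arrow_displacement[OF assms(1)] unfolding edist_def by linarith
qed

lemma geodesic_Cons:
  assumes "e \<in> E" "f \<in> E"
  shows "geodesic e f (a # p) \<longleftrightarrow> a \<in> Ar \<and> fst a = e \<and> good f a \<and> geodesic (snd a) f p"
proof
  assume g: "geodesic e f (a # p)"
  then have "ddeg (snd a) f \<le> weight p" using ddeg_le_weight[of "snd a" p] arrows_edges by (auto simp: geodesic_def)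
  moreover have "ddeg e f \<le> ddeg e (snd a) + ddeg (snd a) f"
    using g ddeg_tri assms arrows_edges by (auto simp: geodesic_def)
  ultimately show "a \<in> Ar \<and> fst a = e \<and> good f a \<and> geodesic (snd a) f p"
    using g by (auto simp: geodesic_def good_def)
qed (auto simp: geodesic_def good_def)

lemma geodesic_append:
  assumes "path_ok Ar e p" "weight p + ddeg (path_end e p) f = ddeg e f" "geodesic (path_end e p) f q"
  shows "geodesic e f (p @ q)"
  using assms by (auto simp: geodesic_def)

text \<open>A cycle of weight one has total slack one in the triangle inequalities towards \<open>f\<close>, so at
  most one of its arrows fails to be good.\<close>

lemma bad_rest:
  assumes "a \<in> Ar" "path_ok Ar (snd a) r" "path_end (snd a) r = fst a"
    "ddeg (fst a) (snd a) + weight r = 1" "\<not> good f a" "f \<in> E"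
  shows "weight r + ddeg (fst a) f = ddeg (snd a) f"
proof -
  have "ddeg (fst a) f \<le> ddeg (fst a) (snd a) + ddeg (snd a) f"
    using ddeg_tri arrows_edges[OF assms(1)] assms(6) by auto
  moreover have "ddeg (snd a) f \<le> ddeg (snd a) (fst a) + ddeg (fst a) f"
    using ddeg_tri arrows_edges[OF assms(1)] assms(6) by auto
  moreover have "ddeg (snd a) (fst a) \<le> weight r"
    using ddeg_le_weight[OF assms(2)] assms(3) arrows_edges[OF assms(1)] by auto
  ultimately show ?thesis using assms(4,5) unfolding good_def by linarith
qed

lemma diag_vertexI:
  assumes "(i, j) \<in> E" "i + 2 \<le> j" "(i, j) \<noteq> (1, n)"
  shows "i \<in> diag_vertices \<sigma>" "j \<in> diag_vertices \<sigma>"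
  using diag_vertex_iff[OF assms(1)] assms(2,3) by (auto simp: sides_def is_side_def)

text \<open>The cases \<open>r\<close>, \<open>l\<close>, \<open>y\<close> turn the edge about
  \<open>i\<close>, the cases \<open>m\<close>, \<open>x\<close>, \<open>z\<close> about
  \<open>j\<close>. The external arrows \<open>x\<close>, \<open>y\<close>, \<open>z\<close> are
  kept apart because the stored form of an edge changes at the vertices 1 and n.\<close>

lemma out_arrow_cases:
  assumes "a \<in> Ar" "fst a = (i, j)"
  obtains (r) k where "j < k" "a = ((i, j), (i, k))" "(i, k) \<in> E" "(j, k) \<in> E"
  | (l) k where "k < i" "a = ((i, j), (k, i))" "(k, i) \<in> E" "(k, j) \<in> E"
  | (m) k where "i < k" "k < j" "a = ((i, j), (k, j))" "(i, k) \<in> E" "(k, j) \<in> E"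
  | (x) "j = Suc i" "j < n" "j \<in> diag_vertices \<sigma>" "a = ((i, j), (j, Suc j))"
  | (y) "i = 1" "j = n" "1 \<in> diag_vertices \<sigma>" "a = ((i, j), (1, 2))"
  | (z) "Suc i = n" "j = n" "n \<in> diag_vertices \<sigma>" "a = ((i, j), (1, n))"
proof -
  from assms(1) consider "a \<in> int_arrows n \<sigma>" | v where "v \<in> diag_vertices \<sigma>" "a = ext_arrow n v"
    by (auto simp: arrows_def)
  then show ?thesis
  proof cases
    case 1
    then obtain i' j' k' where T: "i' < j'" "j' < k'" "(i', j') \<in> E" "(j', k') \<in> E" "(i', k') \<in> E"
      "a \<in> set (tri_cycle (i', j', k'))" using internal_arrowE by metis
    then have "a = ((i', j'), (i', k')) \<or> a = ((i', k'), (j', k')) \<or> a = ((j', k'), (i', j'))" by simp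
    then show ?thesis using T assms(2) r[of k'] l[of i'] m[of j'] by auto
  next
    case (2 v)
    have vb: "1 \<le> v" "v \<le> n" using diag_vertex_bounds[OF 2(1)] by auto
    consider "v = 1" | "v = n" "v \<noteq> 1" | "1 < v" "v < n" using vb by linarith
    then show ?thesis
    proof cases
      case 1
      then have "a = ((1, n), (1, 2))"
        using 2(2) n3 by (simp add: ext_arrow_def prv_def nxt_def ed_def numeral_2_eq_2)
      with assms(2) 2(1) 1 show ?thesis by (intro y) simp_all
    next
      case b: 2
      then have "a = ((n - 1, n), (1, n))"
        using 2(2) n3 by (simp add: ext_arrow_def prv_def nxt_def ed_def)
      with assms(2) 2(1) b(1) n3 show ?thesis by (intro z) auto
    next
      case 3
      then have "a = ((v - 1, v), (v, Suc v))"
        using 2(2) n3 by (simp add: ext_arrow_def prv_def nxt_def ed_def)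
      with assms(2) 2(1) 3 show ?thesis by (intro x) auto
    qed
  qed
qed

lemma out_internal:
  assumes "(i, j) \<in> E"
  shows "\<exists>a r. fst a = (i, j) \<and> tri_rest a r"
proof (cases "(i, j) = (1, n)")
  case True
  then obtain k where "(i, k) \<in> E" "(k, j) \<in> E" using inner_apex[OF assms] n3 by auto
  then show ?thesis using tri_restI(2)[OF _ _ assms] by (metis fst_conv)
next
  case False
  from assms this show ?thesis
  proof (cases rule: outer_apex)
    case (right k)
    then show ?thesis using tri_restI(1)[OF assms] by (metis fst_conv)
  next
    case (left k)
    then show ?thesis using tri_restI(3)[OF _ assms] by (metis fst_conv)
  qed
qed

section \<open>Goodness of each kind of arrow in coordinates\<close>

lemma good_right_iff:
  "i < j \<Longrightarrow> j < k \<Longrightarrow> good (p, q) ((i, j), (i, k)) \<longleftrightarrow> q < j \<or> k \<le> q \<or> p < i"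
  by (auto simp: good_def ddeg_def)

lemma good_middle_iff:
  "i < j \<Longrightarrow> j < k \<Longrightarrow> p < q \<Longrightarrow>
    good (p, q) ((i, k), (j, k)) \<longleftrightarrow> \<not> (i \<le> q \<and> q < j \<or> i \<le> p \<and> p < j \<and> k \<le> q)"
  by (auto simp: good_def ddeg_def)

lemma good_left_iff:
  "i < j \<Longrightarrow> j < k \<Longrightarrow> p < q \<Longrightarrow>
    good (p, q) ((j, k), (i, j)) \<longleftrightarrow> i \<le> q \<and> (q < j \<or> i \<le> p \<and> (p < j \<or> q < k))"
  by (auto simp: good_def ddeg_def)

lemma good_ext_iff:
  "p < q \<Longrightarrow> good (p, q) ((i, Suc i), (Suc i, Suc (Suc i))) \<longleftrightarrow> p \<noteq> i \<and> q \<noteq> i"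
  by (auto simp: good_def ddeg_def)

lemma good_ext_first_iff:
  "1 \<le> p \<Longrightarrow> p < q \<Longrightarrow> good (p, q) ((1, n), (1, 2)) \<longleftrightarrow> q < n"
  using n3 by (auto simp: good_def ddeg_def)

lemma good_ext_last_iff:
  "1 \<le> p \<Longrightarrow> p < q \<Longrightarrow> q \<le> n \<Longrightarrow> Suc i = n \<Longrightarrow> good (p, q) ((i, n), (1, n)) \<longleftrightarrow> p \<noteq> i \<and> q \<noteq> i"
  using n3 by (auto simp: good_def ddeg_def)

lemma ext_arrowI:
  "j \<in> diag_vertices \<sigma> \<Longrightarrow> j = Suc i \<Longrightarrow> 1 \<le> i \<Longrightarrow> j < n \<Longrightarrow> ((i, Suc i), (Suc i, Suc (Suc i))) \<in> Ar"
  "1 \<in> diag_vertices \<sigma> \<Longrightarrow> ((1, n), (1, 2)) \<in> Ar"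
  "n \<in> diag_vertices \<sigma> \<Longrightarrow> Suc i = n \<Longrightarrow> ((i, n), (1, n)) \<in> Ar"
proof -
  have ext: "ext_arrow n v \<in> Ar" if "v \<in> diag_vertices \<sigma>" for v
    using that by (simp add: arrows_def)
  show "j \<in> diag_vertices \<sigma> \<Longrightarrow> j = Suc i \<Longrightarrow> 1 \<le> i \<Longrightarrow> j < n \<Longrightarrow> ((i, Suc i), (Suc i, Suc (Suc i))) \<in> Ar"
    using ext[of j] by (simp add: ext_arrow_def prv_def nxt_def ed_def)
  show "1 \<in> diag_vertices \<sigma> \<Longrightarrow> ((1, n), (1, 2)) \<in> Ar"
    using ext[of 1] n3 by (simp add: ext_arrow_def prv_def nxt_def ed_def numeral_2_eq_2)
  show "n \<in> diag_vertices \<sigma> \<Longrightarrow> Suc i = n \<Longrightarrow> ((i, n), (1, n)) \<in> Ar"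
    using ext[of n] n3 by (auto simp: ext_arrow_def prv_def nxt_def ed_def)
qed

text \<open>Suppose all arrows out of (i,j) are bad. Badness of the internal ones confines (p,q) to
  a region that, since edges do not cross, forces (i,j) to be a side. Another side of its triangle
  is then a diagonal at the vertex about which the external arrow turns, so this external arrow
  exists; it is good, a contradiction.\<close>

lemma good_arrow_exists:
  assumes e: "(i, j) \<in> E" and f: "(p, q) \<in> E" and ne: "(i, j) \<noteq> (p, q)"
  shows "\<exists>a\<in>Ar. fst a = (i, j) \<and> good (p, q) a"
proof (rule ccontr)
  assume H: "\<not> ?thesis"
  have bad: "\<not> good (p, q) ((i, j), b)" if "((i, j), b) \<in> Ar" for b
    using H that by force
  note be = edge_cases[OF e] and bf = edge_cases[OF f]
  have nij: "i \<noteq> p \<or> j \<noteq> q" using ne by simp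
  have int: "((i, j), b) \<in> Ar" if "((i, j), b) \<in> int_arrows n \<sigma>" for b
    using that by (simp add: arrows_def)
  note nef = nocross_pair[OF e f] nocross_pair[OF f e]
  have side: "j = Suc i" if "\<And>l. i < l \<Longrightarrow> l < j \<Longrightarrow> (i, l) \<in> E \<Longrightarrow> (l, j) \<in> E \<Longrightarrow> False"
  proof (rule ccontr)
    assume "j \<noteq> Suc i"
    then have "i + 2 \<le> j" using be by simp
    then show False using inner_apex[OF e] that by blast
  qed
  have inner: "i \<le> q \<and> q < l \<or> i \<le> p \<and> p < l \<and> j \<le> q" if "i < l" "l < j" "(i, l) \<in> E" "(l, j) \<in> E" for l
    using bad[OF int[OF internal_arrowI(2)[OF that(3,4) e]]] good_middle_iff that(1,2) bf(2) by blast
  show False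
  proof (cases "(i, j) = (1, n)")
    case True
    then have ij: "i = 1" "j = n" by simp_all
    then obtain l where l: "i < l" "l < j" "(i, l) \<in> E" "(l, j) \<in> E" using inner_apex[OF e] n3 by auto
    \<comment> \<open>The other alternative in \<open>inner\<close> has q = n; then (p,q) either
      crosses (1,l) or equals (1,n).\<close>
    have q: "q < l" "q < n" using inner[OF l] ij nocross_pair[OF l(3) f] nij l(1,2) bf by linarith+
    have "(i, l) \<noteq> (1, n)" "i + 2 \<le> l" using l(2) ij q bf by auto
    then have "1 \<in> diag_vertices \<sigma>" using diag_vertexI(1)[OF l(3)] ij by simp
    then have "((i, j), (1, 2)) \<in> Ar" using ext_arrowI(2) ij by simp
    then show False using bad good_ext_first_iff[of p q] bf q ij by auto
  next
    case False
    from e this show False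
    proof (cases rule: outer_apex)
      case (right k)
      note nk = nocross_pair[OF f right(3)] nocross_pair[OF right(3) f]
      have "\<not> good (p, q) ((i, j), (i, k))"
        using bad[OF int[OF internal_arrowI(1)[OF e right(3) right(2)]]] .
      then have pq: "i \<le> p" "j \<le> q" "q < k" using good_right_iff[OF be(2) right(1)] by auto
      have ji: "j = Suc i"
      proof (rule side)
        fix l assume l: "i < l" "l < j" "(i, l) \<in> E" "(l, j) \<in> E"
        show False using inner[OF l] nocross_pair[OF l(3) f] pq nef nk nij l(1,2) by linarith
      qed
      \<comment> \<open>For p = i the edge (i,q) would be (i,j) itself or would cross (j,k).\<close>
      have p: "j \<le> p" using pq nk nij ji by linarith
      have "(j, k) \<noteq> (1, n)" "j + 2 \<le> k" using p pq bf be by auto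
      then have "j \<in> diag_vertices \<sigma>" using diag_vertexI(1)[OF right(3)] by simp
      then have "((i, j), (j, Suc j)) \<in> Ar"
        using ext_arrowI(1)[of j i] ji be right(1) edge_cases[OF right(2)] by simp
      then show False using bad good_ext_iff[of p q i] bf p pq ji by auto
    next
      case (left k)
      note nk = nocross_pair[OF f left(2)] nocross_pair[OF left(2) f]
        nocross_pair[OF f left(3)] nocross_pair[OF left(3) f]
      have "\<not> good (p, q) ((i, j), (k, i))"
        using bad[OF int[OF internal_arrowI(3)[OF left(2) e left(3)]]] .
      then have b: "\<not> (k \<le> q \<and> (q < i \<or> k \<le> p \<and> (p < i \<or> q < j)))"
        using good_left_iff[OF left(1) be(2) bf(2)] by simp
      have ji: "j = Suc i"
      proof (rule side)
        fix l assume l: "i < l" "l < j" "(i, l) \<in> E" "(l, j) \<in> E"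
        from inner[OF l] show False
        proof
          assume q: "i \<le> q \<and> q < l"
          then have "p < k" using b l(2) left(1) by auto
          then show False using nk(3) q l(1,2) left(1) by auto
        next
          assume q: "i \<le> p \<and> p < l \<and> j \<le> q"
          then have "p = i" using nocross_pair[OF l(3) f] l(2) by auto
          then show False using nk(4) nij q be(2) left(1) by auto
        qed
      qed
      have "p \<noteq> i" using b nk(4) nij left(1) bf(2) be(2) by auto
      moreover have "q \<noteq> i" using b nk(3) left(1) bf(2) be(2) by auto
      ultimately have pq: "p \<noteq> i \<and> q \<noteq> i" by simp
      have dv: "j \<in> diag_vertices \<sigma>"
      proof (rule ccontr)
        assume "\<not> ?thesis"
        then have "k = 1" "j = n" using diag_vertexI(2)[OF left(3)] left(1) ji by auto
        then show False using b pq bf ji by auto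
      qed
      show False
      proof (cases "j = n")
        case True
        then have "((i, j), (1, n)) \<in> Ar" using ext_arrowI(3)[of i] ji dv by simp
        then show False using bad good_ext_last_iff[of p q i] bf pq ji True by auto
      next
        case False
        then have "((i, j), (j, Suc j)) \<in> Ar" using ext_arrowI(1)[of j i] ji be dv by simp
        then show False using bad good_ext_iff[of p q i] bf pq ji by auto
      qed
    qed
  qed
qed

lemma geodesic_exists:
  assumes "e \<in> E" "f \<in> E" shows "\<exists>p. geodesic e f p"
  using assms(1)
proof (induction "edist f e" arbitrary: e rule: less_induct)
  case less
  show ?case
  proof (cases "e = f")
    case True
    then have "geodesic e f []" using less by (simp add: geodesic_def)
    then show ?thesis by blast
  next
    case False
    then obtain a where a: "a \<in> Ar" "fst a = e" "good f a"
      using good_arrow_exists[of "fst e" "snd e" "fst f" "snd f"] less assms(2) by auto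
    then obtain p where "geodesic (snd a) f p"
      using less.hyps[of "snd a"] good_edist arrows_edges by blast
    then show ?thesis using geodesic_Cons[OF less.prems assms(2)] a by blast
  qed
qed

text \<open>A diamond over \<open>a\<close> and \<open>b\<close>: they continue to congruent paths
  with common end \<open>g\<close>, of such weight that any geodesic from \<open>g\<close> to
  \<open>f\<close> completes both to geodesics.\<close>

definition joinable :: "edge \<Rightarrow> arrow \<Rightarrow> arrow \<Rightarrow> bool" where
  "joinable f a b \<longleftrightarrow> (\<exists>p q g. pcong (a # p) (b # q) \<and> path_ok Ar (fst a) (a # p) \<and> path_ok Ar (fst a) (b # q)
     \<and> path_end (fst a) (a # p) = g \<and> path_end (fst a) (b # q) = g
     \<and> weight (a # p) + ddeg g f = ddeg (fst a) f \<and> weight (b # q) + ddeg g f = ddeg (fst a) f)"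

lemma joinable_sym: "fst a = fst b \<Longrightarrow> joinable f a b \<Longrightarrow> joinable f b a"
  unfolding joinable_def using pcong.sym by metis

text \<open>The relation of the incoming arrow \<open>c\<close> identifies the rest of its triangle,
  which starts with \<open>a\<close>, with the rest of its big cycle at \<open>v\<close>, which
  starts with \<open>b\<close>. As \<open>c\<close> is bad, \<open>bad_rest\<close> makes both rests
  minimal towards \<open>f\<close>, and they meet in \<open>fst c\<close>.\<close>

lemma joinableI:
  assumes t: "tri_rest c (a # p)" and bad: "\<not> good f c" and f: "f \<in> E"
    and v: "v \<in> diag_vertices \<sigma>" "incident v (fst c)" "incident v (snd c)"
    and b: "b \<in> Ar" "fst b = fst a" "incident v (snd b)"
  shows "joinable f a b"
proof -
  have c: "c \<in> Ar" using tri_rest_path(1)[OF t] by (simp add: arrows_def)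
  obtain s where s: "big_rest v c s" using big_rest_exists[OF v(1) c v(2,3)] by blast
  obtain b' q where bq: "s = b' # q" using big_rest_path(5)[OF s] by (cases s) auto
  have fa: "fst a = snd c" using tri_rest_path(2)[OF t] by auto
  have "incident v (fst b)" using v(3) fa b(2) by simp
  then obtain s' where "big_rest v b s'" using big_rest_exists[OF v(1) b(1) _ b(3)] by blast
  moreover have "big_rest v b' (q @ [c])" using big_rest_step s bq by simp
  moreover have "fst b' = snd c" using big_rest_path(2)[OF s] bq by auto
  ultimately have "b' = b" using big_rest_unique(1) b(2) fa by metis
  then have s: "big_rest v c (b # q)" using s bq by simp
  note P = tri_rest_path(2,3)[OF t] bad_rest[OF c tri_rest_path(2-4)[OF t] bad f]
  note Q = big_rest_path(2,3)[OF s] bad_rest[OF c big_rest_path(2-4)[OF s] bad f]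
  show ?thesis unfolding joinable_def fa
    by (rule exI[of _ p], rule exI[of _ q], rule exI[of _ "fst c"])
      (intro conjI pcong.rel[OF t s] P Q)
qed

text \<open>One arrow turns about \<open>i\<close>, the other about \<open>j\<close>. If
  \<open>a\<close> is internal and turns about \<open>i\<close>, its predecessor in its triangle
  turns about \<open>j\<close>, so it also precedes \<open>b\<close> in the big cycle at
  \<open>j\<close>; the same holds with the roles exchanged. Goodness of \<open>a\<close>,
  \<open>b\<close> and both predecessors contradicts noncrossing of (i,j) and (p,q). So one
  predecessor is bad and \<open>joinableI\<close> applies to it. If (i,j) is a side there is only
  one internal predecessor, and it is bad.\<close>

lemma good_arrows_joinable:
  assumes a: "a \<in> Ar" "fst a = (i, j)" "good (p, q) a" and b: "b \<in> Ar" "fst b = (i, j)" "good (p, q) b"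
    and ne: "a \<noteq> b" and f: "(p, q) \<in> E"
  shows "joinable (p, q) a b"
proof -
  have e: "(i, j) \<in> E" using arrows_edges[OF a(1)] a(2) by simp
  note be = edge_cases[OF e] and bf = edge_cases[OF f]
  note nef = nocross_pair[OF e f] nocross_pair[OF f e]
  text \<open>Since edges do not cross, at most one arrow out of \<open>(i,j)\<close> pivots at \<open>i\<close> and at most one at \<open>j\<close>.\<close>
  have main: "joinable (p, q) a b"
    if a: "a \<in> Ar" "fst a = (i, j)" "good (p, q) a" and b: "b \<in> Ar" "fst b = (i, j)" "good (p, q) b"
    and ai: "(\<exists>k>j. a = ((i, j), (i, k)) \<and> (i, k) \<in> E \<and> (j, k) \<in> E) \<or>
      (\<exists>k<i. a = ((i, j), (k, i)) \<and> (k, i) \<in> E \<and> (k, j) \<in> E) \<or>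
      (i = 1 \<and> j = n \<and> 1 \<in> diag_vertices \<sigma> \<and> a = ((i, j), (1, 2)))" (is "?r \<or> ?l \<or> ?y")
    and bj: "(\<exists>k. i < k \<and> k < j \<and> b = ((i, j), (k, j)) \<and> (i, k) \<in> E \<and> (k, j) \<in> E) \<or>
      (j = Suc i \<and> j < n \<and> j \<in> diag_vertices \<sigma> \<and> b = ((i, j), (j, Suc j))) \<or>
      (Suc i = n \<and> j = n \<and> n \<in> diag_vertices \<sigma> \<and> b = ((i, j), (1, n)))" (is "?m \<or> ?x \<or> ?z") for a b
    using ai
  proof (elim disjE)
    assume ?r
    then obtain k where k: "j < k" "a = ((i, j), (i, k))" "(i, k) \<in> E" "(j, k) \<in> E" by blast
    have ga: "q < j \<or> k \<le> q \<or> p < i" using a(3) good_right_iff[OF be(2) k(1)] unfolding k(2) by simp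
    \<comment> \<open>This arrow turns about \<open>j\<close>: it precedes \<open>a\<close> in the
      triangle and \<open>b\<close> in the big cycle at \<open>j\<close>.\<close>
    let ?c = "((j, k), (i, j))"
    have t: "tri_rest ?c (a # [((i, k), (j, k))])" using tri_restI(3)[OF e k(4,3)] k(2) by simp
    note J = joinableI[OF t _ f _ _ _ b(1), of j]
    show ?thesis using bj
    proof (elim disjE)
      assume ?m
      then obtain l where l: "i < l" "l < j" "b = ((i, j), (l, j))" "(i, l) \<in> E" "(l, j) \<in> E" by blast
      \<comment> \<open>The mirror candidate turns about \<open>i\<close>: it precedes
        \<open>b\<close> in the triangle and \<open>a\<close> in the big cycle at
        \<open>i\<close>.\<close>
      let ?c' = "((i, l), (i, j))"
      have t': "tri_rest ?c' (b # [((l, j), (i, l))])" using tri_restI(1)[OF l(4,5) e] l(3) by simp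
      have dv: "i \<in> diag_vertices \<sigma>" "j \<in> diag_vertices \<sigma>"
        using diag_vertexI[OF e] l(1,2) k(1) edge_cases[OF k(3)] by auto
      have gb: "\<not> (i \<le> q \<and> q < l \<or> i \<le> p \<and> p < l \<and> j \<le> q)"
        using b(3) good_middle_iff[OF l(1,2) bf(2)] unfolding l(3) by simp
      have "\<not> good (p, q) ?c \<or> \<not> good (p, q) ?c'"
      proof (rule ccontr)
        assume "\<not> ?thesis"
        then have gc: "i \<le> q" "q < j \<or> i \<le> p \<and> (p < j \<or> q < k)" and gc': "q < l \<or> j \<le> q \<or> p < i"
          using good_left_iff[OF be(2) k(1) bf(2)] good_right_iff[OF l(1,2)] by auto
        from gc(2) show False
        proof
          assume "q < j"
          then show False using gb gc' gc(1) nef(2) l(1) by auto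
        next
          assume "i \<le> p \<and> (p < j \<or> q < k)"
          then show False using gb gc' ga gc(1) nef(1) l(1,2) k(1) by auto
        qed
      qed
      then show ?thesis
      proof
        assume "\<not> good (p, q) ?c"
        then show ?thesis using J dv k(2) l(3) by (auto simp: incident_def)
      next
        assume "\<not> good (p, q) ?c'"
        then have "joinable (p, q) b a"
          using joinableI[OF t' _ f dv(1) _ _ a(1)] k(2) l(3) by (auto simp: incident_def)
        then show ?thesis using joinable_sym a(2) b(2) by metis
      qed
    next
      assume x: ?x
      then have "\<not> good (p, q) ?c"
        using ga b(3) good_left_iff[OF be(2) k(1) bf(2)] good_ext_iff[OF bf(2), of i] be(2) k(1) by auto
      then show ?thesis using J x k(2) by (auto simp: incident_def)
    next
      assume ?z
      then show ?thesis using k(1) edge_cases[OF k(3)] by auto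
    qed
  next
    assume ?l
    then obtain k where k: "k < i" "a = ((i, j), (k, i))" "(k, i) \<in> E" "(k, j) \<in> E" by blast
    have ga: "k \<le> q \<and> (q < i \<or> k \<le> p \<and> (p < i \<or> q < j))"
      using a(3) good_left_iff[OF k(1) be(2) bf(2)] unfolding k(2) by simp
    let ?c = "((k, j), (i, j))"
    have t: "tri_rest ?c (a # [((k, i), (k, j))])" using tri_restI(2)[OF k(3) e k(4)] k(2) by simp
    note J = joinableI[OF t _ f _ _ _ b(1), of j]
    show ?thesis using bj
    proof (elim disjE)
      assume ?m
      then obtain l where l: "i < l" "l < j" "b = ((i, j), (l, j))" "(i, l) \<in> E" "(l, j) \<in> E" by blast
      let ?c' = "((i, l), (i, j))"
      have t': "tri_rest ?c' (b # [((l, j), (i, l))])" using tri_restI(1)[OF l(4,5) e] l(3) by simp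
      have dv: "i \<in> diag_vertices \<sigma>" "j \<in> diag_vertices \<sigma>"
        using diag_vertexI[OF e] l(1,2) k(1) edge_cases[OF k(3)] by auto
      have gb: "\<not> (i \<le> q \<and> q < l \<or> i \<le> p \<and> p < l \<and> j \<le> q)"
        using b(3) good_middle_iff[OF l(1,2) bf(2)] unfolding l(3) by simp
      have "\<not> good (p, q) ?c \<or> \<not> good (p, q) ?c'"
      proof (rule ccontr)
        assume "\<not> ?thesis"
        then have gc: "\<not> (k \<le> q \<and> q < i \<or> k \<le> p \<and> p < i \<and> j \<le> q)" and gc': "q < l \<or> j \<le> q \<or> p < i"
          using good_middle_iff[OF k(1) be(2) bf(2)] good_right_iff[OF l(1,2)] by auto
        have "i \<le> q" "k \<le> p" "p < i \<or> q < j" using ga gc by auto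
        then show False using gb gc gc' nef(2) l(1,2) by (cases "p < i") auto
      qed
      then show ?thesis
      proof
        assume "\<not> good (p, q) ?c"
        then show ?thesis using J dv k(2) l(3) by (auto simp: incident_def)
      next
        assume "\<not> good (p, q) ?c'"
        then have "joinable (p, q) b a"
          using joinableI[OF t' _ f dv(1) _ _ a(1)] k(2) l(3) by (auto simp: incident_def)
        then show ?thesis using joinable_sym a(2) b(2) by metis
      qed
    next
      assume x: ?x
      then have "\<not> good (p, q) ?c"
        using ga b(3) good_middle_iff[OF k(1) be(2) bf(2)] good_ext_iff[OF bf(2), of i] be(2) by auto
      then show ?thesis using J x k(2) by (auto simp: incident_def)
    next
      assume z: ?z
      then have "\<not> good (p, q) ?c"
        using ga b(3) good_middle_iff[OF k(1) be(2) bf(2)] good_ext_last_iff[OF bf, of i] be(2) by auto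
      then show ?thesis using J z k(2) by (auto simp: incident_def)
    qed
  next
    assume y: ?y
    show ?thesis using bj
    proof (elim disjE)
      assume ?m
      then obtain l where l: "i < l" "l < j" "b = ((i, j), (l, j))" "(i, l) \<in> E" "(l, j) \<in> E" by blast
      let ?c = "((i, l), (i, j))"
      have t: "tri_rest ?c (b # [((l, j), (i, l))])" using tri_restI(1)[OF l(4,5) e] l(3) by simp
      have "\<not> good (p, q) ?c"
        using a(3) b(3) y l(1,2) bf good_middle_iff[OF l(1,2) bf(2)] good_right_iff[OF l(1,2)]
          good_ext_first_iff[OF bf(1,2)] unfolding l(3) by auto
      then have "joinable (p, q) b a"
        using joinableI[OF t _ f _ _ _ a(1), of 1] y l(3) by (auto simp: incident_def)
      then show ?thesis using joinable_sym a(2) b(2) by metis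
    qed (use y n3 in auto)
  qed
  from a(1,2) show ?thesis
  proof (cases rule: out_arrow_cases)
    case (r k)
    note A = this
    then have R: "?thesis" if "\<exists>k. i < k \<and> k < j \<and> b = ((i, j), (k, j)) \<and> (i, k) \<in> E \<and> (k, j) \<in> E \<or>
      (j = Suc i \<and> j < n \<and> j \<in> diag_vertices \<sigma> \<and> b = ((i, j), (j, Suc j))) \<or>
      (Suc i = n \<and> j = n \<and> n \<in> diag_vertices \<sigma> \<and> b = ((i, j), (1, n)))"
      using main[OF a b] that by blast
    from b(1,2) show ?thesis
    proof (cases rule: out_arrow_cases)
      case (r k')
      then show ?thesis using A ne nocross_pair[OF A(3) r(4)] nocross_pair[OF r(3) A(4)] be by force
    next
      case (l k')
      then show ?thesis using A nocross_pair[OF l(4) A(3)] be by auto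
    qed (use R A edge_cases[OF A(3)] in blast, use R in blast, use A edge_cases[OF A(3)] in auto)
  next
    case (l k)
    note A = this
    then have R: "?thesis" if "\<exists>k. i < k \<and> k < j \<and> b = ((i, j), (k, j)) \<and> (i, k) \<in> E \<and> (k, j) \<in> E \<or>
      (j = Suc i \<and> j < n \<and> j \<in> diag_vertices \<sigma> \<and> b = ((i, j), (j, Suc j))) \<or>
      (Suc i = n \<and> j = n \<and> n \<in> diag_vertices \<sigma> \<and> b = ((i, j), (1, n)))"
      using main[OF a b] that by blast
    from b(1,2) show ?thesis
    proof (cases rule: out_arrow_cases)
      case (r k')
      then show ?thesis using A nocross_pair[OF A(4) r(3)] be by auto
    next
      case (l k')
      then show ?thesis using A ne nocross_pair[OF A(3) l(4)] nocross_pair[OF l(3) A(4)] be by force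
    next
      case y then show ?thesis using A edge_cases[OF A(3)] by auto
    qed (use R in blast)+
  next
    case y
    note A = this
    from b(1,2) show ?thesis
    proof (cases rule: out_arrow_cases)
      case (m k)
      then show ?thesis using main[OF a b] A by blast
    next
      case (r k) then show ?thesis using A edge_cases[OF r(3)] by auto
    next
      case (l k) then show ?thesis using A edge_cases[OF l(3)] by auto
    qed (use A ne n3 in auto)
  next
    case (m k)
    note A = this
    have R: "?thesis" if "(\<exists>k>j. b = ((i, j), (i, k)) \<and> (i, k) \<in> E \<and> (j, k) \<in> E) \<or>
      (\<exists>k<i. b = ((i, j), (k, i)) \<and> (k, i) \<in> E \<and> (k, j) \<in> E) \<or>
      (i = 1 \<and> j = n \<and> 1 \<in> diag_vertices \<sigma> \<and> b = ((i, j), (1, 2)))"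
      by (rule joinable_sym[OF _ main[OF b a that]]) (use A a(2) b(2) in auto)
    from b(1,2) show ?thesis
    proof (cases rule: out_arrow_cases)
      case (m k')
      then show ?thesis using A ne nocross_pair[OF A(4) m(5)] nocross_pair[OF m(4) A(5)] be by force
    next
      case (r k')
      then show ?thesis using R by blast
    next
      case (l k')
      then show ?thesis using R by blast
    next
      case x
      then show ?thesis using A(1,2) by linarith
    next
      case y
      then show ?thesis using R by blast
    next
      case z
      then show ?thesis using A(1,2) by linarith
    qed
  next
    case x
    note A = this
    have R: "?thesis" if "(\<exists>k>j. b = ((i, j), (i, k)) \<and> (i, k) \<in> E \<and> (j, k) \<in> E) \<or>
      (\<exists>k<i. b = ((i, j), (k, i)) \<and> (k, i) \<in> E \<and> (k, j) \<in> E) \<or>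
      (i = 1 \<and> j = n \<and> 1 \<in> diag_vertices \<sigma> \<and> b = ((i, j), (1, 2)))"
      by (rule joinable_sym[OF _ main[OF b a that]]) (use A a(2) b(2) in auto)
    from b(1,2) show ?thesis
    proof (cases rule: out_arrow_cases)
      case (r k')
      then show ?thesis using R by blast
    next
      case (l k')
      then show ?thesis using R by blast
    next
      case (m k')
      then show ?thesis using A(1) by linarith
    next
      case x
      then show ?thesis using A ne by simp
    next
      case y
      then show ?thesis using R by blast
    next
      case z
      then show ?thesis using A(2) by linarith
    qed
  next
    case z
    note A = this
    have R: "?thesis" if "(\<exists>k>j. b = ((i, j), (i, k)) \<and> (i, k) \<in> E \<and> (j, k) \<in> E) \<or>
      (\<exists>k<i. b = ((i, j), (k, i)) \<and> (k, i) \<in> E \<and> (k, j) \<in> E) \<or>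
      (i = 1 \<and> j = n \<and> 1 \<in> diag_vertices \<sigma> \<and> b = ((i, j), (1, 2)))"
      by (rule joinable_sym[OF _ main[OF b a that]]) (use A a(2) b(2) in auto)
    from b(1,2) show ?thesis
    proof (cases rule: out_arrow_cases)
      case (r k')
      then show ?thesis using R by blast
    next
      case (l k')
      then show ?thesis using R by blast
    next
      case (m k')
      then show ?thesis using A(1,2) by linarith
    next
      case x
      then show ?thesis using A(2) by linarith
    next
      case y
      then show ?thesis using R by blast
    next
      case z
      then show ?thesis using A ne by simp
    qed
  qed
qed

text \<open>Newman's argument along \<open>edist\<close>: if the first arrows differ, the diamond is
  completed by one common geodesic from its lower corner \<open>g\<close>, and each of the two given
  paths is compared with its own side of the diamond by induction.\<close>

lemma geodesic_unique:
  assumes "e \<in> E" "f \<in> E" "geodesic e f p" "geodesic e f q"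
  shows "pcong p q"
  using assms(1,3,4)
proof (induction "edist f e" arbitrary: e p q rule: less_induct)
  case less
  show ?case
  proof (cases "e = f")
    case True
    \<comment> \<open>A geodesic from \<open>f\<close> to itself has weight 0, hence length
      0.\<close>
    then have "p = []" "q = []"
      using path_displacement[of e p] path_displacement[of e q] less.prems by (auto simp: geodesic_def)
    then show ?thesis by simp
  next
    case False
    then obtain a p' b q' where pq: "p = a # p'" "q = b # q'"
      using less.prems by (cases p; cases q) (auto simp: geodesic_def)
    note G = geodesic_Cons[OF less.prems(1) assms(2)]
    have a: "a \<in> Ar" "fst a = e" "good f a" "geodesic (snd a) f p'" 
      and b: "b \<in> Ar" "fst b = e" "good f b" "geodesic (snd b) f q'"
      using less.prems pq G by auto
    note IHa = less.hyps[OF good_edist[OF a(1,3), unfolded a(2)] arrows_edges(2)[OF a(1)]]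
    note IHb = less.hyps[OF good_edist[OF b(1,3), unfolded b(2)] arrows_edges(2)[OF b(1)]]
    show ?thesis
    proof (cases "a = b")
      case True
      then show ?thesis using IHa[OF a(4)] b(4) pq pcong_Cons by simp
    next
      case False
      then have "joinable f a b"
        using good_arrows_joinable[of a "fst e" "snd e" "fst f" "snd f" b] a b assms(2) by simp
      then obtain r s g where J: "pcong (a # r) (b # s)" "path_ok Ar e (a # r)" "path_ok Ar e (b # s)"
        "path_end e (a # r) = g" "path_end e (b # s) = g"
        "weight (a # r) + ddeg g f = ddeg e f" "weight (b # s) + ddeg g f = ddeg e f"
        unfolding joinable_def a(2) by blast
      have gE: "g \<in> E" using path_edges[OF J(2) less.prems(1)] J(4) by simp
      obtain z where z: "geodesic g f z" using geodesic_exists[OF gE assms(2)] by blast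
      have "geodesic e f ((a # r) @ z)" "geodesic e f ((b # s) @ z)"
        using geodesic_append J z by metis+
      then have "geodesic (snd a) f (r @ z)" "geodesic (snd b) f (s @ z)" using G by auto
      then have "pcong p (a # r @ z)" "pcong (b # s @ z) q"
        using IHa[OF a(4)] IHb[OF _ b(4)] pq pcong_Cons by auto
      moreover have "pcong (a # r @ z) (b # s @ z)" using pcong_right[OF J(1)] by simp
      ultimately show ?thesis using pcong.trans by blast
    qed
  qed
qed

section \<open>Minimal cycles, their centrality, and normal forms of paths\<close>

definition small_cycle :: "edge \<Rightarrow> arrow list \<Rightarrow> bool" where
  "small_cycle e p \<longleftrightarrow> (\<exists>a r. p = a # r \<and> fst a = e \<and> (tri_rest a r \<or> (\<exists>v. big_rest v a r)))"

lemma small_cycle_path: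
  assumes "small_cycle e p"
  shows "path_ok Ar e p" "path_end e p = e" "weight p = 1"
  using assms tri_rest_path big_rest_path unfolding small_cycle_def by (fastforce simp: arrows_def)+

text \<open>The triangle has an arrow turning about \<open>v\<close> either out of the common source
  or into it. The relation of that arrow compares the complements, and putting the arrow back in
  front or behind gives the two cycles.\<close>

lemma tri_cong_big:
  assumes t: "tri_rest a r" and b: "big_rest v b s" and ab: "fst a = fst b"
  shows "pcong (a # r) (b # s)"
proof -
  have v: "v \<in> diag_vertices \<sigma>" "incident v (fst a)" using big_rest_path[OF b] ab by auto
  obtain x c where r: "r = [x, c]" using t unfolding tri_rest_iff by auto
  have "incident v (snd a) \<or> incident v (fst c)" "snd c = fst a"
    using t v(2) unfolding r tri_rest_iff by (auto simp: incident_def)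
  then consider "incident v (snd a)" | "incident v (fst c)" "snd c = fst a" by blast
  then show ?thesis
  proof cases
    case 1
    obtain s' where s': "big_rest v a s'"
      using big_rest_exists[OF v(1) _ v(2) 1] tri_rest_path(1)[OF t] by (auto simp: arrows_def)
    then have "a = b" "s' = s" using big_rest_unique b ab by auto
    then show ?thesis using pcong_Cons[OF pcong.rel[OF t s']] by simp
  next
    case 2
    have tc: "tri_rest c [a, x]"
      using tri_rest_step[OF tri_rest_step[of a x "[c]", simplified], simplified] t r by simp
    obtain s' where s': "big_rest v c s'"
      using big_rest_exists[OF v(1) _ 2(1)] v(2) 2(2) tri_rest_path(1)[OF tc] by (auto simp: arrows_def)
    obtain b' q where q: "s' = b' # q" using big_rest_path(5)[OF s'] by (cases s') auto
    have B: "big_rest v b' (q @ [c])" using big_rest_step s' q by simp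
    have "fst b' = snd c" using big_rest_path(2)[OF s'] q by auto
    then have "b' = b" "q @ [c] = s" using big_rest_unique[OF B b] 2(2) ab by auto
    then show ?thesis using pcong_right[OF pcong.rel[OF tc s'], of "[c]"] q r by simp
  qed
qed

lemma tri_rest_out_cases:
  assumes "tri_rest a r" "fst a = (i, j)"
  obtains (r) k where "j < k" "(i, k) \<in> E" "(j, k) \<in> E"
      "a # r = [((i, j), (i, k)), ((i, k), (j, k)), ((j, k), (i, j))]"
  | (l) k where "k < i" "(k, i) \<in> E" "(k, j) \<in> E"
      "a # r = [((i, j), (k, i)), ((k, i), (k, j)), ((k, j), (i, j))]"
  | (m) k where "i < k" "k < j" "(i, k) \<in> E" "(k, j) \<in> E"
      "a # r = [((i, j), (k, j)), ((k, j), (i, k)), ((i, k), (i, j))]"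
proof -
  obtain i1 j1 k1 where E1: "(i1, j1) \<in> E" "(j1, k1) \<in> E" "(i1, k1) \<in> E" 
    and c: "a = ((i1, j1), (i1, k1)) \<and> r = [((i1, k1), (j1, k1)), ((j1, k1), (i1, j1))]
    \<or> a = ((i1, k1), (j1, k1)) \<and> r = [((j1, k1), (i1, j1)), ((i1, j1), (i1, k1))]
    \<or> a = ((j1, k1), (i1, j1)) \<and> r = [((i1, j1), (i1, k1)), ((i1, k1), (j1, k1))]"
    using assms(1) unfolding tri_rest_iff by blast
  have b: "i1 < j1" "j1 < k1" using edge_cases E1 by auto
  from c show ?thesis
  proof (elim disjE conjE)
    assume "a = ((i1, j1), (i1, k1))" "r = [((i1, k1), (j1, k1)), ((j1, k1), (i1, j1))]"
    then show ?thesis using r[of k1] E1 b assms(2) by simp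
  next
    assume "a = ((i1, k1), (j1, k1))" "r = [((j1, k1), (i1, j1)), ((i1, j1), (i1, k1))]"
    then show ?thesis using m[of j1] E1 b assms(2) by simp
  next
    assume "a = ((j1, k1), (i1, j1))" "r = [((i1, j1), (i1, k1)), ((i1, k1), (j1, k1))]"
    then show ?thesis using l[of i1] E1 b assms(2) by simp
  qed
qed

text \<open>All vertices lie on one side of a polygon side, and two triangles with different apexes
  over it would have crossing edges.\<close>

lemma tri_rest_out_unique:
  assumes t: "tri_rest a r" "fst a = (i, j)" and t': "tri_rest b s" "fst b = (i, j)"
    and side: "j = Suc i \<or> i = 1 \<and> j = n"
  shows "a # r = b # s"
proof -
  have ij: "i < j" using tri_rest_path(1)[OF t(1)] arrows_edges(1)[of a] t(2) edge_cases(2)[of i j]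
    by (simp add: arrows_def)
  from t show ?thesis
  proof (cases rule: tri_rest_out_cases)
    case (r k)
    note A = this
    then have s: "j = Suc i" using side edge_cases(3)[OF A(2)] by auto
    from t' show ?thesis
    proof (cases rule: tri_rest_out_cases)
      case (r k')
      then have "k = k'" using A(1) nocross_pair[OF A(2) r(3)] nocross_pair[OF r(2) A(3)] ij by linarith
      then show ?thesis using A r by simp
    next
      case (l k')
      then show ?thesis using A(1) nocross_pair[OF l(3) A(2)] ij by linarith
    next
      case (m k')
      then show ?thesis using s by linarith
    qed
  next
    case (l k)
    note A = this
    then have s: "j = Suc i" using side edge_cases(1)[OF A(2)] by auto
    from t' show ?thesis
    proof (cases rule: tri_rest_out_cases)
      case (r k')
      then show ?thesis using A(1) nocross_pair[OF A(3) r(2)] ij by linarith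
    next
      case (l k')
      then have "k = k'" using A(1) nocross_pair[OF A(2) l(3)] nocross_pair[OF l(2) A(3)] ij by linarith
      then show ?thesis using A l by simp
    next
      case (m k')
      then show ?thesis using s by linarith
    qed
  next
    case (m k)
    note A = this
    then have s: "i = 1" "j = n" using side by auto
    from t' show ?thesis
    proof (cases rule: tri_rest_out_cases)
      case (r k')
      then show ?thesis using s edge_cases(3)[OF r(2)] by linarith
    next
      case (l k')
      then show ?thesis using s edge_cases(1)[OF l(2)] by linarith
    next
      case (m k')
      then have "k = k'" using A(1,2) nocross_pair[OF A(3) m(4)] nocross_pair[OF m(3) A(4)] by linarith
      then show ?thesis using A m by simp
    qed
  qed
qed

text \<open>The two triangles on a diagonal are compared through the big cycle around one of its
  ends; a side of the polygon has only one triangle.\<close>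

lemma small_cycles_cong:
  assumes "e \<in> E" "small_cycle e p" "small_cycle e q"
  shows "pcong p q"
proof -
  obtain i j where e: "e = (i, j)" by (cases e)
  obtain a r where t: "fst a = e" "tri_rest a r" using out_internal assms(1) e by blast
  have big: "pcong (a # r) (b # s)" if "big_rest v b s" "fst b = e" for v b s
    using tri_cong_big[OF t(2) that(1)] that t by simp
  have tri: "pcong (a # r) (b # s)" if b: "tri_rest b s" "fst b = e" for b s
  proof (cases "j = Suc i \<or> i = 1 \<and> j = n")
    case True
    then show ?thesis using tri_rest_out_unique[OF t(2) _ b(1) _ True] b e t by simp
  next
    case False
    then have v: "i \<in> diag_vertices \<sigma>" using diag_vertexI(1)[of i j] assms(1) e edge_cases[of i j] by auto
    have "\<exists>c\<in>Ar. fst c = e \<and> incident i (snd c)"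
    proof -
      have "(i, j) \<in> E" "(i, j) \<noteq> (1, n)" using assms(1) e False by auto
      then show ?thesis
      proof (cases rule: outer_apex)
        case (right k)
        then show ?thesis using internal_arrowI(1)[of i j k] assms(1) e
            by (intro bexI[of _ "((i, j), (i, k))"]) (auto simp: arrows_def incident_def)
      next
        case (left k)
        then show ?thesis using internal_arrowI(3)[of k i j] assms(1) e
            by (intro bexI[of _ "((i, j), (k, i))"]) (auto simp: arrows_def incident_def)
      qed
    qed
    then obtain c where c: "c \<in> Ar" "fst c = e" "incident i (snd c)" by blast
    moreover have "incident i (fst c)" using c(2) e by (simp add: incident_def)
    ultimately obtain s' where s': "big_rest i c s'" using big_rest_exists[OF v] by blast
    have "pcong (a # r) (c # s')" "pcong (b # s) (c # s')"
      using tri_cong_big[OF t(2) s'] tri_cong_big[OF b(1) s'] c t b by simp_all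
    then show ?thesis using pcong.sym pcong.trans by blast
  qed
  have "pcong (a # r) p" "pcong (a # r) q" using assms(2,3) big tri unfolding small_cycle_def by blast+
  then show ?thesis using pcong.sym pcong.trans by blast
qed

definition cyc :: "edge \<Rightarrow> arrow list" where
  "cyc e = (SOME p. small_cycle e p)"

lemma small_cycle_cyc:
  assumes "e \<in> E" shows "small_cycle e (cyc e)"
proof -
  have "(fst e, snd e) \<in> E" using assms by simp
  then obtain a r where "fst a = e" "tri_rest a r" using out_internal by (metis prod.collapse)
  then have "small_cycle e (a # r)" unfolding small_cycle_def by blast
  then show ?thesis unfolding cyc_def by (rule someI)
qed

lemma arrow_small_cycle:
  assumes "a \<in> Ar"
  obtains r where "small_cycle (fst a) (a # r)" "small_cycle (snd a) (r @ [a])" "path_ok Ar (snd a) r"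
    "path_end (snd a) r = fst a" "ddeg (fst a) (snd a) + weight r = 1"
proof -
  have "\<exists>r. tri_rest a r \<or> (\<exists>v. big_rest v a r)"
    using assms unfolding arrows_def
  proof
    assume "a \<in> int_arrows n \<sigma>"
    then obtain i j k where "i < j" "j < k" "(i, j) \<in> E" "(j, k) \<in> E" "(i, k) \<in> E"
      "a \<in> set (tri_cycle (i, j, k))" using internal_arrowE by metis
    then have "a = ((i, j), (i, k)) \<or> a = ((i, k), (j, k)) \<or> a = ((j, k), (i, j))" by simp
    then show ?thesis using tri_restI[of i j k] \<open>(i, j) \<in> E\<close> \<open>(j, k) \<in> E\<close> \<open>(i, k) \<in> E\<close> by blast
  next
    assume "a \<in> ext_arrow n ` diag_vertices \<sigma>"
    then obtain v where v: "v \<in> diag_vertices \<sigma>" "a = ext_arrow n v" by auto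
    then have "a \<in> set (bc v)" using ext_arrow_last by simp
    then show ?thesis using split_list v(1) unfolding big_rest_def by metis
  qed
  then obtain r where r: "tri_rest a r \<or> (\<exists>v. big_rest v a r)" by blast
  then have P: "path_ok Ar (snd a) r" "path_end (snd a) r = fst a" "ddeg (fst a) (snd a) + weight r = 1" "r \<noteq> []"
    using tri_rest_path(2-5)[of a r] big_rest_path(2-5)[of _ a r] by blast+
  obtain b t where bt: "r = b # t" using P(4) by (cases r) auto
  have "tri_rest b (t @ [a]) \<or> (\<exists>v. big_rest v b (t @ [a]))"
    using r tri_rest_step[of a b t] big_rest_step[of _ a b t] unfolding bt by blast
  then have "small_cycle (snd a) (r @ [a])" using P(1) bt by (auto simp: small_cycle_def)
  moreover have "small_cycle (fst a) (a # r)" using r by (auto simp: small_cycle_def)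
  ultimately show ?thesis using that P by blast
qed

text \<open>If a r is a small cycle, then the word a r a begins with a small cycle at the source of
  \<open>a\<close> and ends with one at its target.\<close>

lemma cyc_central:
  assumes "a \<in> Ar" shows "pcong (a # cyc (snd a)) (cyc (fst a) @ [a])"
proof -
  obtain r where r: "small_cycle (fst a) (a # r)" "small_cycle (snd a) (r @ [a])"
    using arrow_small_cycle[OF assms] by blast
  have "pcong (a # cyc (snd a)) (a # r @ [a])"
    using small_cycles_cong[OF _ small_cycle_cyc r(2)] arrows_edges[OF assms] pcong_Cons by blast
  also have "pcong (a # r @ [a]) (cyc (fst a) @ [a])"
    using small_cycles_cong[OF _ r(1) small_cycle_cyc] arrows_edges[OF assms] pcong_right[of "a # r"] by simp
  finally show ?thesis .
qed

definition cpow :: "edge \<Rightarrow> nat \<Rightarrow> arrow list" where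
  "cpow e k = concat (replicate k (cyc e))"

lemma cpow_simps [simp]: "cpow e 0 = []" "cpow e (Suc k) = cyc e @ cpow e k"
  by (simp_all add: cpow_def)

lemma cpow_commute: "cpow e k @ cyc e = cyc e @ cpow e k"
  by (induction k) auto

lemma cpow_path:
  assumes "e \<in> E" shows "path_ok Ar e (cpow e k)" "path_end e (cpow e k) = e" "weight (cpow e k) = k"
  using small_cycle_path[OF small_cycle_cyc[OF assms]] by (induction k) auto

lemma cpow_central:
  assumes "a \<in> Ar" shows "pcong (a # cpow (snd a) k) (cpow (fst a) k @ [a])"
proof (induction k)
  case (Suc k)
  have "pcong (a # cpow (snd a) (Suc k)) (cyc (fst a) @ a # cpow (snd a) k)"
    using pcong_right[OF cyc_central[OF assms], of "cpow (snd a) k"] by simp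
  also have "pcong \<dots> (cyc (fst a) @ cpow (fst a) k @ [a])" by (rule pcong_left[OF Suc])
  finally show ?case by simp
qed simp

text \<open>Arrows are prepended one at a time, and collected cycles move past them by centrality. A
  good arrow prolongs the geodesic. After a bad arrow \<open>a\<close> the geodesic may be rerouted
  through the rest \<open>r\<close> of a small cycle, so that a r splits off as one more
  cycle.\<close>

lemma path_normal_form:
  assumes "path_ok Ar e p" "e \<in> E"
  shows "\<exists>k z. geodesic e (path_end e p) z \<and> pcong p (cpow e k @ z) \<and> weight p = k + ddeg e (path_end e p)"
  using assms
proof (induction p arbitrary: e)
  case Nil
  then show ?case by (intro exI[of _ 0] exI[of _ "[]"]) (auto simp: geodesic_def)
next
  case (Cons a p)
  define f where "f = path_end e (a # p)"
  have a: "a \<in> Ar" "fst a = e" "path_ok Ar (snd a) p" "path_end (snd a) p = f" using Cons.prems f_def by auto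
  have aE: "snd a \<in> E" and fE: "f \<in> E" using arrows_edges[OF a(1)] path_edges[OF a(3)] a(4) by auto
  obtain k z where z: "geodesic (snd a) f z" "pcong p (cpow (snd a) k @ z)" "weight p = k + ddeg (snd a) f"
    using Cons.IH[OF a(3) aE] a(4) by auto
  have "pcong (a # p) ((a # cpow (snd a) k) @ z)" using pcong_Cons[OF z(2)] by simp
  also have "pcong \<dots> (cpow e k @ a # z)" using pcong_right[OF cpow_central[OF a(1)], of k z] a(2) by simp
  finally have pa: "pcong (a # p) (cpow e k @ a # z)" .
  show ?case
  proof (cases "good f a")
    case True
    then have "geodesic e f (a # z)" using geodesic_Cons[OF Cons.prems(2) fE] a z by auto
    then show ?thesis using pa z(3) True a(2) unfolding f_def[symmetric]
      by (intro exI[of _ k] exI[of _ "a # z"]) (auto simp: good_def)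
  next
    case False
    obtain r where r: "small_cycle (fst a) (a # r)" "path_ok Ar (snd a) r"
      "path_end (snd a) r = fst a" "ddeg (fst a) (snd a) + weight r = 1"
      using arrow_small_cycle[OF a(1)] by blast
    note B = bad_rest[OF a(1) r(2-4) False fE]
    obtain y where y: "geodesic e f y" using geodesic_exists[OF Cons.prems(2) fE] by blast
    \<comment> \<open>By \<open>bad_rest\<close>, going back along \<open>r\<close> and on by a
      geodesic from \<open>e\<close> is minimal, so it may replace \<open>z\<close>.\<close>
    have "geodesic (snd a) f (r @ y)" using geodesic_append[OF r(2)] B r(3) y a(2) by simp
    then have "pcong z (r @ y)" using geodesic_unique[OF aE fE z(1)] by blast
    then have "pcong (cpow e k @ a # z) (cpow e k @ a # r @ y)" using pcong_left pcong_Cons by blast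
    also have "pcong (cpow e k @ a # r @ y) (cpow e k @ cyc e @ y)"
      using small_cycles_cong[OF Cons.prems(2) _ small_cycle_cyc[OF Cons.prems(2)]] r(1) a(2)
        pcong_left pcong_right[of "a # r" "cyc e" y] by auto
    also have "cpow e k @ cyc e @ y = cpow e (Suc k) @ y" using cpow_commute[of e k] by simp
    finally have "pcong (a # p) (cpow e (Suc k) @ y)" using pa pcong.trans by blast
    then show ?thesis using y z(3) B r(4) a(2) unfolding f_def[symmetric]
      by (intro exI[of _ "Suc k"] exI[of _ y]) auto
  qed
qed

text \<open>In normal form the number of cycles is the weight minus the degree between the
  endpoints, and the remaining geodesic is unique up to congruence.\<close>

theorem same_weight_pcong:
  assumes "path_ok Ar e p" "path_ok Ar e q" "e \<in> E" "path_end e p = path_end e q" "weight p = weight q"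
  shows "pcong p q"
proof -
  let ?f = "path_end e p"
  obtain k z where z: "geodesic e ?f z" "pcong p (cpow e k @ z)" "weight p = k + ddeg e ?f"
    using path_normal_form[OF assms(1,3)] by blast
  obtain l y where y: "geodesic e ?f y" "pcong q (cpow e l @ y)" "weight q = l + ddeg e ?f"
    using path_normal_form[OF assms(2,3)] assms(4) by auto
  have "k = l" using z(3) y(3) assms(5) by simp
  moreover have "pcong z y" using geodesic_unique[OF assms(3) _ z(1) y(1)] path_edges assms by blast
  ultimately have "pcong (cpow e k @ z) (cpow e l @ y)" using pcong_left by simp
  then show ?thesis using pcong.trans[OF z(2)] pcong.trans pcong.sym[OF y(2)] by blast
qed

theorem path_of_weight:
  assumes "e \<in> E" "f \<in> E" "ddeg e f \<le> k"
  shows "\<exists>p. path_ok Ar e p \<and> path_end e p = f \<and> weight p = k"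
proof -
  obtain z where z: "geodesic e f z" using geodesic_exists[OF assms(1,2)] by blast
  show ?thesis using z assms cpow_path[OF assms(1), of "k - ddeg e f"]
    by (intro exI[of _ "cpow e (k - ddeg e f) @ z"]) (auto simp: geodesic_def)
qed

end

subsection \<open>The path algebra and the Jacobian ideal\<close>

lemma kq_mult_Nil: "kq_mult f g (e, []) = f (e, []) * g (e, [])"
  by (simp add: kq_mult_def)

text \<open>Recursion for the induction behind associativity: either the first factor takes the
  empty path, or it takes the first arrow. The shifted first factor ignores its starting edge, so it
  can be evaluated on paths from \<open>snd c\<close>.\<close>

lemma kq_mult_Cons:
  "kq_mult f g (e, c # cs) = f (e, []) * g (e, c # cs) + kq_mult (\<lambda>(_, as). f (e, c # as)) g (snd c, cs)"
  by (simp add: kq_mult_def sum.atMost_Suc_shift del: sum.atMost_Suc)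

lemma kq_mult_cong1:
  assumes "\<And>as. f (e, as) = f' (e, as)" shows "kq_mult f g (e, cs) = kq_mult f' g (e, cs)"
  using assms by (simp add: kq_mult_def)

lemma kq_mult_add_left: "kq_mult (\<lambda>p. f p + f' p) g p = kq_mult f g p + kq_mult f' g p"
  by (cases p) (simp add: kq_mult_def distrib_right sum.distrib)

lemma kq_mult_add_right: "kq_mult f (\<lambda>p. g p + g' p) p = kq_mult f g p + kq_mult f g' p"
  by (cases p) (simp add: kq_mult_def distrib_left sum.distrib)

lemma kq_mult_scale_left: "kq_mult (\<lambda>p. c * f p) g p = c * kq_mult f g p"
  by (cases p) (simp add: kq_mult_def sum_distrib_left mult.assoc)

lemma kq_mult_assoc_at: "kq_mult (kq_mult f g) h (e, cs) = kq_mult f (kq_mult g h) (e, cs)"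
proof (induction cs arbitrary: e f g)
  case Nil
  then show ?case by (simp add: kq_mult_Nil mult.assoc)
next
  case (Cons c cs)
  let ?f = "\<lambda>(_, as). f (e, c # as)" and ?g = "\<lambda>(_, as). g (e, c # as)"
  have "kq_mult (\<lambda>(_, as). kq_mult f g (e, c # as)) h (snd c, cs)
      = kq_mult (\<lambda>p. f (e, []) * ?g p + kq_mult ?f g p) h (snd c, cs)"
    by (rule kq_mult_cong1) (simp add: kq_mult_Cons)
  also have "\<dots> = f (e, []) * kq_mult ?g h (snd c, cs) + kq_mult (kq_mult ?f g) h (snd c, cs)"
    by (simp add: kq_mult_add_left kq_mult_scale_left)
  also have "kq_mult (kq_mult ?f g) h (snd c, cs) = kq_mult ?f (kq_mult g h) (snd c, cs)"
    by (rule Cons.IH)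
  finally show ?case by (simp add: kq_mult_Cons kq_mult_Nil distrib_left mult.assoc)
qed

lemma kq_mult_assoc: "kq_mult (kq_mult f g) h = kq_mult f (kq_mult g h)"
  using kq_mult_assoc_at by (metis ext surj_pair)

lemma kq_mult_nonzero:
  assumes "kq_mult f g (e, cs) \<noteq> 0"
  obtains u v where "cs = u @ v" "f (e, u) \<noteq> 0" "g (path_end e u, v) \<noteq> 0"
proof -
  obtain k where "f (e, take k cs) * g (path_end e (take k cs), drop k cs) \<noteq> 0"
    using assms unfolding kq_mult_def prod.case by (rule sum.not_neutral_contains_not_neutral)
  then show ?thesis using that[of "take k cs" "drop k cs"] by auto
qed

definition path_basis :: "qpath \<Rightarrow> ('k::field) kq" where
  "path_basis p = (\<lambda>q. if q = p then 1 else 0)"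

lemma path_basis_mult:
  "kq_mult (path_basis (e, u)) (path_basis (e', v))
    = (if e' = path_end e u then path_basis (e, u @ v) else (\<lambda>_. 0 :: 'k::field))"
proof
  fix p :: qpath
  obtain d cs where p: "p = (d, cs)" by (cases p)
  show "kq_mult (path_basis (e, u)) (path_basis (e', v)) p
    = (if e' = path_end e u then path_basis (e, u @ v) else (\<lambda>_. 0 :: 'k)) p"
  proof (cases "d = e \<and> e' = path_end e u \<and> cs = u @ v")
    case True
    have "kq_mult (path_basis (e, u)) (path_basis (e', v)) (d, cs)
        = (\<Sum>k\<le>length cs. if k = length u then 1 else 0 :: 'k)"
      unfolding kq_mult_def prod.case
    proof (rule sum.cong)
      fix k assume k: "k \<in> {..length cs}"
      have "take k (u @ v) = u \<longleftrightarrow> k = length u"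
      proof
        assume "take k (u @ v) = u"
        then have "length (take k (u @ v)) = length u" by simp
        then show "k = length u" using k True by simp
      qed simp
      then show "path_basis (e, u) (d, take k cs) * path_basis (e', v) (path_end d (take k cs), drop k cs)
          = (if k = length u then 1 else 0 :: 'k)"
        using True by (auto simp: path_basis_def)
    qed simp
    then show ?thesis using True by (simp add: p path_basis_def)
  next
    case False
    have "kq_mult (path_basis (e, u)) (path_basis (e', v)) (d, cs) = (0 :: 'k)"
    proof (rule ccontr)
      assume "kq_mult (path_basis (e, u)) (path_basis (e', v)) (d, cs) \<noteq> (0 :: 'k)"
      then obtain a b where "cs = a @ b" "path_basis (e, u) (d, a) \<noteq> (0::'k)"
        "path_basis (e', v) (path_end d a, b) \<noteq> (0::'k)" by (rule kq_mult_nonzero)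
      moreover from this have "d = e" "a = u" "path_end d a = e'" "b = v" 
        by (auto simp: path_basis_def split: if_splits)
      ultimately show False using False by simp
    qed
    then show ?thesis using False by (auto simp: p path_basis_def)
  qed
qed

lemma cyc_deriv_notin:
  assumes "a \<notin> set ws" shows "cyc_deriv a ws p = 0"
proof -
  have "{m. m < length ws \<and> ws ! m = a \<and> p = (snd a, drop (Suc m) ws @ take m ws)} = {}"
    using assms nth_mem by blast
  then show ?thesis unfolding cyc_deriv_def by (simp only: card.empty of_nat_0)
qed

lemma cyc_deriv_distinct:
  assumes "ws = us @ a # vs" "distinct ws"
  shows "cyc_deriv a ws = path_basis (snd a, vs @ us)"
proof
  fix p
  have idx: "m < length ws \<and> ws ! m = a \<longleftrightarrow> m = length us" for m
    using nth_eq_iff_index_eq[OF assms(2), of m "length us"] assms(1) by auto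
  have "{m. m < length ws \<and> ws ! m = a \<and> p = (snd a, drop (Suc m) ws @ take m ws)}
      = {m. m = length us \<and> p = (snd a, drop (Suc (length us)) ws @ take (length us) ws)}"
  proof (rule Collect_cong)
    fix m
    show "m < length ws \<and> ws ! m = a \<and> p = (snd a, drop (Suc m) ws @ take m ws)
      \<longleftrightarrow> m = length us \<and> p = (snd a, drop (Suc (length us)) ws @ take (length us) ws)"
      using idx[of m] by (cases "m = length us") (simp, argo)
  qed
  also have "\<dots> = (if p = (snd a, vs @ us) then {length us} else {})" by (simp add: assms(1))
  finally show "cyc_deriv a ws p = path_basis (snd a, vs @ us) p"
    unfolding cyc_deriv_def path_basis_def by simp
qed

context triangulated_polygon
begin

abbreviation valid_path :: "qpath \<Rightarrow> bool" where
  "valid_path p \<equiv> fst p \<in> E \<and> path_ok Ar (fst p) (snd p)"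

lemma KQ_simps [simp]:
  "carrier (KQ n \<sigma>) = kq_carrier n \<sigma>" "monoid.mult (KQ n \<sigma>) = kq_mult"
  "one (KQ n \<sigma>) = kq_one n \<sigma>" "zero (KQ n \<sigma>) = (\<lambda>_. 0)" "add (KQ n \<sigma>) = (\<lambda>f g p. f p + g p)"
  by (simp_all add: KQ_def)

lemma kq_carrierI:
  "finite {p. f p \<noteq> 0} \<Longrightarrow> (\<And>p. f p \<noteq> 0 \<Longrightarrow> valid_path p) \<Longrightarrow> f \<in> kq_carrier n \<sigma>"
  by (auto simp: kq_carrier_def)

lemma kq_carrierD:
  "f \<in> kq_carrier n \<sigma> \<Longrightarrow> finite {p. f p \<noteq> 0}" "f \<in> kq_carrier n \<sigma> \<Longrightarrow> f p \<noteq> 0 \<Longrightarrow> valid_path p"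
  unfolding kq_carrier_def by blast+

lemma finite_E: "finite E"
proof (rule finite_subset)
  show "E \<subseteq> {..n} \<times> {..n}" using edge_bounds by fastforce
qed simp

lemma kq_mult_closed:
  assumes "f \<in> kq_carrier n \<sigma>" "g \<in> kq_carrier n \<sigma>" shows "kq_mult f g \<in> kq_carrier n \<sigma>"
proof (rule kq_carrierI)
  let ?h = "\<lambda>(p, q). (fst p, snd p @ snd q)"
  have "{p. kq_mult f g p \<noteq> 0} \<subseteq> ?h ` ({p. f p \<noteq> 0} \<times> {p. g p \<noteq> 0})"
  proof
    fix p assume p: "p \<in> {p. kq_mult f g p \<noteq> 0}"
    obtain e cs where e: "p = (e, cs)" by (cases p)
    obtain u v where "cs = u @ v" "f (e, u) \<noteq> 0" "g (path_end e u, v) \<noteq> 0"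
      using p kq_mult_nonzero[of f g e cs] unfolding e mem_Collect_eq by blast
    then have "p = ?h ((e, u), (path_end e u, v))" "((e, u), (path_end e u, v)) \<in> {p. f p \<noteq> 0} \<times> {p. g p \<noteq> 0}"
      using e by auto
    then show "p \<in> ?h ` ({p. f p \<noteq> 0} \<times> {p. g p \<noteq> 0})" by (rule image_eqI)
  qed
  then show "finite {p. kq_mult f g p \<noteq> 0}"
    by (rule finite_subset) (use kq_carrierD(1) assms in blast)
  fix p assume p: "kq_mult f g p \<noteq> 0"
  obtain e cs where e: "p = (e, cs)" by (cases p)
  obtain u v where "cs = u @ v" "f (e, u) \<noteq> 0" "g (path_end e u, v) \<noteq> 0"
    using p kq_mult_nonzero[of f g e cs] unfolding e by blast
  then show "valid_path p" 
    using kq_carrierD(2)[OF assms(1), of "(e, u)"] kq_carrierD(2)[OF assms(2), of "(path_end e u, v)"] e by simp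
qed

lemma kq_add_closed:
  assumes "f \<in> kq_carrier n \<sigma>" "g \<in> kq_carrier n \<sigma>" shows "(\<lambda>p. f p + g p) \<in> kq_carrier n \<sigma>"
proof (rule kq_carrierI)
  have "{p. f p + g p \<noteq> 0} \<subseteq> {p. f p \<noteq> 0} \<union> {p. g p \<noteq> 0}" by auto
  then show "finite {p. f p + g p \<noteq> 0}"
    by (rule finite_subset) (use kq_carrierD(1) assms in blast)
  fix p assume "f p + g p \<noteq> 0"
  then have "f p \<noteq> 0 \<or> g p \<noteq> 0" by auto
  then show "valid_path p" using kq_carrierD(2) assms by blast
qed

lemma kq_scale_closed:
  assumes "f \<in> kq_carrier n \<sigma>" shows "(\<lambda>p. c * f p) \<in> kq_carrier n \<sigma>"
proof (rule kq_carrierI)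
  have "{p. c * f p \<noteq> 0} \<subseteq> {p. f p \<noteq> 0}" by auto
  then show "finite {p. c * f p \<noteq> 0}"
    by (rule finite_subset) (use kq_carrierD(1) assms in blast)
  fix p assume "c * f p \<noteq> 0"
  then show "valid_path p" using kq_carrierD(2)[OF assms, of p] by simp
qed

lemma kq_zero_closed: "(\<lambda>_. 0) \<in> kq_carrier n \<sigma>"
  by (rule kq_carrierI) auto

lemma kq_idempotent_closed:
  assumes "S \<subseteq> E" shows "(\<lambda>(e, cs). if cs = [] \<and> e \<in> S then 1 else 0) \<in> kq_carrier n \<sigma>"
proof (rule kq_carrierI)
  have "{p. (case p of (e, cs) \<Rightarrow> if cs = [] \<and> e \<in> S then 1 else 0) \<noteq> (0::'a)} \<subseteq> (\<lambda>e. (e, [])) ` E"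
    using assms by (auto split: if_splits)
  then show "finite {p. (case p of (e, cs) \<Rightarrow> if cs = [] \<and> e \<in> S then 1 else 0) \<noteq> (0::'a)}"
    by (rule finite_subset) (use finite_E in simp)
qed (use assms in \<open>auto split: if_splits\<close>)

lemma kq_one_closed: "kq_one n \<sigma> \<in> kq_carrier n \<sigma>"
  unfolding kq_one_def by (rule kq_idempotent_closed) simp

lemma path_basis_closed: "valid_path p \<Longrightarrow> path_basis p \<in> kq_carrier n \<sigma>"
  by (rule kq_carrierI) (auto simp: path_basis_def split: if_splits)

lemma kq_one_left:
  assumes "f \<in> kq_carrier n \<sigma>" shows "kq_mult (kq_one n \<sigma>) f = f"
proof
  fix p :: qpath
  obtain e and cs :: "arrow list" where p: "p = (e, cs)" by (cases p)
  have "kq_mult (kq_one n \<sigma>) f (e, cs) = (\<Sum>k\<le>length cs. if k = 0 then (if e \<in> E then f (e, cs) else 0) else 0)"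
    unfolding kq_mult_def prod.case by (rule sum.cong) (auto simp: kq_one_def)
  then show "kq_mult (kq_one n \<sigma>) f p = f p" using kq_carrierD(2)[OF assms, of p] p by auto
qed

lemma kq_one_right:
  assumes "f \<in> kq_carrier n \<sigma>" shows "kq_mult f (kq_one n \<sigma>) = f"
proof
  fix p :: qpath
  obtain e and cs :: "arrow list" where p: "p = (e, cs)" by (cases p)
  have "kq_mult f (kq_one n \<sigma>) (e, cs)
      = (\<Sum>k\<le>length cs. if k = length cs then (if path_end e cs \<in> E then f (e, cs) else 0) else 0)"
    unfolding kq_mult_def prod.case by (rule sum.cong) (auto simp: kq_one_def)
  then show "kq_mult f (kq_one n \<sigma>) p = f p"
    using kq_carrierD(2)[OF assms, of p] path_edges[of e cs] p by auto
qed

lemma ring_KQ: "ring (KQ n \<sigma> :: 'k::field kq ring)"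
proof (rule ringI)
  show "abelian_group (KQ n \<sigma> :: 'k kq ring)"
  proof (rule abelian_groupI)
    fix f :: "'k kq" assume "f \<in> carrier (KQ n \<sigma>)"
    then show "\<exists>g\<in>carrier (KQ n \<sigma>). g \<oplus>\<^bsub>KQ n \<sigma>\<^esub> f = \<zero>\<^bsub>KQ n \<sigma>\<^esub>"
      using kq_scale_closed[of f "-1"] by (intro bexI[of _ "\<lambda>p. - 1 * f p"]) auto
  qed (simp_all add: kq_add_closed kq_zero_closed ac_simps)
  show "Group.monoid (KQ n \<sigma> :: 'k kq ring)"
    by (rule monoidI) (simp_all add: kq_mult_closed kq_one_closed kq_one_left kq_one_right kq_mult_assoc)
qed (simp_all add: fun_eq_iff kq_mult_add_left kq_mult_add_right)

section \<open>The Jacobian ideal and its generators\<close>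

abbreviation J :: "('k::field) kq set" where "J \<equiv> Jac_ideal n \<sigma>"

lemma finite_diag_vertices: "finite (diag_vertices \<sigma>)"
  by (rule finite_subset[of _ "{..n}"]) (use diag_vertex_bounds in auto)

lemma finite_triangles: "finite (triangles n \<sigma>)"
proof (rule finite_subset)
  show "triangles n \<sigma> \<subseteq> {..n} \<times> {..n} \<times> {..n}" using edge_cases by (fastforce simp: triangles_def)
qed simp

lemma arrow_ends_distinct: "a \<in> Ar \<Longrightarrow> fst a \<noteq> snd a"
  using arrow_displacement[of a] arrows_edges(2)[of a] by auto

text \<open>The two edges of an internal arrow already contain all three vertices of its
  triangle.\<close>

lemma tri_cycle_unique:
  assumes "T \<in> triangles n \<sigma>" "T' \<in> triangles n \<sigma>" "a \<in> set (tri_cycle T)" "a \<in> set (tri_cycle T')"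
  shows "T = T'"
  using assms by (cases T; cases T') (auto simp: triangles_def)

lemma incident_unique:
  assumes "a \<in> Ar" "incident v (fst a)" "incident v (snd a)" "incident v' (fst a)" "incident v' (snd a)"
  shows "v = v'"
proof (rule ccontr)
  assume ne: "v \<noteq> v'"
  have "fst (fst a) < snd (fst a)" "fst (snd a) < snd (snd a)" using arrows_edges[OF assms(1)] edge_bounds by auto
  then have "fst a = snd a" using assms(2-5) ne by (auto simp: incident_def prod_eq_iff)
  then show False using arrow_ends_distinct[OF assms(1)] by simp
qed

text \<open>The arrow lies in one triangle only, and its two edges meet in a single vertex. So each
  of the two sums in the potential has exactly one term that involves \<open>a\<close>.\<close>

lemma dW_eq:
  assumes t: "tri_rest a r" and b: "big_rest v a s"
  shows "dW n \<sigma> a = (\<lambda>p. path_basis (snd a, r) p - path_basis (snd a, s) p :: 'k::field)"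
proof
  fix p
  obtain T us vs where T: "T \<in> triangles n \<sigma>" "tri_cycle T = us @ a # vs" "r = vs @ us"
    using t by (auto simp: tri_rest_def)
  obtain us' vs' where B: "bc v = us' @ a # vs'" "s = vs' @ us'"
    using b by (auto simp: big_rest_def)
  note v = big_rest_path[OF b]
  have dT: "distinct (tri_cycle T)" using T(1) by (cases T) (auto simp: triangles_def)
  have dB: "distinct (bc v)" using big_cycle_distinct[OF v(8)] by (simp add: distinct_map)
  have "(\<Sum>T'\<in>triangles n \<sigma>. cyc_deriv a (tri_cycle T') p)
      = (\<Sum>T'\<in>triangles n \<sigma>. if T' = T then path_basis (snd a, r) p else 0 :: 'k)"
  proof (rule sum.cong)
    fix T' assume T': "T' \<in> triangles n \<sigma>"
    show "cyc_deriv a (tri_cycle T') p = (if T' = T then path_basis (snd a, r) p else 0 :: 'k)"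
    proof (cases "T' = T")
      case True
      then show ?thesis by (simp add: cyc_deriv_distinct[OF T(2) dT] T(3) del: tri_cycle.simps)
    next
      case False
      then have "a \<notin> set (tri_cycle T')" using tri_cycle_unique[OF T' T(1), of a] T(2) by auto
      then show ?thesis using False cyc_deriv_notin by simp
    qed
  qed simp
  moreover have "(\<Sum>v'\<in>diag_vertices \<sigma>. cyc_deriv a (bc v') p)
      = (\<Sum>v'\<in>diag_vertices \<sigma>. if v' = v then path_basis (snd a, s) p else 0 :: 'k)"
  proof (rule sum.cong)
    fix v' assume v': "v' \<in> diag_vertices \<sigma>"
    show "cyc_deriv a (bc v') p = (if v' = v then path_basis (snd a, s) p else 0 :: 'k)"
    proof (cases "v' = v")
      case True
      then show ?thesis by (simp add: cyc_deriv_distinct[OF B(1) dB] B(2))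
    next
      case False
      then have "a \<notin> set (bc v')" using incident_unique[OF v(1,6,7)] big_cycle_arrow[OF v'] by blast
      then show ?thesis using False cyc_deriv_notin by simp
    qed
  qed simp
  ultimately show "dW n \<sigma> a p = path_basis (snd a, r) p - (path_basis (snd a, s) p :: 'k)"
    using finite_triangles finite_diag_vertices T(1) v(8) by (simp add: dW_def)
qed

abbreviation frozen_arrow :: "arrow \<Rightarrow> bool" where
  "frozen_arrow a \<equiv> fst a \<in> sides n \<and> snd a \<in> sides n"

lemma ext_arrow_frozen: "1 \<le> v \<Longrightarrow> v \<le> n \<Longrightarrow> frozen_arrow (ext_arrow n v)"
  using n3 by (auto simp: ext_arrow_def sides_def is_side_def ed_def prv_def nxt_def min_def max_def)

text \<open>External arrows join two sides, so an arrow with an unfrozen end is internal, and its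
  diagonal end makes the common vertex a diagonal vertex. With \<open>rests_unfrozen\<close> this
  matches the generators of the ideal with the rule \<open>rel\<close> of the congruence.\<close>

lemma unfrozen_arrow_rests:
  assumes "a \<in> Ar" "\<not> frozen_arrow a"
  obtains r v s where "tri_rest a r" "big_rest v a s"
proof -
  have "a \<in> int_arrows n \<sigma>" using assms ext_arrow_frozen diag_vertex_bounds unfolding arrows_def by blast
  then obtain i j k where T: "i < j" "j < k" "(i, j) \<in> E" "(j, k) \<in> E" "(i, k) \<in> E"
    "a \<in> set (tri_cycle (i, j, k))" using internal_arrowE by metis
  then have c: "a = ((i, j), (i, k)) \<or> a = ((i, k), (j, k)) \<or> a = ((j, k), (i, j))" by simp
  then obtain r where r: "tri_rest a r" using tri_restI[OF T(3-5)] by blast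
  have "\<exists>v. incident v (fst a) \<and> incident v (snd a)" using c by (auto simp: incident_def)
  then obtain v where v: "incident v (fst a)" "incident v (snd a)" by blast
  have "v \<in> diag_vertices \<sigma>"
    using v diag_vertex_iff[of "fst (fst a)" "snd (fst a)"] diag_vertex_iff[of "fst (snd a)" "snd (snd a)"]
      assms(2) arrows_edges[OF assms(1)] by (auto simp: incident_def)
  then obtain s where "big_rest v a s" using big_rest_exists[OF _ assms(1) v] by blast
  then show ?thesis using that r by blast
qed

lemma rests_unfrozen:
  assumes "tri_rest a r" "big_rest v a s" shows "\<not> frozen_arrow a"
proof -
  obtain T where T: "T \<in> triangles n \<sigma>" "a \<in> set (tri_cycle T)" 
    using assms(1) unfolding tri_rest_def by (metis in_set_conv_decomp)
  obtain i j k where "T = (i, j, k)" by (cases T)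
  then show ?thesis using side_side_not_diag_vertex[of i j k a v] T big_rest_path(6-8)[OF assms(2)] by blast
qed

abbreviation relations :: "('k::field) kq set" where
  "relations \<equiv> {dW n \<sigma> a | a. a \<in> arrows n \<sigma> \<and> (fst a \<notin> sides n \<or> snd a \<notin> sides n)}"

lemma path_basis_diff_closed:
  "valid_path p \<Longrightarrow> valid_path q \<Longrightarrow> (\<lambda>x. path_basis p x - path_basis q x) \<in> kq_carrier n \<sigma>"
  using kq_add_closed[OF path_basis_closed[of p] kq_scale_closed[OF path_basis_closed[of q], of "-1"]] by simp

lemma rest_valid:
  "tri_rest a r \<Longrightarrow> valid_path (snd a, r)" "big_rest v a s \<Longrightarrow> valid_path (snd a, s)"
  using tri_rest_path[of a r] big_rest_path[of v a s] arrows_edges(2)[of a] by (auto simp: arrows_def)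

lemma relations_closed: "relations \<subseteq> (kq_carrier n \<sigma> :: ('k::field) kq set)"
proof
  fix f :: "'k kq" assume "f \<in> relations"
  then obtain a where a: "a \<in> Ar" "\<not> frozen_arrow a" "f = dW n \<sigma> a" by blast
  obtain r v s where rs: "tri_rest a r" "big_rest v a s" using unfrozen_arrow_rests[OF a(1,2)] by blast
  show "f \<in> kq_carrier n \<sigma>"
    unfolding a(3) dW_eq[OF rs] by (rule path_basis_diff_closed[OF rest_valid(1)[OF rs(1)] rest_valid(2)[OF rs(2)]])
qed

lemma ideal_J: "ideal J (KQ n \<sigma> :: 'k::field kq ring)"
  unfolding Jac_ideal_def by (rule ring.genideal_ideal[OF ring_KQ]) (simp only: relations_closed KQ_simps)

lemma J_add: "f \<in> J \<Longrightarrow> g \<in> J \<Longrightarrow> (\<lambda>p. f p + g p) \<in> J"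
  using additive_subgroup.a_closed[OF ideal.axioms(1)[OF ideal_J], of f g] by simp

lemma J_zero: "(\<lambda>_. 0) \<in> J"
  using additive_subgroup.zero_closed[OF ideal.axioms(1)[OF ideal_J]] by simp

lemma J_carrier: "f \<in> J \<Longrightarrow> f \<in> kq_carrier n \<sigma>"
  using additive_subgroup.a_subset[OF ideal.axioms(1)[OF ideal_J]] by auto

lemma J_mult: "f \<in> J \<Longrightarrow> g \<in> kq_carrier n \<sigma> \<Longrightarrow> kq_mult g f \<in> J" "f \<in> J \<Longrightarrow> g \<in> kq_carrier n \<sigma> \<Longrightarrow> kq_mult f g \<in> J"
  using ideal.I_l_closed[OF ideal_J, of f g] ideal.I_r_closed[OF ideal_J, of f g] by simp_all

text \<open>The generated ideal is an ideal of the ring only; scalars act on it through multiples of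
  the identity.\<close>

lemma J_scale: "f \<in> J \<Longrightarrow> (\<lambda>p. c * f p) \<in> J"
proof -
  assume f: "f \<in> J"
  have "kq_mult (\<lambda>p. c * kq_one n \<sigma> p) f = (\<lambda>p. c * f p)"
    using kq_one_left[OF J_carrier[OF f]] by (simp add: fun_eq_iff kq_mult_scale_left)
  then show ?thesis using J_mult(1)[OF f kq_scale_closed[OF kq_one_closed], of c] by simp
qed

lemma J_sum: "finite S \<Longrightarrow> (\<And>x. x \<in> S \<Longrightarrow> f x \<in> J) \<Longrightarrow> (\<lambda>p. \<Sum>x\<in>S. f x p) \<in> J"
  by (induction S rule: finite_induct) (simp_all add: J_zero J_add)

text \<open>The context rule allows arbitrary words on both sides. So the induction has to carry
  agreement of validity and endpoints for every starting edge; this lets a difference in the ideal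
  be multiplied by the basis elements of the surrounding paths.\<close>

lemma pcong_sound:
  assumes "pcong p q"
  shows "(\<forall>e. (path_ok Ar e p \<longleftrightarrow> path_ok Ar e q) \<and> (path_ok Ar e p \<longrightarrow> path_end e p = path_end e q))
    \<and> (\<forall>e\<in>E. path_ok Ar e p \<longrightarrow> (\<lambda>x. path_basis (e, p) x - path_basis (e, q) x :: 'k::field) \<in> J)"
  using assms
proof (induction rule: pcong.induct)
  case (rel a r v s)
  note t = tri_rest_path[OF rel(1)] and b = big_rest_path[OF rel(2)]
  have st: "path_ok Ar e x \<longleftrightarrow> e = d" if "path_ok Ar d x" "x \<noteq> []" for x e d
    using that by (cases x) auto
  note st = st[OF t(2,5)] st[OF b(2,5)]
  have "relations \<subseteq> carrier (KQ n \<sigma> :: 'k kq ring)" by (simp only: KQ_simps relations_closed)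
  moreover have "dW n \<sigma> a \<in> (relations :: 'k kq set)" using rests_unfrozen[OF rel] b(1) by blast
  ultimately have "dW n \<sigma> a \<in> (J :: 'k kq set)"
    unfolding Jac_ideal_def using ring.genideal_self[OF ring_KQ] by blast
  then show ?case using st t(3) b(3) by (simp add: dW_eq[OF rel])
next
  case (refl p)
  then show ?case by (simp add: J_zero)
next
  case (sym p q)
  have "(\<lambda>x. path_basis (e, q) x - path_basis (e, p) x :: 'k) \<in> J" if "e \<in> E" "path_ok Ar e p" for e
    using J_scale[of "\<lambda>x. path_basis (e, p) x - path_basis (e, q) x :: 'k" "-1"] sym.IH that by simp
  then show ?case using sym.IH by simp
next
  case (trans p q r)
  have "(\<lambda>x. path_basis (e, p) x - path_basis (e, r) x :: 'k) \<in> J" if e: "e \<in> E" "path_ok Ar e p" for e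
  proof -
    have "path_ok Ar e q" using trans.IH(1) e(2) by blast
    then have "(\<lambda>x. path_basis (e, p) x - path_basis (e, q) x :: 'k) \<in> J"
      "(\<lambda>x. path_basis (e, q) x - path_basis (e, r) x :: 'k) \<in> J" using trans.IH e by blast+
    from J_add[OF this] show ?thesis by simp
  qed
  moreover have "(path_ok Ar e p \<longleftrightarrow> path_ok Ar e r) \<and> (path_ok Ar e p \<longrightarrow> path_end e p = path_end e r)" for e
    using spec[OF conjunct1[OF trans.IH(1)], of e] spec[OF conjunct1[OF trans.IH(2)], of e] by simp
  ultimately show ?case by blast
next
  case (ctxt p q u v)
  have "(\<lambda>x. path_basis (e, u @ p @ v) x - path_basis (e, u @ q @ v) x :: 'k) \<in> J"
    if e: "e \<in> E" "path_ok Ar e (u @ p @ v)" for e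
  proof -
    let ?d = "path_end e u"
    let ?D = "\<lambda>x. path_basis (?d, p) x - path_basis (?d, q) x :: 'k"
    let ?V = "path_basis (path_end ?d p, v) :: 'k kq"
    have d: "?d \<in> E" "path_ok Ar ?d p" "path_end ?d p \<in> E" using e path_edges by auto
    have IH: "path_end ?d p = path_end ?d q" "?D \<in> J" using ctxt.IH d(1,2) by blast+
    have diff_l: "kq_mult f (\<lambda>x. g x - h x) = (\<lambda>x. kq_mult f g x - kq_mult f h x)" for f g h :: "'k kq"
      by (auto simp: kq_mult_def fun_eq_iff right_diff_distrib sum_subtractf)
    have diff_r: "kq_mult (\<lambda>x. g x - h x) f = (\<lambda>x. kq_mult g f x - kq_mult h f x)" for f g h :: "'k kq"
      by (auto simp: kq_mult_def fun_eq_iff left_diff_distrib sum_subtractf)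
    have "kq_mult (kq_mult (path_basis (e, u)) ?D) ?V \<in> J"
      using e d by (intro J_mult IH path_basis_closed) auto
    moreover have "kq_mult (kq_mult (path_basis (e, u)) ?D) ?V
        = (\<lambda>x. path_basis (e, u @ p @ v) x - path_basis (e, u @ q @ v) x)"
      using IH(1) by (simp add: diff_l diff_r path_basis_mult)
    ultimately show ?thesis by simp
  qed
  moreover have "(path_ok Ar e (u @ p @ v) \<longleftrightarrow> path_ok Ar e (u @ q @ v))
      \<and> (path_ok Ar e (u @ p @ v) \<longrightarrow> path_end e (u @ p @ v) = path_end e (u @ q @ v))" for e
    using spec[OF conjunct1[OF ctxt.IH], of "path_end e u"] by auto
  ultimately show ?case by blast
qed

end

subsection \<open>Realization by matrices over the polynomial ring\<close>

text \<open>Trades the sum over split points of \<open>r\<close> for a sum over pairs of paths,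
  whose range does not depend on \<open>r\<close>. This makes the interchange of sums in
  \<open>Phi_mult\<close> possible.\<close>

lemma kq_mult_support:
  fixes f g :: "('k::field) kq"
  assumes "finite A" "finite B" "{p. f p \<noteq> 0} \<subseteq> A" "{p. g p \<noteq> 0} \<subseteq> B"
  shows "kq_mult f g r = (\<Sum>(p, q)\<in>A \<times> B.
    if fst q = path_end (fst p) (snd p) \<and> r = (fst p, snd p @ snd q) then f p * g q else 0)"
proof -
  obtain e cs where r: "r = (e, cs)" by (cases r)
  let ?i = "\<lambda>k. ((e, take k cs), (path_end e (take k cs), drop k cs))"
  let ?c = "\<lambda>p q. fst q = path_end (fst p) (snd p) \<and> r = (fst p, snd p @ snd q)"
  have inj: "inj_on ?i {..length cs}"
    by (rule inj_onI) (metis atMost_iff length_take min_absorb2 prod.inject)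
  have img: "?i ` {..length cs} = {(p, q). ?c p q}"
  proof (intro equalityI subsetI)
    fix z assume "z \<in> {(p, q). ?c p q}"
    then obtain p q where z: "z = (p, q)" "?c p q" by auto
    then have "z = ?i (length (snd p))" "length (snd p) \<le> length cs" using r by (cases p; cases q; auto)+
    then show "z \<in> ?i ` {..length cs}" by (intro image_eqI) auto
  qed (auto simp: r)
  have fin: "finite {(p, q). ?c p q}" unfolding img[symmetric] by simp
  have "kq_mult f g r = (\<Sum>k\<le>length cs. f (fst (?i k)) * g (snd (?i k)))"
    by (simp add: kq_mult_def r)
  also have "\<dots> = (\<Sum>z\<in>?i ` {..length cs}. f (fst z) * g (snd z))"
    by (simp add: sum.reindex[OF inj])
  also have "\<dots> = (\<Sum>z\<in>(A \<times> B) \<inter> {(p, q). ?c p q}. f (fst z) * g (snd z))"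
    unfolding img by (rule sum.mono_neutral_right) (use fin assms(3,4) in auto)
  also have "\<dots> = (\<Sum>z\<in>A \<times> B. if z \<in> {(p, q). ?c p q} then f (fst z) * g (snd z) else 0)"
    by (rule sum.inter_restrict) (simp add: assms)
  also have "\<dots> = (\<Sum>(p, q)\<in>A \<times> B. if ?c p q then f p * g q else 0)"
    by (rule sum.cong) (simp_all add: case_prod_unfold)
  finally show ?thesis .
qed

context triangulated_polygon
begin

section \<open>Recording paths by start, end and weight\<close>

definition Phi :: "('k::field) kq \<Rightarrow> edge \<Rightarrow> edge \<Rightarrow> 'k poly" where
  "Phi f e e' = (\<Sum>p | f p \<noteq> 0. if fst p = e \<and> path_end e (snd p) = e' then monom (f p) (weight (snd p)) else 0)"

lemma Phi_superset:
  assumes "finite S" "{p. f p \<noteq> 0} \<subseteq> S"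
  shows "Phi f e e' = (\<Sum>p\<in>S. if fst p = e \<and> path_end e (snd p) = e' then monom (f p) (weight (snd p)) else 0)"
  unfolding Phi_def by (rule sum.mono_neutral_left) (use assms in auto)

lemma Phi_zero [simp]: "Phi (\<lambda>_. 0) = (\<lambda>_ _. 0)"
  by (simp add: Phi_def fun_eq_iff)

lemma Phi_add:
  assumes "f \<in> kq_carrier n \<sigma>" "g \<in> kq_carrier n \<sigma>"
  shows "Phi (\<lambda>p. f p + g p) e e' = Phi f e e' + Phi g e e'"
proof -
  let ?S = "{p. f p \<noteq> 0} \<union> {p. g p \<noteq> 0}"
  have S: "finite ?S" "{p. f p \<noteq> 0} \<subseteq> ?S" "{p. g p \<noteq> 0} \<subseteq> ?S" "{p. f p + g p \<noteq> 0} \<subseteq> ?S"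
    using kq_carrierD(1) assms by auto
  show ?thesis
    unfolding Phi_superset[OF S(1,2)] Phi_superset[OF S(1,3)] Phi_superset[OF S(1,4)] sum.distrib[symmetric]
    by (rule sum.cong) (auto simp: add_monom)
qed

lemma Phi_scale:
  assumes "f \<in> kq_carrier n \<sigma>"
  shows "Phi (\<lambda>p. c * f p) e e' = smult c (Phi f e e')"
proof -
  have S: "finite {p. f p \<noteq> 0}" "{p. c * f p \<noteq> 0} \<subseteq> {p. f p \<noteq> 0}" using kq_carrierD(1) assms by auto
  have smult_sum: "smult c (\<Sum>p\<in>S. h p) = (\<Sum>p\<in>S. smult c (h p))" for S and h :: "qpath \<Rightarrow> 'a poly"
    by (induction S rule: infinite_finite_induct) (auto simp: smult_add_right)
  show ?thesis unfolding Phi_superset[OF S] Phi_def smult_sum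
    by (rule sum.cong) (auto simp: smult_monom)
qed

lemma Phi_basis:
  "Phi (path_basis (d, p)) e e' = (if e = d \<and> e' = path_end d p then monom 1 (weight p) else 0)"
  by (subst Phi_superset[of "{(d, p)}"]) (auto simp: path_basis_def)

text \<open>Weights add under concatenation, and the pairs of paths that meet at \<open>d\<close>
  make up the summand for \<open>d\<close> of the matrix product.\<close>

lemma Phi_mult:
  assumes f: "f \<in> kq_carrier n \<sigma>" and g: "g \<in> kq_carrier n \<sigma>"
  shows "Phi (kq_mult f g) e e' = (\<Sum>d\<in>E. Phi f e d * Phi g d e')"
proof -
  let ?A = "{p. f p \<noteq> 0}" and ?B = "{p. g p \<noteq> 0}"
  have fin: "finite ?A" "finite ?B" using kq_carrierD(1) f g by auto
  let ?h = "\<lambda>p q. (fst p, snd p @ snd q)"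
  let ?c = "\<lambda>p q. fst q = path_end (fst p) (snd p)"
  let ?S = "(\<lambda>(p, q). ?h p q) ` (?A \<times> ?B)"
  let ?t = "\<lambda>r. fst r = e \<and> path_end e (snd r) = e'"
  have S: "finite ?S" using fin by simp
  note KS = kq_mult_support[OF fin subset_refl subset_refl]
  have sub: "{r. kq_mult f g r \<noteq> 0} \<subseteq> ?S"
  proof
    fix r assume "r \<in> {r. kq_mult f g r \<noteq> 0}"
    then have "(\<Sum>(p, q)\<in>?A \<times> ?B. if ?c p q \<and> r = ?h p q then f p * g q else 0) \<noteq> 0"
      using KS[of r] by simp
    then obtain z where z: "z \<in> ?A \<times> ?B" "(case z of (p, q) \<Rightarrow> if ?c p q \<and> r = ?h p q then f p * g q else 0) \<noteq> 0"
      by (rule sum.not_neutral_contains_not_neutral)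
    obtain p q where pq: "z = (p, q)" by (cases z)
    have "r = ?h p q" using z(2) unfolding pq by (auto split: if_splits)
    then show "r \<in> ?S" using z(1) pq by (intro image_eqI[of _ _ z]) auto
  qed
  have "Phi (kq_mult f g) e e' = (\<Sum>r\<in>?S. if ?t r then monom (kq_mult f g r) (weight (snd r)) else 0)"
    by (rule Phi_superset[OF S sub])
  also have "\<dots> = (\<Sum>r\<in>?S. \<Sum>(p, q)\<in>?A \<times> ?B.
      if ?t r \<and> ?c p q \<and> r = ?h p q then monom (f p * g q) (weight (snd r)) else 0)"
  proof (rule sum.cong)
    fix r
    have "monom (kq_mult f g r) (weight (snd r)) = (\<Sum>z\<in>?A \<times> ?B.
        monom (case z of (p, q) \<Rightarrow> if ?c p q \<and> r = ?h p q then f p * g q else 0) (weight (snd r)))"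
      unfolding KS[of r] by (rule monom_sum)
    then show "(if ?t r then monom (kq_mult f g r) (weight (snd r)) else 0) = (\<Sum>(p, q)\<in>?A \<times> ?B.
      if ?t r \<and> ?c p q \<and> r = ?h p q then monom (f p * g q) (weight (snd r)) else 0)"
      by (cases "?t r") (auto intro!: sum.cong sum.neutral)
  qed simp
  also have "\<dots> = (\<Sum>z\<in>?A \<times> ?B. \<Sum>r\<in>?S. (case z of (p, q) \<Rightarrow>
      if ?t r \<and> ?c p q \<and> r = ?h p q then monom (f p * g q) (weight (snd r)) else 0))"
    by (rule sum.swap)
  also have "\<dots> = (\<Sum>(p, q)\<in>?A \<times> ?B.
      if ?t (?h p q) \<and> ?c p q then monom (f p * g q) (weight (snd p) + weight (snd q)) else 0)"
  proof (rule sum.cong)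
    fix z assume z: "z \<in> ?A \<times> ?B"
    obtain p q where pq: "z = (p, q)" by (cases z)
    have hS: "?h p q \<in> ?S" using z pq by force
    have "(\<Sum>r\<in>?S. if ?t r \<and> ?c p q \<and> r = ?h p q then monom (f p * g q) (weight (snd r)) else 0)
        = (\<Sum>r\<in>?S. if r = ?h p q then (if ?t r \<and> ?c p q then monom (f p * g q) (weight (snd r)) else 0) else 0)"
      by (rule sum.cong) auto
    also have "\<dots> = (if ?t (?h p q) \<and> ?c p q then monom (f p * g q) (weight (snd (?h p q))) else 0)"
      using S hS by (simp only: sum.delta if_True)
    finally show "(\<Sum>r\<in>?S. (case z of (p, q) \<Rightarrow>
        if ?t r \<and> ?c p q \<and> r = ?h p q then monom (f p * g q) (weight (snd r)) else 0))
      = (case z of (p, q) \<Rightarrow>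
        if ?t (?h p q) \<and> ?c p q then monom (f p * g q) (weight (snd p) + weight (snd q)) else 0)"
      unfolding pq by simp
  qed simp
  also have "\<dots> = (\<Sum>(p, q)\<in>?A \<times> ?B. \<Sum>d\<in>E.
      (if fst p = e \<and> path_end e (snd p) = d then monom (f p) (weight (snd p)) else 0)
      * (if fst q = d \<and> path_end d (snd q) = e' then monom (g q) (weight (snd q)) else 0))"
  proof (rule sum.cong)
    fix z assume z: "z \<in> ?A \<times> ?B"
    obtain p q where pq: "z = (p, q)" by (cases z)
    have "valid_path p" using kq_carrierD(2)[OF f] z pq by auto
    then have pe: "path_end (fst p) (snd p) \<in> E" using path_edges by blast
    have "(\<Sum>d\<in>E.
      (if fst p = e \<and> path_end e (snd p) = d then monom (f p) (weight (snd p)) else 0)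
      * (if fst q = d \<and> path_end d (snd q) = e' then monom (g q) (weight (snd q)) else 0))
      = (\<Sum>d\<in>E. if d = path_end (fst p) (snd p) then
        (if fst p = e \<and> fst q = d \<and> path_end d (snd q) = e' then monom (f p * g q) (weight (snd p) + weight (snd q)) else 0) else 0)"
    proof (rule sum.cong)
      fix d
      show "(if fst p = e \<and> path_end e (snd p) = d then monom (f p) (weight (snd p)) else 0)
        * (if fst q = d \<and> path_end d (snd q) = e' then monom (g q) (weight (snd q)) else 0)
        = (if d = path_end (fst p) (snd p) then (if fst p = e \<and> fst q = d \<and> path_end d (snd q) = e'
           then monom (f p * g q) (weight (snd p) + weight (snd q)) else 0) else 0)"
        by (cases "fst p = e"; cases "path_end (fst p) (snd p) = d"; cases "fst q = d";
          cases "path_end d (snd q) = e'") (simp_all add: mult_monom)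
    qed simp
    also have "\<dots> = (if fst p = e \<and> ?c p q \<and> path_end (path_end (fst p) (snd p)) (snd q) = e'
        then monom (f p * g q) (weight (snd p) + weight (snd q)) else 0)"
      using finite_E pe by (simp only: sum.delta if_True)
    finally show "(case z of (p, q) \<Rightarrow>
        if ?t (?h p q) \<and> ?c p q then monom (f p * g q) (weight (snd p) + weight (snd q)) else 0)
      = (case z of (p, q) \<Rightarrow> \<Sum>d\<in>E.
      (if fst p = e \<and> path_end e (snd p) = d then monom (f p) (weight (snd p)) else 0)
      * (if fst q = d \<and> path_end d (snd q) = e' then monom (g q) (weight (snd q)) else 0))"
      unfolding pq prod.case by auto
  qed simp
  also have "\<dots> = (\<Sum>d\<in>E. \<Sum>(p, q)\<in>?A \<times> ?B.
      (if fst p = e \<and> path_end e (snd p) = d then monom (f p) (weight (snd p)) else 0)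
      * (if fst q = d \<and> path_end d (snd q) = e' then monom (g q) (weight (snd q)) else 0))"
    unfolding case_prod_unfold by (rule sum.swap)
  also have "\<dots> = (\<Sum>d\<in>E. Phi f e d * Phi g d e')"
    unfolding Phi_def sum_product sum.cartesian_product ..
  finally show ?thesis .
qed

text \<open>The tiled order with entry ideals x^(\<open>ddeg e e'\<close>) K[x]. Entries outside the
  edges are set to 0, so that equality of matrices is equality of functions.\<close>

definition edge_matrices :: "(edge \<Rightarrow> edge \<Rightarrow> ('k::field) poly) set" where
  "edge_matrices = {M. \<forall>e e'. (e \<notin> E \<or> e' \<notin> E \<longrightarrow> M e e' = 0) \<and> monom 1 (ddeg e e') dvd M e e'}"

lemma Phi_in_edge_matrices:
  assumes "f \<in> kq_carrier n \<sigma>" shows "Phi f \<in> edge_matrices"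
  unfolding edge_matrices_def
proof (intro CollectI allI conjI impI)
  fix e e' assume ne: "e \<notin> E \<or> e' \<notin> E"
  show "Phi f e e' = 0" unfolding Phi_def
  proof (rule sum.neutral, rule ballI)
    fix p assume "p \<in> {p. f p \<noteq> 0}"
    then have "valid_path p" using kq_carrierD(2)[OF assms] by blast
    then have "\<not> (fst p = e \<and> path_end e (snd p) = e')" using ne path_edges by blast
    then show "(if fst p = e \<and> path_end e (snd p) = e' then monom (f p) (weight (snd p)) else 0) = 0" by argo
  qed
next
  fix e e'
  show "monom 1 (ddeg e e') dvd Phi f e e'" unfolding Phi_def
  proof (rule dvd_sum)
    fix p assume "p \<in> {p. f p \<noteq> 0}"
    then have p: "valid_path p" using kq_carrierD(2)[OF assms] by auto
    show "monom 1 (ddeg e e') dvd (if fst p = e \<and> path_end e (snd p) = e' then monom (f p) (weight (snd p)) else 0)"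
    proof (cases "fst p = e \<and> path_end e (snd p) = e'")
      case True
      then have "ddeg e e' \<le> weight (snd p)" using ddeg_le_weight[of e "snd p"] p by auto
      then have "monom (f p) (weight (snd p)) = monom 1 (ddeg e e') * monom (f p) (weight (snd p) - ddeg e e')"
        by (simp add: mult_monom)
      then show ?thesis using True by simp
    next
      case False
      then show ?thesis by (simp only: if_False dvd_0_right)
    qed
  qed
qed

lemma Phi_add_fun:
  "f \<in> kq_carrier n \<sigma> \<Longrightarrow> g \<in> kq_carrier n \<sigma> \<Longrightarrow> Phi (\<lambda>p. f p + g p) = (\<lambda>e e'. Phi f e e' + Phi g e e')"
  by (intro ext) (rule Phi_add)

lemma Phi_mult_fun:
  "f \<in> kq_carrier n \<sigma> \<Longrightarrow> g \<in> kq_carrier n \<sigma> \<Longrightarrow>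
    Phi (kq_mult f g) = (\<lambda>e e'. \<Sum>d\<in>E. Phi f e d * Phi g d e')"
  by (intro ext) (rule Phi_mult)

text \<open>Once the kernel is an ideal, minimality of the generated ideal reduces the vanishing of
  \<open>Phi\<close> on \<open>J\<close> to the generators.\<close>

lemma Phi_ideal: "ideal {f \<in> kq_carrier n \<sigma>. Phi f = (\<lambda>_ _. 0)} (KQ n \<sigma> :: 'k::field kq ring)" (is "ideal ?K _")
proof (rule idealI[OF ring_KQ])
  interpret R: ring "KQ n \<sigma> :: 'k kq ring" by (rule ring_KQ)
  have minus: "\<ominus>\<^bsub>KQ n \<sigma>\<^esub> f = (\<lambda>p. - 1 * f p)" if "f \<in> kq_carrier n \<sigma>" for f :: "'k kq"
    using that kq_scale_closed[OF that, of "-1"] by (intro R.minus_equality) auto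
  show "subgroup ?K (add_monoid (KQ n \<sigma>))"
  proof (rule R.add.subgroupI)
    fix f :: "'k kq" assume f: "f \<in> ?K"
    have "Phi (\<lambda>p. - 1 * f p) e e' = 0" for e e'
      using f Phi_scale[of f "-1" e e'] by simp
    then have "Phi (\<lambda>p. - 1 * f p) = (\<lambda>_ _. 0)" by (intro ext)
    with f show "\<ominus>\<^bsub>KQ n \<sigma>\<^esub> f \<in> ?K"
      using kq_scale_closed[of f "-1"] by (simp add: minus del: mult_minus1)
  qed (auto simp: Phi_add_fun kq_add_closed intro!: exI[of _ "\<lambda>_. 0"] kq_zero_closed)
qed (auto simp: Phi_mult_fun kq_mult_closed)

lemma Phi_relation:
  assumes "tri_rest a r" "big_rest v a s"
  shows "Phi (\<lambda>p. path_basis (snd a, r) p - path_basis (snd a, s) p :: 'k::field) = (\<lambda>_ _. 0)"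
proof (intro ext)
  fix e e'
  have "weight r = weight s" "path_end (snd a) r = path_end (snd a) s"
    using tri_rest_path(3,4)[OF assms(1)] big_rest_path(3,4)[OF assms(2)] by simp_all
  moreover have "Phi (\<lambda>p. path_basis (snd a, r) p + - 1 * path_basis (snd a, s) p :: 'k) e e'
      = Phi (path_basis (snd a, r)) e e' + smult (- 1) (Phi (path_basis (snd a, s)) e e')"
    using path_basis_closed[OF rest_valid(1)[OF assms(1)], where 'a = 'k]
      path_basis_closed[OF rest_valid(2)[OF assms(2)], where 'a = 'k]
    by (simp only: Phi_add Phi_scale kq_scale_closed)
  ultimately show "Phi (\<lambda>p. path_basis (snd a, r) p - path_basis (snd a, s) p :: 'k) e e' = 0"
    by (simp add: Phi_basis)
qed

lemma Phi_J: "f \<in> J \<Longrightarrow> Phi (f :: ('k::field) kq) = (\<lambda>_ _. 0)"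
proof -
  have "(relations :: 'k kq set) \<subseteq> {f \<in> kq_carrier n \<sigma>. Phi f = (\<lambda>_ _. 0)}"
  proof
    fix f :: "'k kq" assume f: "f \<in> relations"
    then obtain a where a: "a \<in> Ar" "\<not> frozen_arrow a" "f = dW n \<sigma> a" by blast
    obtain r v s where rs: "tri_rest a r" "big_rest v a s" using unfrozen_arrow_rests[OF a(1,2)] by blast
    show "f \<in> {f \<in> kq_carrier n \<sigma>. Phi f = (\<lambda>_ _. 0)}"
      using subsetD[OF relations_closed f] Phi_relation[OF rs, where 'k = 'k] unfolding a(3) dW_eq[OF rs] by simp
  qed
  then have "(J :: 'k kq set) \<subseteq> {f \<in> kq_carrier n \<sigma>. Phi f = (\<lambda>_ _. 0)}"
    unfolding Jac_ideal_def by (rule ring.genideal_minimal[OF ring_KQ Phi_ideal])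
  then show "f \<in> J \<Longrightarrow> Phi f = (\<lambda>_ _. 0)" by blast
qed

definition path_type :: "qpath \<Rightarrow> edge \<times> edge \<times> nat" where
  "path_type p = (fst p, path_end (fst p) (snd p), weight (snd p))"

lemma Phi_coeff:
  assumes "f \<in> kq_carrier n \<sigma>"
  shows "coeff (Phi f e e') k = (\<Sum>p | f p \<noteq> 0 \<and> path_type p = (e, e', k). f p)"
proof -
  have fin: "finite {p. f p \<noteq> 0}" by (rule kq_carrierD(1)[OF assms])
  have "coeff (Phi f e e') k = (\<Sum>p | f p \<noteq> 0. if path_type p = (e, e', k) then f p else 0)"
    unfolding Phi_def coeff_sum by (rule sum.cong) (auto simp: path_type_def)
  also have "\<dots> = (\<Sum>p\<in>{p. f p \<noteq> 0} \<inter> {p. path_type p = (e, e', k)}. f p)"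
    using sum.inter_restrict[OF fin, of f "{p. path_type p = (e, e', k)}"] by simp
  finally show ?thesis by (simp add: Collect_conj_eq)
qed

lemma same_type_J:
  assumes "valid_path p" "valid_path q" "path_type p = path_type q"
  shows "(\<lambda>x. path_basis p x - path_basis q x :: 'k::field) \<in> J"
proof -
  obtain e u where p: "p = (e, u)" by (cases p)
  obtain v where q: "q = (e, v)" using assms(3) p by (cases q) (simp add: path_type_def)
  have "pcong u v"
    by (rule same_weight_pcong[of e]) (use assms in \<open>simp_all add: p q path_type_def\<close>)
  from pcong_sound[OF this, where 'k = 'k] show ?thesis using assms(1) unfolding p q fst_conv snd_conv by blast
qed

text \<open>Modulo \<open>J\<close> each path may be replaced by a representative of its type. The
  coefficients collected on one representative add up to a coefficient of \<open>Phi f\<close>,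
  which is 0.\<close>

lemma kernel_Phi:
  assumes f: "f \<in> kq_carrier n \<sigma>" and 0: "Phi f = (\<lambda>_ _. 0)"
  shows "f \<in> (J :: ('k::field) kq set)"
proof -
  let ?S = "{p. f p \<noteq> 0}"
  have fin: "finite ?S" by (rule kq_carrierD(1)[OF f])
  \<comment> \<open>Representatives are taken inside the support of \<open>f\<close>, so they are
    valid paths.\<close>
  define rep where "rep t = (SOME p. p \<in> ?S \<and> path_type p = t)" for t
  have rep: "rep (path_type p) \<in> ?S" "path_type (rep (path_type p)) = path_type p" if "p \<in> ?S" for p
    using someI[of "\<lambda>q. q \<in> ?S \<and> path_type q = path_type p" p] that unfolding rep_def by auto
  have "(\<lambda>x. \<Sum>p\<in>?S. f p * (path_basis p x - path_basis (rep (path_type p)) x)) \<in> J"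
  proof (rule J_sum[OF fin])
    fix p assume p: "p \<in> ?S"
    have "valid_path p" "valid_path (rep (path_type p))"
      using kq_carrierD(2)[OF f] p rep(1)[OF p] by auto
    then show "(\<lambda>x. f p * (path_basis p x - path_basis (rep (path_type p)) x)) \<in> J"
      by (intro J_scale same_type_J) (simp_all add: rep(2)[OF p])
  qed
  moreover have "(\<Sum>p\<in>?S. f p * (path_basis p x - path_basis (rep (path_type p)) x)) = f x" for x
  proof -
    have "(\<Sum>p\<in>?S. f p * path_basis p x) = (\<Sum>p\<in>?S. if p = x then f p else 0)"
      by (rule sum.cong) (auto simp: path_basis_def)
    also have "\<dots> = f x" using fin by (simp add: sum.delta)
    finally have 1: "(\<Sum>p\<in>?S. f p * path_basis p x) = f x" .
    have "(\<Sum>p\<in>?S. f p * path_basis (rep (path_type p)) x) = (\<Sum>p\<in>?S. if x = rep (path_type p) then f p else 0)"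
      by (rule sum.cong) (auto simp: path_basis_def)
    also have "\<dots> = (\<Sum>p\<in>?S \<inter> {p. x = rep (path_type p)}. f p)"
      using sum.inter_restrict[OF fin, of f "{p. x = rep (path_type p)}"] by simp
    also have "\<dots> = 0"
    proof (cases "\<exists>p\<in>?S. x = rep (path_type p)")
      case True
      then obtain p where p: "p \<in> ?S" "x = rep (path_type p)" by blast
      obtain e e' k where t: "path_type p = (e, e', k)" by (cases "path_type p")
      have "?S \<inter> {q. x = rep (path_type q)} = {q. f q \<noteq> 0 \<and> path_type q = (e, e', k)}"
        (is "?L = ?R")
      proof (intro equalityI subsetI)
        fix q assume q: "q \<in> ?L"
        then have "rep (path_type q) = rep (path_type p)" "q \<in> ?S" using p(2) by auto
        then have "path_type q = path_type p" using rep(2)[OF p(1)] rep(2)[of q] by simp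
        then show "q \<in> ?R" using q t by simp
      next
        fix q assume "q \<in> ?R"
        then show "q \<in> ?L" using p(2) t by simp
      qed
      then show ?thesis using Phi_coeff[OF f, of e e' k] 0 by simp
    next
      case False
      then have "?S \<inter> {p. x = rep (path_type p)} = {}" by blast
      then show ?thesis by (metis sum.empty)
    qed
    finally show ?thesis using 1 by (simp add: right_diff_distrib sum_subtractf)
  qed
  ultimately show ?thesis by simp
qed

text \<open>By \<open>path_of_weight\<close> every monomial allowed by the divisibility condition is
  the image of a single path; the coefficients of \<open>M\<close> are placed on such paths.\<close>

lemma Phi_surj:
  assumes M: "M \<in> edge_matrices"
  shows "\<exists>f\<in>kq_carrier n \<sigma>. Phi f = (M :: edge \<Rightarrow> edge \<Rightarrow> ('k::field) poly)"
proof -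
  define P where "P t = (SOME p. valid_path p \<and> path_type p = t)" for t
  have P: "valid_path (P (e, e', k))" "path_type (P (e, e', k)) = (e, e', k)"
    if ek: "e \<in> E" "e' \<in> E" "ddeg e e' \<le> k" for e e' k
  proof -
    obtain p where "path_ok Ar e p" "path_end e p = e'" "weight p = k" using path_of_weight[OF ek] by blast
    then have "valid_path (e, p) \<and> path_type (e, p) = (e, e', k)" using ek by (simp add: path_type_def)
    then have "valid_path (P (e, e', k)) \<and> path_type (P (e, e', k)) = (e, e', k)" unfolding P_def by (rule someI)
    then show "valid_path (P (e, e', k))" "path_type (P (e, e', k)) = (e, e', k)" by auto
  qed
  have lowM: "e \<in> E \<and> e' \<in> E \<and> ddeg e e' \<le> k" if nz: "coeff (M e e') k \<noteq> 0" for e e' k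
  proof -
    have "monom 1 (ddeg e e') dvd M e e'" "e \<notin> E \<or> e' \<notin> E \<longrightarrow> M e e' = 0"
      using M unfolding edge_matrices_def by blast+
    then obtain q where "M e e' = monom 1 (ddeg e e') * q" "e \<in> E \<and> e' \<in> E"
      using nz by (metis dvdE coeff_0)
    then show ?thesis using nz by (auto simp: coeff_monom_mult split: if_splits)
  qed
  define c where "c t = (case t of (e, e', k) \<Rightarrow> coeff (M e e') k)" for t
  \<comment> \<open>Where no valid path of a type exists, the choice made by \<open>P\<close> is
    arbitrary, but \<open>lowM\<close> shows that the coefficient is 0 there.\<close>
  define f where "f p = (if P (path_type p) = p then c (path_type p) else 0)" for p
  have nz: "\<exists>e e' k. p = P (e, e', k) \<and> path_type p = (e, e', k) \<and> coeff (M e e') k \<noteq> 0" if "f p \<noteq> 0" for p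
    using that by (cases "path_type p") (auto simp: f_def c_def split: if_splits)
  have fc: "f \<in> kq_carrier n \<sigma>"
  proof (rule kq_carrierI)
    let ?T = "E \<times> E \<times> {..Max ((\<lambda>(e, e'). degree (M e e')) ` (E \<times> E))}"
    have "{p. f p \<noteq> 0} \<subseteq> P ` ?T"
    proof
      fix p assume "p \<in> {p. f p \<noteq> 0}"
      then obtain e e' k where p: "p = P (e, e', k)" "coeff (M e e') k \<noteq> 0" using nz by blast
      have ee: "e \<in> E" "e' \<in> E" using lowM[OF p(2)] by auto
      have "k \<le> degree (M e e')" using p(2) by (rule le_degree)
      also have "\<dots> \<le> Max ((\<lambda>(e, e'). degree (M e e')) ` (E \<times> E))"
        using finite_E ee by (intro Max_ge) auto
      finally show "p \<in> P ` ?T" using p ee by auto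
    qed
    then show "finite {p. f p \<noteq> 0}" by (rule finite_subset) (use finite_E in auto)
    fix p assume "f p \<noteq> 0"
    then obtain e e' k where p: "p = P (e, e', k)" "coeff (M e e') k \<noteq> 0" using nz by blast
    then show "valid_path p" using P(1)[of e e' k] lowM[OF p(2)] by simp
  qed
  have "Phi f = M"
  proof (intro ext poly_eqI)
    fix e e' k
    have "coeff (Phi f e e') k = (\<Sum>p | f p \<noteq> 0 \<and> path_type p = (e, e', k). f p)" by (rule Phi_coeff[OF fc])
    also have "\<dots> = coeff (M e e') k"
    proof (cases "coeff (M e e') k = 0")
      case True
      then have "{p. f p \<noteq> 0 \<and> path_type p = (e, e', k)} = {}" by (auto simp: f_def c_def)
      then show ?thesis using True by (metis sum.empty)
    next
      case False
      have "{p. f p \<noteq> 0 \<and> path_type p = (e, e', k)} = {P (e, e', k)}"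
        using P(2)[of e e' k] lowM[OF False] False by (auto simp: f_def c_def split: if_splits)
      moreover have "f (P (e, e', k)) = coeff (M e e') k"
        using P(2)[of e e' k] lowM[OF False] by (simp add: f_def c_def)
      ultimately show ?thesis by simp
    qed
    finally show "coeff (Phi f e e') k = coeff (M e e') k" .
  qed
  then show ?thesis using fc by blast
qed

abbreviation G :: "('k::field) kq set ring" where "G \<equiv> Gamma n \<sigma>"

lemma ring_G: "ring (G :: 'k::field kq set ring)"
  unfolding Gamma_def by (rule ideal.quotient_is_ring[OF ideal_J])

lemma G_mult_closed: "a \<in> carrier G \<Longrightarrow> b \<in> carrier G \<Longrightarrow> a \<otimes>\<^bsub>G\<^esub> b \<in> carrier G"
  by (rule ring.ring_simprules(5)[OF ring_G])

lemma G_add_closed: "a \<in> carrier G \<Longrightarrow> b \<in> carrier G \<Longrightarrow> a \<oplus>\<^bsub>G\<^esub> b \<in> carrier G"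
  by (rule ring.ring_simprules(1)[OF ring_G])

lemma abelian_subgroup_J: "abelian_subgroup J (KQ n \<sigma> :: 'k::field kq ring)"
  by (rule abelian_subgroupI3[OF ideal.axioms(1)[OF ideal_J] ring.is_abelian_group[OF ring_KQ]])

lemma carrier_G: "carrier (G :: 'k::field kq set ring) = cls n \<sigma> ` kq_carrier n \<sigma>"
  by (auto simp: Gamma_def FactRing_def A_RCOSETS_def' cls_def)

lemma cls_closed: "f \<in> kq_carrier n \<sigma> \<Longrightarrow> cls n \<sigma> f \<in> carrier G"
  by (simp add: carrier_G)

lemma cls_add:
  assumes "f \<in> kq_carrier n \<sigma>" "g \<in> kq_carrier n \<sigma>"
  shows "cls n \<sigma> f \<oplus>\<^bsub>G\<^esub> cls n \<sigma> g = cls n \<sigma> (\<lambda>p. f p + g p)"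
  using abelian_subgroup.a_rcos_sum[OF abelian_subgroup_J, of f g] assms
  by (simp add: Gamma_def FactRing_def cls_def)

lemma cls_mult:
  assumes "f \<in> kq_carrier n \<sigma>" "g \<in> kq_carrier n \<sigma>"
  shows "cls n \<sigma> f \<otimes>\<^bsub>G\<^esub> cls n \<sigma> g = cls n \<sigma> (kq_mult f g)"
  using ideal.rcoset_mult_add[OF ideal_J, of f g] assms
  by (simp add: Gamma_def FactRing_def cls_def)

lemma cls_eq_iff:
  assumes f: "f \<in> kq_carrier n \<sigma>" and g: "g \<in> kq_carrier n \<sigma>"
  shows "cls n \<sigma> f = cls n \<sigma> g \<longleftrightarrow> Phi f = Phi (g :: 'k::field kq)"
proof
  have coset: "cls n \<sigma> h = {\<lambda>p. j p + h p | j. j \<in> J}" for h :: "'k kq"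
    by (auto simp: cls_def a_r_coset_def')
  {
    assume "cls n \<sigma> f = cls n \<sigma> g"
    moreover have "f \<in> cls n \<sigma> f" unfolding coset using J_zero by (intro CollectI exI[of _ "\<lambda>_. 0"]) simp
    ultimately obtain j where j: "j \<in> J" "f = (\<lambda>p. j p + g p)" unfolding coset by blast
    then show "Phi f = Phi g" using Phi_add_fun[OF J_carrier[OF j(1)] g] Phi_J[OF j(1)] by simp
  next
    assume eq: "Phi f = Phi g"
    have m: "(\<lambda>p. - 1 * g p) \<in> kq_carrier n \<sigma>" by (rule kq_scale_closed[OF g])
    have "Phi (\<lambda>p. f p + - 1 * g p) = (\<lambda>_ _. 0)"
      unfolding Phi_add_fun[OF f m] using Phi_scale[OF g, of "- 1"] eq by simp
    then have "(\<lambda>p. f p + - 1 * g p) \<in> J" by (rule kernel_Phi[OF kq_add_closed[OF f m]])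
    then have "f \<in> cls n \<sigma> g" unfolding coset by (intro CollectI exI[of _ "\<lambda>p. f p + - 1 * g p"]) simp
    then show "cls n \<sigma> f = cls n \<sigma> g"
      using abelian_subgroup.a_repr_independence'[OF abelian_subgroup_J, of f g] g by (simp add: cls_def)
  }
qed

definition Theta :: "('k::field) kq set \<Rightarrow> edge \<Rightarrow> edge \<Rightarrow> 'k poly" where
  "Theta g = Phi (SOME f. f \<in> kq_carrier n \<sigma> \<and> cls n \<sigma> f = g)"

lemma Theta_cls: "f \<in> kq_carrier n \<sigma> \<Longrightarrow> Theta (cls n \<sigma> f) = Phi f"
  unfolding Theta_def using someI[of "\<lambda>h. h \<in> kq_carrier n \<sigma> \<and> cls n \<sigma> h = cls n \<sigma> f" f] cls_eq_iff by blast

lemma Theta_bij: "bij_betw Theta (carrier (G :: 'k::field kq set ring)) edge_matrices"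
  unfolding bij_betw_def
proof
  show "inj_on Theta (carrier (G :: 'k kq set ring))"
  proof (rule inj_onI)
    fix x y :: "'k kq set" assume "x \<in> carrier G" "y \<in> carrier G" and eq: "Theta x = Theta y"
    then obtain f g where "f \<in> kq_carrier n \<sigma>" "x = cls n \<sigma> f" "g \<in> kq_carrier n \<sigma>" "y = cls n \<sigma> g"
      unfolding carrier_G by blast
    then show "x = y" using eq cls_eq_iff[of f g] Theta_cls[of f] Theta_cls[of g] by simp
  qed
  show "Theta ` carrier (G :: 'k kq set ring) = edge_matrices"
  proof (intro equalityI subsetI)
    fix M assume "M \<in> Theta ` carrier (G :: 'k kq set ring)"
    then show "M \<in> edge_matrices" by (auto simp: carrier_G Theta_cls Phi_in_edge_matrices)
  next
    fix M :: "edge \<Rightarrow> edge \<Rightarrow> 'k poly" assume "M \<in> edge_matrices"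
    then obtain f where "f \<in> kq_carrier n \<sigma>" "Phi f = M" using Phi_surj by blast
    then show "M \<in> Theta ` carrier (G :: 'k kq set ring)"
      by (intro image_eqI[of _ _ "cls n \<sigma> f"]) (auto simp: carrier_G Theta_cls)
  qed
qed

lemma Theta_eqI: "g \<in> carrier G \<Longrightarrow> h \<in> carrier G \<Longrightarrow> (\<And>e e'. Theta g e e' = Theta h e e') \<Longrightarrow> g = h"
  using inj_onD[OF bij_betw_imp_inj_on[OF Theta_bij]] by blast

lemma Theta_edge_matrices: "g \<in> carrier G \<Longrightarrow> Theta g \<in> edge_matrices"
  using bij_betwE[OF Theta_bij] by blast

lemma Theta_outside: "g \<in> carrier G \<Longrightarrow> e \<notin> E \<or> e' \<notin> E \<Longrightarrow> Theta g e e' = 0"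
  and Theta_dvd: "g \<in> carrier G \<Longrightarrow> monom 1 (ddeg e e') dvd Theta g e e'"
  using Theta_edge_matrices[of g] unfolding edge_matrices_def by blast+

lemma Theta_add:
  assumes "g \<in> carrier G" "h \<in> carrier G"
  shows "Theta (g \<oplus>\<^bsub>G\<^esub> h) e e' = Theta g e e' + Theta h e e'"
  using assms by (auto simp: carrier_G cls_add Theta_cls kq_add_closed Phi_add)

lemma Theta_mult:
  assumes "g \<in> carrier G" "h \<in> carrier G"
  shows "Theta (g \<otimes>\<^bsub>G\<^esub> h) e e' = (\<Sum>d\<in>E. Theta g e d * Theta h d e')"
  using assms by (auto simp: carrier_G cls_mult Theta_cls kq_mult_closed Phi_mult)

lemma Phi_idempotent:
  assumes "S \<subseteq> E"
  shows "Phi (\<lambda>(e, cs). if cs = [] \<and> e \<in> S then 1 else 0 :: 'k::field) d d' = (if d = d' \<and> d \<in> S then 1 else 0)"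
proof -
  let ?f = "\<lambda>(e, cs). if cs = [] \<and> e \<in> S then 1 else 0 :: 'k"
  have sub: "{p. ?f p \<noteq> 0} \<subseteq> (\<lambda>e. (e, [])) ` S" by (auto split: if_splits)
  have fin: "finite S" using assms finite_E finite_subset by blast
  have "Phi ?f d d' = (\<Sum>p\<in>(\<lambda>e. (e, [])) ` S. if fst p = d \<and> path_end d (snd p) = d'
      then monom (?f p) (weight (snd p)) else 0)"
    by (rule Phi_superset[OF _ sub]) (simp add: fin)
  also have "\<dots> = (\<Sum>e\<in>S. if e = d then (if d = d' then 1 else 0) else 0)"
    by (subst sum.reindex) (auto simp: inj_on_def intro!: sum.cong)
  also have "\<dots> = (if d = d' \<and> d \<in> S then 1 else 0)" using fin by (simp add: sum.delta)
  finally show ?thesis .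
qed

lemma sides_subset: "sides n \<subseteq> E"
  by (simp add: edges_def)

lemma eF_closed: "eF n \<in> kq_carrier n \<sigma>"
  unfolding eF_def by (rule kq_idempotent_closed[OF sides_subset])

lemma Theta_eF: "Theta (cls n \<sigma> (eF n)) e e' = (if e = e' \<and> e \<in> sides n then 1 else (0 :: 'k::field poly))"
  unfolding Theta_cls[OF eF_closed] unfolding eF_def by (rule Phi_idempotent[OF sides_subset])

section \<open>The action of K[x] through the minimal cycles\<close>

lemma min_cycle_small:
  assumes "e \<in> E"
  obtains p where "min_cycle n \<sigma> e = (e, p)" "small_cycle e p"
proof -
  let ?P = "\<lambda>T. T \<in> triangles n \<sigma> \<and> e \<in> fst ` set (tri_cycle T)"
  define T where "T = (SOME T. ?P T)"
  have "(fst e, snd e) \<in> E" using assms by simp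
  then obtain a r where "fst a = e" "tri_rest a r" using out_internal by (metis prod.collapse)
  then have "\<exists>T. ?P T" unfolding tri_rest_def by (metis image_eqI in_set_conv_decomp)
  then have T: "T \<in> triangles n \<sigma>" "e \<in> fst ` set (tri_cycle T)" unfolding T_def by (metis (mono_tags, lifting) someI_ex)+
  have len: "length (tri_cycle T) = 3" by (cases T) simp
  have dis: "distinct (map fst (tri_cycle T))" using T(1) by (cases T) (auto simp: triangles_def)
  obtain m where m: "m < 3" "fst (tri_cycle T ! m) = e" using T(2) len by (metis imageE in_set_conv_nth)
  have uniq: "m' = m" if "m' < 3" "fst (tri_cycle T ! m') = e" for m'
    using nth_eq_iff_index_eq[OF dis, of m' m] that m len by simp
  have "(THE m. m < 3 \<and> fst (tri_cycle T ! m) = e) = m"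
    by (rule the_equality, intro conjI m) (use uniq in blast)
  then have mc: "min_cycle n \<sigma> e = (e, rotate m (tri_cycle T))"
    by (simp add: min_cycle_def T_def[symmetric] Let_def)
  let ?a = "tri_cycle T ! m"
  have "rotate m (tri_cycle T) = ?a # (drop (Suc m) (tri_cycle T) @ take m (tri_cycle T))"
    using m(1) len by (simp add: rotate_drop_take Cons_nth_drop_Suc)
  moreover have "tri_rest ?a (drop (Suc m) (tri_cycle T) @ take m (tri_cycle T))"
    unfolding tri_rest_def
    using T(1) id_take_nth_drop[of m "tri_cycle T"] m(1) len by (intro bexI[of _ T] exI conjI) simp_all
  ultimately have "small_cycle e (rotate m (tri_cycle T))" using m(2) unfolding small_cycle_def by blast
  then show ?thesis using that mc by blast
qed

text \<open>Each minimal cycle is closed of weight 1, so the sum becomes x times the identity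
  matrix. Polynomials in it therefore act as scalars and are central.\<close>

lemma Csum_properties:
  shows "Csum n \<sigma> \<in> (kq_carrier n \<sigma> :: ('k::field) kq set)"
    "Phi (Csum n \<sigma>) d d' = (if d = d' \<and> d \<in> E then monom (1 :: 'k) 1 else 0)"
proof -
  let ?m = "min_cycle n \<sigma>"
  have nz: "{p. Csum n \<sigma> p \<noteq> (0 :: 'k)} = ?m ` E" by (auto simp: Csum_def)
  have mE: "fst (?m e) = e" "path_ok Ar e (snd (?m e))" "path_end e (snd (?m e)) = e" "weight (snd (?m e)) = 1"
    if e: "e \<in> E" for e
  proof -
    obtain p where "?m e = (e, p)" "small_cycle e p" using min_cycle_small[OF e] by blast
    then show "fst (?m e) = e" "path_ok Ar e (snd (?m e))" "path_end e (snd (?m e)) = e" "weight (snd (?m e)) = 1"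
      using small_cycle_path by simp_all
  qed
  show "Csum n \<sigma> \<in> (kq_carrier n \<sigma> :: 'k kq set)"
  proof (rule kq_carrierI)
    show "finite {p. Csum n \<sigma> p \<noteq> (0 :: 'k)}" unfolding nz using finite_E by simp
    fix p assume "Csum n \<sigma> p \<noteq> (0 :: 'k)"
    then obtain e where "e \<in> E" "p = ?m e" using nz by blast
    then show "valid_path p" using mE by simp
  qed
  have inj: "inj_on ?m E" by (rule inj_onI) (metis mE(1))
  have "Phi (Csum n \<sigma>) d d' = (\<Sum>e\<in>E. if fst (?m e) = d \<and> path_end d (snd (?m e)) = d'
      then monom (Csum n \<sigma> (?m e) :: 'k) (weight (snd (?m e))) else 0)"
    unfolding Phi_def nz by (rule sum.reindex_cong[OF inj]) auto
  also have "\<dots> = (\<Sum>e\<in>E. if e = d then (if d = d' then monom (1 :: 'k) 1 else 0) else 0)"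
  proof (rule sum.cong)
    fix e assume e: "e \<in> E"
    then have "Csum n \<sigma> (?m e) = (1 :: 'k)" unfolding Csum_def by auto
    then show "(if fst (?m e) = d \<and> path_end d (snd (?m e)) = d'
      then monom (Csum n \<sigma> (?m e) :: 'k) (weight (snd (?m e))) else 0)
      = (if e = d then (if d = d' then monom (1 :: 'k) 1 else 0) else 0)"
      using mE[OF e] by (cases "e = d"; cases "d = d'") simp_all
  qed simp
  also have "\<dots> = (if d = d' \<and> d \<in> E then monom 1 1 else 0)" using finite_E by (simp add: sum.delta)
  finally show "Phi (Csum n \<sigma>) d d' = (if d = d' \<and> d \<in> E then monom (1 :: 'k) 1 else 0)" .
qed

lemma Csum_power:
  shows "Csum n \<sigma> [^]\<^bsub>KQ n \<sigma>\<^esub> k \<in> (kq_carrier n \<sigma> :: ('k::field) kq set)"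
    "Phi (Csum n \<sigma> [^]\<^bsub>KQ n \<sigma>\<^esub> (k::nat)) d d' = (if d = d' \<and> d \<in> E then monom (1 :: 'k) k else 0)"
proof -
  interpret R: ring "KQ n \<sigma> :: 'k kq ring" by (rule ring_KQ)
  have C: "Csum n \<sigma> \<in> (kq_carrier n \<sigma> :: 'k kq set)" by (rule Csum_properties)
  have cl: "Csum n \<sigma> [^]\<^bsub>KQ n \<sigma>\<^esub> k \<in> (kq_carrier n \<sigma> :: 'k kq set)" for k :: nat
    using R.nat_pow_closed[of "Csum n \<sigma>" k] C by simp
  show "Csum n \<sigma> [^]\<^bsub>KQ n \<sigma>\<^esub> k \<in> (kq_carrier n \<sigma> :: 'k kq set)" by (rule cl)
  show "Phi (Csum n \<sigma> [^]\<^bsub>KQ n \<sigma>\<^esub> (k::nat)) d d' = (if d = d' \<and> d \<in> E then monom (1 :: 'k) k else 0)"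
  proof (induction k arbitrary: d d')
    case 0
    have "Phi (kq_one n \<sigma>) d d' = (if d = d' \<and> d \<in> E then 1 else (0 :: 'k poly))"
      unfolding kq_one_def by (rule Phi_idempotent) simp
    then show ?case by (cases "d = d'") (simp_all add: monom_0 one_pCons)
  next
    case (Suc k)
    have "Phi (kq_mult (Csum n \<sigma> [^]\<^bsub>KQ n \<sigma>\<^esub> k) (Csum n \<sigma>)) d d'
      = (\<Sum>c\<in>E. (if d = c \<and> d \<in> E then monom (1 :: 'k) k else 0) * (if c = d' \<and> c \<in> E then monom 1 1 else 0))"
      unfolding Phi_mult[OF cl C] Suc.IH Csum_properties(2) ..
    also have "\<dots> = (\<Sum>c\<in>E. if c = d then (if d = d' \<and> d \<in> E then monom (1 :: 'k) (Suc k) else 0) else 0)"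
      by (rule sum.cong) (auto simp: mult_monom)
    also have "\<dots> = (if d = d' \<and> d \<in> E then monom (1 :: 'k) (Suc k) else 0)"
      using finite_E by (simp add: sum.delta)
    finally show ?case by simp
  qed
qed

lemma Phi_finsum:
  fixes F :: "'b \<Rightarrow> ('k::field) kq"
  assumes "finite A" "\<And>k. k \<in> A \<Longrightarrow> F k \<in> kq_carrier n \<sigma>"
  shows "finsum (KQ n \<sigma>) F A \<in> kq_carrier n \<sigma> \<and>
    Phi (finsum (KQ n \<sigma>) F A) = (\<lambda>d d'. \<Sum>k\<in>A. Phi (F k) d d')"
proof -
  interpret R: ring "KQ n \<sigma> :: 'k kq ring" by (rule ring_KQ)
  show ?thesis using assms
  proof (induction A rule: finite_induct)
    case empty
    then show ?case using R.finsum_empty[of F] kq_zero_closed by simp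
  next
    case (insert a A)
    have "finsum (KQ n \<sigma>) F (insert a A) = F a \<oplus>\<^bsub>KQ n \<sigma>\<^esub> finsum (KQ n \<sigma>) F A"
      by (rule R.finsum_insert) (use insert in auto)
    then show ?case using insert by (simp add: kq_add_closed Phi_add_fun)
  qed
qed

lemma polyact_properties:
  fixes q :: "('k::field) poly"
  shows "polyact n \<sigma> q \<in> carrier G"
    "Theta (polyact n \<sigma> q) d d' = (if d = d' \<and> d \<in> E then q else 0)"
proof -
  let ?F = "\<lambda>k. \<lambda>p. coeff q k * (Csum n \<sigma> [^]\<^bsub>KQ n \<sigma>\<^esub> k) p"
  have F: "?F k \<in> kq_carrier n \<sigma>" for k by (rule kq_scale_closed[OF Csum_power(1)])
  have ifq: "(\<Sum>k\<le>degree q. if c then monom (coeff q k) k else 0) = (if c then q else 0)" for c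
    by (cases c) (simp_all add: poly_as_sum_of_monoms)
  note S = Phi_finsum[of "{..degree q}" ?F, OF finite_atMost F]
  show "polyact n \<sigma> q \<in> carrier G" unfolding polyact_def using S cls_closed by blast
  have "Theta (polyact n \<sigma> q) d d' = (\<Sum>k\<le>degree q. Phi (?F k) d d')"
    unfolding polyact_def Theta_cls[OF conjunct1[OF S]] conjunct2[OF S] ..
  also have "\<dots> = (\<Sum>k\<le>degree q. if d = d' \<and> d \<in> E then monom (coeff q k) k else 0)"
    unfolding Phi_scale[OF Csum_power(1)] Csum_power(2) by (rule sum.cong) (auto simp: smult_monom)
  also have "\<dots> = (if d = d' \<and> d \<in> E then q else 0)"
    using ifq[of "d = d' \<and> d \<in> E"] .
  finally show "Theta (polyact n \<sigma> q) d d' = (if d = d' \<and> d \<in> E then q else 0)" .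
qed

lemma Theta_polyact_left:
  assumes "g \<in> carrier G" shows "Theta (polyact n \<sigma> q \<otimes>\<^bsub>G\<^esub> g) e e' = q * Theta g e e'"
proof -
  have "Theta (polyact n \<sigma> q \<otimes>\<^bsub>G\<^esub> g) e e' = (\<Sum>d\<in>E. if d = e then q * Theta g e e' else 0)"
    unfolding Theta_mult[OF polyact_properties(1) assms] polyact_properties(2) by (rule sum.cong) auto
  also have "\<dots> = q * Theta g e e'" using finite_E Theta_outside[OF assms] by (simp add: sum.delta)
  finally show ?thesis .
qed

lemma Theta_polyact_right:
  assumes "g \<in> carrier G" shows "Theta (g \<otimes>\<^bsub>G\<^esub> polyact n \<sigma> q) e e' = q * Theta g e e'"
proof -
  have "Theta (g \<otimes>\<^bsub>G\<^esub> polyact n \<sigma> q) e e' = (\<Sum>d\<in>E. if d = e' then q * Theta g e e' else 0)"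
    unfolding Theta_mult[OF assms polyact_properties(1)] polyact_properties(2) by (rule sum.cong) auto
  also have "\<dots> = q * Theta g e e'" using finite_E Theta_outside[OF assms] by (simp add: sum.delta)
  finally show ?thesis .
qed

lemma polyact_central:
  assumes "g \<in> carrier G" shows "g \<otimes>\<^bsub>G\<^esub> polyact n \<sigma> q = polyact n \<sigma> q \<otimes>\<^bsub>G\<^esub> g"
  by (intro Theta_eqI G_mult_closed polyact_properties(1) assms)
    (simp add: Theta_polyact_left Theta_polyact_right assms)

section \<open>Cutting down by the idempotent of the sides\<close>

lemma Theta_eF_left:
  assumes "g \<in> carrier G"
  shows "Theta (cls n \<sigma> (eF n) \<otimes>\<^bsub>G\<^esub> g) e e' = (if e \<in> sides n then Theta g e e' else 0)"
proof -
  have "Theta (cls n \<sigma> (eF n) \<otimes>\<^bsub>G\<^esub> g) e e' = (\<Sum>d\<in>E. if d = e then (if e \<in> sides n then Theta g e e' else 0) else 0)"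
    unfolding Theta_mult[OF cls_closed[OF eF_closed] assms] Theta_eF by (rule sum.cong) auto
  also have "\<dots> = (if e \<in> sides n then Theta g e e' else 0)"
    using finite_E sides_subset by (auto simp: sum.delta)
  finally show ?thesis .
qed

lemma Theta_eF_right:
  assumes "g \<in> carrier G"
  shows "Theta (g \<otimes>\<^bsub>G\<^esub> cls n \<sigma> (eF n)) e e' = (if e' \<in> sides n then Theta g e e' else 0)"
proof -
  have "Theta (g \<otimes>\<^bsub>G\<^esub> cls n \<sigma> (eF n)) e e' = (\<Sum>d\<in>E. if d = e' then (if e' \<in> sides n then Theta g e e' else 0) else 0)"
    unfolding Theta_mult[OF assms cls_closed[OF eF_closed]] Theta_eF by (rule sum.cong) auto
  also have "\<dots> = (if e' \<in> sides n then Theta g e e' else 0)"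
    using finite_E sides_subset by (auto simp: sum.delta)
  finally show ?thesis .
qed

lemma eF_Gamma_iff:
  "t \<in> eF_Gamma n \<sigma> \<longleftrightarrow> t \<in> carrier G \<and> (\<forall>e e'. e \<notin> sides n \<longrightarrow> Theta t e e' = (0 :: 'k::field poly))"
proof
  note F = cls_closed[OF eF_closed, where 'a = 'k]
  {
    assume "t \<in> eF_Gamma n \<sigma>"
    then obtain g where "g \<in> carrier G" "t = cls n \<sigma> (eF n) \<otimes>\<^bsub>G\<^esub> g" unfolding eF_Gamma_def by blast
    then show "t \<in> carrier G \<and> (\<forall>e e'. e \<notin> sides n \<longrightarrow> Theta t e e' = 0)"
      using F by (simp add: Theta_eF_left G_mult_closed)
  next
    assume t: "t \<in> carrier G \<and> (\<forall>e e'. e \<notin> sides n \<longrightarrow> Theta t e e' = 0)"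
    then have z: "t \<in> carrier G" "\<And>e e'. e \<notin> sides n \<Longrightarrow> Theta t e e' = 0" by blast+
    then have "t = cls n \<sigma> (eF n) \<otimes>\<^bsub>G\<^esub> t" using F by (intro Theta_eqI) (simp_all add: Theta_eF_left G_mult_closed)
    then show "t \<in> eF_Gamma n \<sigma>" using t unfolding eF_Gamma_def by blast
  }
qed

lemma eF_Gamma_eF_iff:
  "t \<in> eF_Gamma_eF n \<sigma> \<longleftrightarrow> t \<in> carrier G \<and>
    (\<forall>e e'. e \<notin> sides n \<or> e' \<notin> sides n \<longrightarrow> Theta t e e' = (0 :: 'k::field poly))"
proof
  note F = cls_closed[OF eF_closed, where 'a = 'k]
  {
    assume "t \<in> eF_Gamma_eF n \<sigma>"
    then obtain g where "g \<in> carrier G" "t = cls n \<sigma> (eF n) \<otimes>\<^bsub>G\<^esub> g \<otimes>\<^bsub>G\<^esub> cls n \<sigma> (eF n)"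
      unfolding eF_Gamma_eF_def by blast
    then show "t \<in> carrier G \<and> (\<forall>e e'. e \<notin> sides n \<or> e' \<notin> sides n \<longrightarrow> Theta t e e' = 0)"
      using F by (simp add: Theta_eF_left Theta_eF_right G_mult_closed)
  next
    assume t: "t \<in> carrier G \<and> (\<forall>e e'. e \<notin> sides n \<or> e' \<notin> sides n \<longrightarrow> Theta t e e' = 0)"
    then have z: "t \<in> carrier G" "\<And>e e'. e \<notin> sides n \<or> e' \<notin> sides n \<Longrightarrow> Theta t e e' = 0" by blast+
    then have "t = cls n \<sigma> (eF n) \<otimes>\<^bsub>G\<^esub> t \<otimes>\<^bsub>G\<^esub> cls n \<sigma> (eF n)"
      using F by (intro Theta_eqI) (simp_all add: Theta_eF_left Theta_eF_right G_mult_closed)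
    then show "t \<in> eF_Gamma_eF n \<sigma>" using t unfolding eF_Gamma_eF_def by blast
  }
qed

definition Theta_inv :: "(edge \<Rightarrow> edge \<Rightarrow> ('k::field) poly) \<Rightarrow> 'k kq set" where
  "Theta_inv = inv_into (carrier G) Theta"

lemma Theta_inv:
  assumes "M \<in> edge_matrices"
  shows "Theta_inv M \<in> carrier G" "Theta (Theta_inv M) = M"
proof -
  have "M \<in> Theta ` carrier G" using assms bij_betw_imp_surj_on[OF Theta_bij] by blast
  then show "Theta_inv M \<in> carrier G" "Theta (Theta_inv M) = M"
    unfolding Theta_inv_def by (rule inv_into_into, rule f_inv_into_f)
qed

end

subsection \<open>The order and its module\<close>

abbreviation emb :: "('k::field) poly \<Rightarrow> 'k poly fract" where "emb p \<equiv> Fract p 1"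

lemma emb_add: "emb (p + q) = emb p + emb q" and emb_mult: "emb (p * q) = emb p * emb q"
  and emb_zero: "emb 0 = 0" and emb_one: "emb 1 = 1" and emb_eq_iff: "emb p = emb q \<longleftrightarrow> p = q"
  by (simp_all add: eq_fract Zero_fract_def One_fract_def)

lemma emb_sum: "emb (\<Sum>x\<in>A. f x) = (\<Sum>x\<in>A. emb (f x))"
  by (induction A rule: infinite_finite_induct) (simp_all only: sum.infinite sum.empty sum.insert emb_zero emb_add not_False_eq_True)

lemma emb_monom: "emb (monom 1 k) = (Xf :: ('k::field) poly fract) ^ k"
proof (induction k)
  case 0
  then show ?case by (simp add: monom_0 one_pCons[symmetric] emb_one)
next
  case (Suc k)
  have "monom 1 (Suc k) = [:0, 1:] * monom (1::'k) k" by (simp add: monom_Suc)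
  then have "emb (monom (1::'k) (Suc k)) = Xf * emb (monom 1 k)" by (simp only: emb_mult Xf_def)
  then show ?case using Suc by simp
qed

lemma Xf_nonzero: "(Xf :: ('k::field) poly fract) \<noteq> 0"
  using emb_eq_iff[of "[:0, 1:]" "0 :: 'k poly"] by (simp add: Xf_def emb_zero)

lemma Xf_powi_add: "Xf powi (m + n) = (Xf powi m * Xf powi n :: ('k::field) poly fract)"
  by (rule power_int_add) (simp add: Xf_nonzero)

text \<open>Turns divisibility of entries into membership in a fractional ideal; the free shift
  \<open>t\<close> absorbs the conjugating powers of x.\<close>

lemma dvd_iff_xpowR:
  "monom 1 d dvd p \<longleftrightarrow> emb p * Xf powi t \<in> xpowR (int d + (t :: int))" for p :: "('k::field) poly"
proof
  assume "monom 1 d dvd p"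
  then obtain q where "p = monom 1 d * q" by (rule dvdE)
  then have "emb p * Xf powi t = emb q * Xf powi (int d + t)"
    by (simp add: emb_mult emb_monom Xf_powi_add mult.commute mult.left_commute del: mult_fract)
  then show "emb p * Xf powi t \<in> xpowR (int d + t)" unfolding xpowR_def by blast
next
  assume "emb p * Xf powi t \<in> xpowR (int d + t)"
  then obtain q where "emb p * Xf powi t = emb q * Xf powi (int d + t)" unfolding xpowR_def by blast
  then have "emb p * Xf powi t = emb (monom 1 d * q) * Xf powi t"
    by (simp add: emb_mult emb_monom Xf_powi_add mult.commute mult.left_commute del: mult_fract)
  then have "emb p = emb (monom 1 d * q)" by (simp add: Xf_nonzero del: mult_fract)
  then show "monom 1 d dvd p" unfolding emb_eq_iff by simp
qed

lemma xpowR_obtain: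
  assumes "a \<in> xpowR (int d + t)"
  obtains p :: "('k::field) poly" where "monom 1 d dvd p" "emb p * Xf powi t = a"
proof -
  obtain q where q: "a = emb q * Xf powi (int d + t)" using assms unfolding xpowR_def by blast
  show ?thesis
    by (rule that[of "monom 1 d * q"]) (simp_all add: q emb_mult emb_monom Xf_powi_add mult.commute mult.left_commute del: mult_fract)
qed

context triangulated_polygon
begin

text \<open>The sides \<open>side i\<close> index the rows and columns of \<open>\<Lambda>\<close>. Column \<open>n\<close> of \<open>\<Lambda>\<close> is
  \<open>x\<inverse> (1,n)\<close>, which the conjugation by \<open>Xf powi off i\<close> takes into account.\<close>

definition side :: "nat \<Rightarrow> edge" where "side i = (if i = n then (1, n) else (i, Suc i))"

definition off :: "nat \<Rightarrow> int" where "off i = (if i = n then 1 else 0)"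

lemma side_bij: "bij_betw side {1..n} (sides n)"
  unfolding bij_betw_def
proof
  show "inj_on side {1..n}" using n3 by (auto simp: inj_on_def side_def split: if_splits)
  show "side ` {1..n} = sides n"
  proof (intro equalityI subsetI)
    fix e assume "e \<in> side ` {1..n}"
    then show "e \<in> sides n" by (auto simp: side_def sides_def is_side_def split: if_splits)
  next
    fix e assume "e \<in> sides n"
    then consider "e = (1, n)" | i where "1 \<le> i" "i < n" "e = (i, Suc i)"
      by (cases e) (auto simp: sides_def is_side_def)
    then show "e \<in> side ` {1..n}"
    proof cases
      case 1
      then show ?thesis using n3 by (intro image_eqI[of _ _ n]) (auto simp: side_def)
    next
      case (2 i)
      then show ?thesis by (intro image_eqI[of _ _ i]) (auto simp: side_def)
    qed
  qed
qed

lemma side_in: "i \<in> {1..n} \<Longrightarrow> side i \<in> sides n" "i \<in> {1..n} \<Longrightarrow> side i \<in> E"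
  using bij_betwE[OF side_bij] sides_subset by blast+

text \<open>These are the exponents of the rows of the module (a,b). Row n corresponds to the side
  (1,n), whose degree to any edge is one less than the pair (n,n+1) would give; \<open>off\<close>
  makes up for this.\<close>

lemma ddeg_side:
  assumes "i \<in> {1..n}" "1 \<le> a" "a < b" "b \<le> n"
  shows "int (ddeg (side i) (a, b)) + off i = (if i \<le> a then 0 else if i \<le> b then 1 else 2)"
  using assms n3 by (auto simp: ddeg_def side_def off_def)

lemma ddeg_side_side:
  assumes "i \<in> {1..n}" "j \<in> {1..n}"
  shows "int (ddeg (side i) (side j)) + (off i - off j) = cexp n i j"
  using assms n3 by (auto simp: ddeg_def side_def off_def cexp_def)

text \<open>The excess that defines \<open>ddeg e f\<close> is largest at row \<open>fst e\<close>
  or \<open>snd e\<close>, or it is 0, as already seen in row 1; the side of that number gives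
  equality. So the bound on an arbitrary entry can be tested on rows indexed by sides.\<close>

lemma ddeg_attained:
  assumes "e \<in> E" "f \<in> E"
  shows "\<exists>s\<in>sides n. ddeg s f = ddeg s e + ddeg e f"
proof -
  obtain v w p q where ef: "e = (v, w)" "f = (p, q)" by (cases e; cases f)
  have b: "1 \<le> v" "v < w" "w \<le> n" "1 \<le> p" "p < q" "q \<le> n"
    using edge_cases[of v w] edge_cases[of p q] assms ef by auto
  have "\<exists>i\<in>{1..n}. ddeg (side i) f = ddeg (side i) e + ddeg e f"
  proof -
    consider "q < v \<or> p < v" | "v \<le> p" "v \<le> q" "q < w" | "v \<le> p" "v \<le> q" "w \<le> q" by linarith
    then show ?thesis
    proof cases
      case 1
      then show ?thesis using b by (intro bexI[of _ v]) (auto simp: ef side_def ddeg_def)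
    next
      case 2
      then show ?thesis using b by (intro bexI[of _ w]) (auto simp: ef side_def ddeg_def)
    next
      case 3
      then show ?thesis using b n3 by (intro bexI[of _ 1]) (auto simp: ef side_def ddeg_def)
    qed
  qed
  then show ?thesis using side_in by blast
qed

lemma sum_sides: "(\<Sum>e\<in>sides n. h e) = (\<Sum>i\<in>{1..n}. h (side i))"
  using sum.reindex_bij_betw[OF side_bij, of h] by simp

lemma sum_E_sides: 
  assumes "\<And>e. e \<in> E \<Longrightarrow> e \<notin> sides n \<Longrightarrow> h e = 0"
  shows "(\<Sum>e\<in>E. h e) = (\<Sum>i\<in>{1..n}. h (side i))"
  unfolding sum_sides[symmetric]
  by (rule sum.mono_neutral_right) (use finite_E sides_subset assms in auto)

section \<open>From the side rows of the matrix ring to the order and the modules (s,t)\<close>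

definition to_mat :: "('k::field) kq set \<Rightarrow> 'k mat" where
  "to_mat g = (\<lambda>i j. if i \<in> {1..n} \<and> j \<in> {1..n} then emb (Theta g (side i) (side j)) * Xf powi (off i - off j) else 0)"

definition to_vec :: "('k::field) kq set \<Rightarrow> edge \<Rightarrow> 'k vec" where
  "to_vec g = (\<lambda>e i. if e \<in> E \<and> i \<in> {1..n} then emb (Theta g (side i) e) * Xf powi (off i) else 0)"

text \<open>Packages surjectivity of \<open>Theta\<close> with entrywise choice, so that later
  constructions only have to prescribe single entries.\<close>

lemma edge_matrix_exists:
  assumes "\<And>e e'. e \<in> E \<Longrightarrow> e' \<in> E \<Longrightarrow> \<exists>p. monom 1 (ddeg e e') dvd p \<and> Q e e' p"
  shows "\<exists>g\<in>carrier (G :: 'k::field kq set ring). \<forall>e\<in>E. \<forall>e'\<in>E. Q e e' (Theta g e e')"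
proof -
  define M where "M e e' = (if e \<in> E \<and> e' \<in> E then (SOME p. monom 1 (ddeg e e') dvd p \<and> Q e e' p) else (0 :: 'k poly))" for e e'
  have *: "monom 1 (ddeg e e') dvd M e e' \<and> Q e e' (M e e')" if "e \<in> E" "e' \<in> E" for e e'
    using someI_ex[OF assms[OF that]] that unfolding M_def by simp
  have "monom 1 (ddeg e e') dvd M e e'" for e e'
  proof (cases "e \<in> E \<and> e' \<in> E")
    case True
    then show ?thesis using * by blast
  next
    case False
    then have "M e e' = 0" unfolding M_def by argo
    then show ?thesis by simp
  qed
  moreover have "M e e' = 0" if "e \<notin> E \<or> e' \<notin> E" for e e'
    unfolding M_def using that by argo
  ultimately have "M \<in> edge_matrices" unfolding edge_matrices_def by blast
  then show ?thesis using Theta_inv[of M] * by metis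
qed

lemma to_mat_bij: "bij_betw to_mat (eF_Gamma_eF n \<sigma>) (Lambda n :: ('k::field) mat set)"
  unfolding bij_betw_def
proof
  show "inj_on to_mat (eF_Gamma_eF n \<sigma> :: 'k kq set set)"
  proof (rule inj_onI)
    fix g h :: "'k kq set" assume g: "g \<in> eF_Gamma_eF n \<sigma>" and h: "h \<in> eF_Gamma_eF n \<sigma>" and eq: "to_mat g = to_mat h"
    show "g = h"
    proof (rule Theta_eqI)
      fix e e'
      show "Theta g e e' = Theta h e e'"
      proof (cases "e \<in> sides n \<and> e' \<in> sides n")
        case True
        then obtain i j where ij: "i \<in> {1..n}" "e = side i" "j \<in> {1..n}" "e' = side j"
          using bij_betw_imp_surj_on[OF side_bij] by blast
        have "to_mat g i j = to_mat h i j" using eq by simp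
        then have "emb (Theta g e e') = emb (Theta h e e')" using ij by (simp add: to_mat_def Xf_nonzero)
        then show ?thesis unfolding emb_eq_iff .
      next
        case False
        then have "Theta g e e' = 0" "Theta h e e' = 0" using g h unfolding eF_Gamma_eF_iff by blast+
        then show ?thesis by simp
      qed
    qed (use g h eF_Gamma_eF_iff in blast)+
  qed
  show "to_mat ` eF_Gamma_eF n \<sigma> = (Lambda n :: 'k mat set)"
  proof (intro equalityI subsetI)
    fix A :: "'k mat" assume "A \<in> to_mat ` eF_Gamma_eF n \<sigma>"
    then obtain g where g: "g \<in> eF_Gamma_eF n \<sigma>" "A = to_mat g" by blast
    then have "g \<in> carrier G" using eF_Gamma_eF_iff by blast
    then have "A i j \<in> xpowR (cexp n i j)" if "i \<in> {1..n}" "j \<in> {1..n}" for i j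
      unfolding ddeg_side_side[OF that, symmetric] g(2) to_mat_def
      using that Theta_dvd[of g "side i" "side j"] by (simp add: dvd_iff_xpowR[where t = "off i - off j"])
    then show "A \<in> Lambda n" unfolding Lambda_def using g(2) by (auto simp: to_mat_def)
  next
    fix A :: "'k mat" assume A: "A \<in> Lambda n"
    \<comment> \<open>The prescription is indexed by edges: the entry of \<open>A\<close> between
      two sides, and 0 elsewhere, which puts the element into the corner.\<close>
    define Q where "Q e e' p \<longleftrightarrow> (\<forall>i\<in>{1..n}. \<forall>j\<in>{1..n}. e = side i \<longrightarrow> e' = side j \<longrightarrow> emb p * Xf powi (off i - off j) = A i j)
       \<and> (e \<notin> sides n \<or> e' \<notin> sides n \<longrightarrow> p = 0)" for e e' p
    have "\<exists>p. monom 1 (ddeg e e') dvd p \<and> Q e e' p" if "e \<in> E" "e' \<in> E" for e e'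
    proof (cases "e \<in> sides n \<and> e' \<in> sides n")
      case True
      then obtain i j where ij: "i \<in> {1..n}" "e = side i" "j \<in> {1..n}" "e' = side j"
        using bij_betw_imp_surj_on[OF side_bij] by blast
      have "A i j \<in> xpowR (int (ddeg e e') + (off i - off j))"
        using A ij ddeg_side_side[of i j] unfolding Lambda_def by simp
      then obtain p where p: "monom 1 (ddeg e e') dvd p" "emb p * Xf powi (off i - off j) = A i j" by (rule xpowR_obtain)
      have "i' = i" "j' = j" if "i' \<in> {1..n}" "j' \<in> {1..n}" "e = side i'" "e' = side j'" for i' j'
        using inj_onD[OF bij_betw_imp_inj_on[OF side_bij]] that ij by metis+
      then have "Q e e' p" using p True unfolding Q_def by blast
      then show ?thesis using p(1) by blast
    next
      case False
      then have "Q e e' 0" unfolding Q_def using bij_betwE[OF side_bij] by blast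
      then show ?thesis by (intro exI[of _ 0]) simp
    qed
    then obtain g :: "'k kq set" where g: "g \<in> carrier G" "\<And>e e'. e \<in> E \<Longrightarrow> e' \<in> E \<Longrightarrow> Q e e' (Theta g e e')"
      using edge_matrix_exists[of Q] by blast
    have "Theta g e e' = 0" if "e \<notin> sides n \<or> e' \<notin> sides n" for e e'
      using Theta_outside[OF g(1), of e e'] g(2)[of e e'] that unfolding Q_def by blast
    then have "g \<in> eF_Gamma_eF n \<sigma>" unfolding eF_Gamma_eF_iff using g(1) by blast
    moreover have "to_mat g = A"
    proof (intro ext)
      fix i j
      show "to_mat g i j = A i j"
      proof (cases "i \<in> {1..n} \<and> j \<in> {1..n}")
        case True
        then show ?thesis using g(2)[of "side i" "side j"] side_in unfolding Q_def to_mat_def by simp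
      next
        case False
        then show ?thesis using A unfolding Lambda_def to_mat_def by auto
      qed
    qed
    ultimately show "A \<in> to_mat ` eF_Gamma_eF n \<sigma>" by blast
  qed
qed

lemma to_vec_bij: "bij_betw to_vec (eF_Gamma n \<sigma>) (DS n \<sigma> :: (edge \<Rightarrow> ('k::field) vec) set)"
  unfolding bij_betw_def
proof
  show "inj_on to_vec (eF_Gamma n \<sigma> :: 'k kq set set)"
  proof (rule inj_onI)
    fix g h :: "'k kq set" assume g: "g \<in> eF_Gamma n \<sigma>" and h: "h \<in> eF_Gamma n \<sigma>" and eq: "to_vec g = to_vec h"
    have gh: "g \<in> carrier G" "h \<in> carrier G" using g h eF_Gamma_iff by blast+
    show "g = h"
    proof (rule Theta_eqI[OF gh])
      fix e e'
      show "Theta g e e' = Theta h e e'"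
      proof (cases "e \<in> sides n \<and> e' \<in> E")
        case True
        then obtain i where i: "i \<in> {1..n}" "e = side i"
          using bij_betw_imp_surj_on[OF side_bij] by blast
        have "to_vec g e' i = to_vec h e' i" using eq by simp
        then have "emb (Theta g e e') = emb (Theta h e e')" using i True by (simp add: to_vec_def Xf_nonzero)
        then show ?thesis unfolding emb_eq_iff .
      next
        case False
        then have "Theta g e e' = 0" "Theta h e e' = 0"
          using g h Theta_outside[OF gh(1), of e e'] Theta_outside[OF gh(2), of e e'] unfolding eF_Gamma_iff by blast+
        then show ?thesis by simp
      qed
    qed
  qed
  show "to_vec ` eF_Gamma n \<sigma> = (DS n \<sigma> :: (edge \<Rightarrow> 'k vec) set)"
  proof (intro equalityI subsetI)
    fix A :: "edge \<Rightarrow> 'k vec" assume "A \<in> to_vec ` eF_Gamma n \<sigma>"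
    then obtain g where g: "g \<in> eF_Gamma n \<sigma>" "A = to_vec g" by blast
    then have gc: "g \<in> carrier G" using eF_Gamma_iff by blast
    have xp: "A e i \<in> xpowR (if i \<le> fst e then 0 else if i \<le> snd e then 1 else 2)" if ei: "e \<in> E" "i \<in> {1..n}" for e i
    proof -
      have eq: "int (ddeg (side i) e) + off i = (if i \<le> fst e then 0 else if i \<le> snd e then 1 else 2)"
        using ddeg_side[OF ei(2), of "fst e" "snd e"] edge_bounds[OF ei(1)] by simp
      have "emb (Theta g (side i) e) * Xf powi (off i) \<in> xpowR (int (ddeg (side i) e) + off i)"
        using Theta_dvd[OF gc, of "side i" e] unfolding dvd_iff_xpowR[where t = "off i"] .
      then show ?thesis unfolding eq g(2) to_vec_def using ei by simp
    qed
    show "A \<in> DS n \<sigma>" unfolding DS_def st_mod_def mem_Collect_eq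
    proof (intro conjI ballI allI impI)
      fix e i assume "i \<notin> {1..n}"
      then show "A e i = 0" unfolding g(2) to_vec_def by argo
    next
      fix e assume "e \<notin> E"
      then show "A e = (\<lambda>_. 0)" unfolding g(2) to_vec_def by simp
    qed (rule xp)
  next
    fix A :: "edge \<Rightarrow> 'k vec" assume A: "A \<in> DS n \<sigma>"
    define Q where "Q e e' p \<longleftrightarrow> (\<forall>i\<in>{1..n}. e = side i \<longrightarrow> emb p * Xf powi (off i) = A e' i)
       \<and> (e \<notin> sides n \<longrightarrow> p = 0)" for e e' p
    have "\<exists>p. monom 1 (ddeg e e') dvd p \<and> Q e e' p" if ee: "e \<in> E" "e' \<in> E" for e e'
    proof (cases "e \<in> sides n")
      case True
      then obtain i where i: "i \<in> {1..n}" "e = side i"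
        using bij_betw_imp_surj_on[OF side_bij] by blast
      have eq: "int (ddeg (side i) e') + off i = (if i \<le> fst e' then 0 else if i \<le> snd e' then 1 else 2)"
        using ddeg_side[OF i(1), of "fst e'" "snd e'"] edge_bounds[OF ee(2)] by simp
      have "A e' i \<in> xpowR (int (ddeg (side i) e') + off i)"
        unfolding eq using A ee(2) i(1) unfolding DS_def st_mod_def by blast
      then obtain p where p: "monom 1 (ddeg e e') dvd p" "emb p * Xf powi (off i) = A e' i"
        unfolding i(2)[symmetric] by (rule xpowR_obtain)
      have "i' = i" if "i' \<in> {1..n}" "e = side i'" for i'
        using inj_onD[OF bij_betw_imp_inj_on[OF side_bij]] that i by metis
      then have "Q e e' p" using p True unfolding Q_def by blast
      then show ?thesis using p(1) by blast
    next
      case False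
      then have "Q e e' 0" unfolding Q_def using bij_betwE[OF side_bij] by blast
      then show ?thesis by (intro exI[of _ 0]) simp
    qed
    then obtain g :: "'k kq set" where g: "g \<in> carrier G" "\<And>e e'. e \<in> E \<Longrightarrow> e' \<in> E \<Longrightarrow> Q e e' (Theta g e e')"
      using edge_matrix_exists[of Q] by blast
    have "Theta g e e' = 0" if "e \<notin> sides n" for e e'
      using Theta_outside[OF g(1), of e e'] g(2)[of e e'] that unfolding Q_def by blast
    then have "g \<in> eF_Gamma n \<sigma>" unfolding eF_Gamma_iff using g(1) by blast
    moreover have "to_vec g = A"
    proof (intro ext)
      fix e i
      show "to_vec g e i = A e i"
      proof (cases "e \<in> E \<and> i \<in> {1..n}")
        case True
        then show ?thesis using g(2)[of "side i" e] side_in unfolding Q_def to_vec_def by simp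
      next
        case False
        have "A e i = 0"
        proof (cases "e \<in> E")
          case True
          then show ?thesis using A False unfolding DS_def st_mod_def by blast
        next
          case False
          then have "A e = (\<lambda>_. 0)" using A unfolding DS_def by blast
          then show ?thesis by simp
        qed
        then show ?thesis using False unfolding to_vec_def by argo
      qed
    qed
    ultimately show "A \<in> to_vec ` eF_Gamma n \<sigma>" by blast
  qed
qed

lemma to_mat_mult:
  assumes "g \<in> eF_Gamma_eF n \<sigma>" "h \<in> eF_Gamma_eF n \<sigma>"
  shows "to_mat (g \<otimes>\<^bsub>G\<^esub> h) = mat_mul n (to_mat g) (to_mat (h :: ('k::field) kq set))"
proof (intro ext)
  fix i j
  have gh: "g \<in> carrier G" "h \<in> carrier G" using assms eF_Gamma_eF_iff by blast+
  have out: "Theta g (side i) d = 0" if "d \<notin> sides n" for d using assms(1) that unfolding eF_Gamma_eF_iff by blast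
  show "to_mat (g \<otimes>\<^bsub>G\<^esub> h) i j = mat_mul n (to_mat g) (to_mat h) i j"
  proof (cases "i \<in> {1..n} \<and> j \<in> {1..n}")
    case True
    have "Theta (g \<otimes>\<^bsub>G\<^esub> h) (side i) (side j) = (\<Sum>k\<in>{1..n}. Theta g (side i) (side k) * Theta h (side k) (side j))"
      unfolding Theta_mult[OF gh] by (rule sum_E_sides) (simp add: out)
    then have "to_mat (g \<otimes>\<^bsub>G\<^esub> h) i j
        = (\<Sum>k\<in>{1..n}. emb (Theta g (side i) (side k)) * emb (Theta h (side k) (side j)) * Xf powi (off i - off j))"
      using True by (simp only: to_mat_def if_True emb_sum emb_mult sum_distrib_right simp_thms)
    also have "\<dots> = (\<Sum>k\<in>{1..n}. to_mat g i k * to_mat h k j)"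
    proof (rule sum.cong)
      fix k assume k: "k \<in> {1..n}"
      \<comment> \<open>The offset of the middle index cancels, so conjugation respects
        products.\<close>
      have "Xf powi (off i - off j) = Xf powi (off i - off k) * (Xf powi (off k - off j) :: 'k poly fract)"
        by (simp flip: Xf_powi_add)
      then show "emb (Theta g (side i) (side k)) * emb (Theta h (side k) (side j)) * Xf powi (off i - off j)
        = to_mat g i k * to_mat h k j"
        using True k by (simp only: to_mat_def if_True simp_thms) (simp only: ac_simps)
    qed simp
    finally show ?thesis by (simp add: mat_mul_def)
  next
    case False
    then show ?thesis by (auto simp: to_mat_def mat_mul_def)
  qed
qed

lemma to_vec_act:
  assumes "g \<in> eF_Gamma_eF n \<sigma>" "t \<in> eF_Gamma n \<sigma>"
  shows "to_vec (g \<otimes>\<^bsub>G\<^esub> t) = DS_act n (to_mat g) (to_vec (t :: ('k::field) kq set))"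
proof (intro ext)
  fix e i
  have gt: "g \<in> carrier G" "t \<in> carrier G" using assms eF_Gamma_eF_iff eF_Gamma_iff by blast+
  have out: "Theta g (side i) d = 0" if "d \<notin> sides n" for d using assms(1) that unfolding eF_Gamma_eF_iff by blast
  show "to_vec (g \<otimes>\<^bsub>G\<^esub> t) e i = DS_act n (to_mat g) (to_vec t) e i"
  proof (cases "e \<in> E \<and> i \<in> {1..n}")
    case True
    have "Theta (g \<otimes>\<^bsub>G\<^esub> t) (side i) e = (\<Sum>k\<in>{1..n}. Theta g (side i) (side k) * Theta t (side k) e)"
      unfolding Theta_mult[OF gt] by (rule sum_E_sides) (simp add: out)
    then have "to_vec (g \<otimes>\<^bsub>G\<^esub> t) e i
        = (\<Sum>k\<in>{1..n}. emb (Theta g (side i) (side k)) * emb (Theta t (side k) e) * Xf powi (off i))"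
      using True by (simp only: to_vec_def if_True emb_sum emb_mult sum_distrib_right simp_thms)
    also have "\<dots> = (\<Sum>k\<in>{1..n}. to_mat g i k * to_vec t e k)"
    proof (rule sum.cong)
      fix k assume k: "k \<in> {1..n}"
      have "Xf powi off i = Xf powi (off i - off k) * (Xf powi off k :: 'k poly fract)"
        by (simp flip: Xf_powi_add)
      then show "emb (Theta g (side i) (side k)) * emb (Theta t (side k) e) * Xf powi (off i)
        = to_mat g i k * to_vec t e k"
        using True k by (simp only: to_mat_def to_vec_def if_True simp_thms) (simp only: ac_simps)
    qed simp
    finally show ?thesis by (simp add: DS_act_def mat_vec_def)
  next
    case False
    then show ?thesis by (auto simp: to_vec_def to_mat_def DS_act_def mat_vec_def)
  qed
qed

lemma eF_Gamma_eF_closed: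
  assumes "g \<in> eF_Gamma_eF n \<sigma>" "h \<in> eF_Gamma_eF n \<sigma>"
  shows "g \<oplus>\<^bsub>G\<^esub> h \<in> eF_Gamma_eF n \<sigma>" "g \<otimes>\<^bsub>G\<^esub> h \<in> eF_Gamma_eF n \<sigma>"
    "polyact n \<sigma> q \<otimes>\<^bsub>G\<^esub> g \<in> (eF_Gamma_eF n \<sigma> :: ('k::field) kq set set)"
proof -
  have gh: "g \<in> carrier G" "h \<in> carrier G" using assms eF_Gamma_eF_iff by blast+
  have z: "Theta g e e' = 0" "Theta h e e' = 0" if "e \<notin> sides n \<or> e' \<notin> sides n" for e e'
    using assms that unfolding eF_Gamma_eF_iff by blast+
  show "g \<oplus>\<^bsub>G\<^esub> h \<in> eF_Gamma_eF n \<sigma>" unfolding eF_Gamma_eF_iff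
  proof (intro conjI allI impI)
    fix e e' assume "e \<notin> sides n \<or> e' \<notin> sides n"
    then show "Theta (g \<oplus>\<^bsub>G\<^esub> h) e e' = 0" using z[of e e'] by (simp add: Theta_add[OF gh])
  qed (rule G_add_closed[OF gh])
  show "g \<otimes>\<^bsub>G\<^esub> h \<in> eF_Gamma_eF n \<sigma>" unfolding eF_Gamma_eF_iff
  proof (intro conjI allI impI)
    fix e e' assume "e \<notin> sides n \<or> e' \<notin> sides n"
    then show "Theta (g \<otimes>\<^bsub>G\<^esub> h) e e' = 0" unfolding Theta_mult[OF gh]
      using z(1)[of e] z(2)[of _ e'] by (intro sum.neutral) auto
  qed (rule G_mult_closed[OF gh])
  show "polyact n \<sigma> q \<otimes>\<^bsub>G\<^esub> g \<in> eF_Gamma_eF n \<sigma>" unfolding eF_Gamma_eF_iff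
  proof (intro conjI allI impI)
    fix e e' assume "e \<notin> sides n \<or> e' \<notin> sides n"
    then show "Theta (polyact n \<sigma> q \<otimes>\<^bsub>G\<^esub> g) e e' = 0" using z(1)[of e e'] by (simp add: Theta_polyact_left[OF gh(1)])
  qed (rule G_mult_closed[OF polyact_properties(1) gh(1)])
qed

section \<open>The order isomorphism and the module isomorphism\<close>

definition order_map :: "('k::field) mat \<Rightarrow> 'k kq set" where
  "order_map = inv_into (eF_Gamma_eF n \<sigma>) to_mat"

lemma order_map:
  assumes "A \<in> Lambda n" shows "order_map A \<in> eF_Gamma_eF n \<sigma>" "to_mat (order_map A) = A"
proof -
  have "A \<in> to_mat ` eF_Gamma_eF n \<sigma>" using assms bij_betw_imp_surj_on[OF to_mat_bij] by blast
  then show "order_map A \<in> eF_Gamma_eF n \<sigma>" "to_mat (order_map A) = A"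
    unfolding order_map_def by (rule inv_into_into, rule f_inv_into_f)
qed

lemma order_map_to_mat: "g \<in> eF_Gamma_eF n \<sigma> \<Longrightarrow> order_map (to_mat g) = g"
  unfolding order_map_def by (rule inv_into_f_f[OF bij_betw_imp_inj_on[OF to_mat_bij]])

lemma order_map_bij: "bij_betw order_map (Lambda n) (eF_Gamma_eF n \<sigma> :: ('k::field) kq set set)"
  unfolding order_map_def by (rule bij_betw_inv_into[OF to_mat_bij])

lemma order_iso_order_map: "order_iso n \<sigma> (order_map :: ('k::field) mat \<Rightarrow> 'k kq set)"
  unfolding order_iso_def
proof (intro conjI ballI allI)
  show "bij_betw order_map (Lambda n) (eF_Gamma_eF n \<sigma> :: 'k kq set set)" by (rule order_map_bij)
next
  fix A B :: "'k mat" assume "A \<in> Lambda n" "B \<in> Lambda n"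
  note A = order_map[OF \<open>A \<in> Lambda n\<close>] and B = order_map[OF \<open>B \<in> Lambda n\<close>]
  have c: "order_map A \<in> carrier G" "order_map B \<in> carrier G" using A(1) B(1) eF_Gamma_eF_iff by blast+
  have "to_mat (order_map A \<oplus>\<^bsub>G\<^esub> order_map B) = (\<lambda>i j. to_mat (order_map A) i j + to_mat (order_map B) i j)"
    by (intro ext) (simp add: to_mat_def Theta_add[OF c] emb_add distrib_right del: add_fract)
  then show "order_map (\<lambda>i j. A i j + B i j) = order_map A \<oplus>\<^bsub>G\<^esub> order_map B"
    unfolding A(2) B(2) using order_map_to_mat[OF eF_Gamma_eF_closed(1)[OF A(1) B(1)]] by simp
  show "order_map (mat_mul n A B) = order_map A \<otimes>\<^bsub>G\<^esub> order_map B"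
    using order_map_to_mat[OF eF_Gamma_eF_closed(2)[OF A(1) B(1)]]
    unfolding to_mat_mult[OF A(1) B(1)] A(2) B(2) .
next
  have F: "cls n \<sigma> (eF n) \<in> (eF_Gamma_eF n \<sigma> :: 'k kq set set)"
    unfolding eF_Gamma_eF_iff using cls_closed[OF eF_closed] Theta_eF by metis
  have "to_mat (cls n \<sigma> (eF n)) = (mat_one n :: 'k mat)"
  proof (intro ext)
    fix i j
    show "to_mat (cls n \<sigma> (eF n)) i j = (mat_one n i j :: 'k poly fract)"
    proof (cases "i \<in> {1..n} \<and> j \<in> {1..n}")
      case True
      then have "side i = side j \<longleftrightarrow> i = j" using inj_on_eq_iff[OF bij_betw_imp_inj_on[OF side_bij]] by blast
      then show ?thesis using True side_in[of i] by (simp add: to_mat_def mat_one_def Theta_eF emb_zero emb_one)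
    next
      case False
      then have "\<not> (i = j \<and> i \<in> {1..n})" by blast
      with False show ?thesis unfolding to_mat_def mat_one_def by (simp only: if_False)
    qed
  qed
  then show "order_map (mat_one n) = (cls n \<sigma> (eF n) :: 'k kq set)" using order_map_to_mat[OF F] by simp
next
  fix q and A :: "'k mat" assume "A \<in> Lambda n"
  note A = order_map[OF this]
  have c: "order_map A \<in> carrier G" using A(1) eF_Gamma_eF_iff by blast
  have "to_mat (polyact n \<sigma> q \<otimes>\<^bsub>G\<^esub> order_map A) = mat_smult q (to_mat (order_map A))"
    by (intro ext) (simp add: to_mat_def mat_smult_def Theta_polyact_left[OF c] emb_mult mult.assoc del: mult_fract)
  then show "order_map (mat_smult q A) = polyact n \<sigma> q \<otimes>\<^bsub>G\<^esub> order_map A"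
    using order_map_to_mat[OF eF_Gamma_eF_closed(3)[OF A(1) A(1), of q]] unfolding A(2) by simp
qed

lemma module_iso_to_vec: "module_iso n \<sigma> order_map (to_vec :: ('k::field) kq set \<Rightarrow> edge \<Rightarrow> 'k vec)"
  unfolding module_iso_def
proof (intro conjI ballI)
  show "bij_betw to_vec (eF_Gamma n \<sigma>) (DS n \<sigma> :: (edge \<Rightarrow> 'k vec) set)" by (rule to_vec_bij)
next
  fix a b :: "'k kq set" assume "a \<in> eF_Gamma n \<sigma>" "b \<in> eF_Gamma n \<sigma>"
  then have c: "a \<in> carrier G" "b \<in> carrier G" using eF_Gamma_iff by blast+
  show "to_vec (a \<oplus>\<^bsub>G\<^esub> b) = DS_add (to_vec a) (to_vec b)"
    by (intro ext) (simp add: to_vec_def DS_add_def Theta_add[OF c] emb_add distrib_right del: add_fract)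
next
  fix A :: "'k mat" and a :: "'k kq set" assume "A \<in> Lambda n" "a \<in> eF_Gamma n \<sigma>"
  then show "to_vec (order_map A \<otimes>\<^bsub>G\<^esub> a) = DS_act n A (to_vec a)"
    by (simp only: to_vec_act order_map)
qed

end

subsection \<open>Endomorphisms\<close>

context triangulated_polygon
begin

abbreviation T :: "('k::field) kq set set" where "T \<equiv> eF_Gamma n \<sigma>"

lemma T_carrier: "t \<in> T \<Longrightarrow> t \<in> carrier G" and T_zero: "t \<in> T \<Longrightarrow> e \<notin> sides n \<Longrightarrow> Theta t e e' = 0"
  unfolding eF_Gamma_iff by blast+

lemma T_add: "s \<in> T \<Longrightarrow> t \<in> T \<Longrightarrow> s \<oplus>\<^bsub>G\<^esub> t \<in> T"
  unfolding eF_Gamma_iff[of "s \<oplus>\<^bsub>G\<^esub> t"] by (simp add: T_carrier T_zero G_add_closed Theta_add)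

lemma T_mult: "t \<in> T \<Longrightarrow> g \<in> carrier G \<Longrightarrow> t \<otimes>\<^bsub>G\<^esub> g \<in> T"
  unfolding eF_Gamma_iff[of "t \<otimes>\<^bsub>G\<^esub> g"] by (simp add: T_carrier T_zero G_mult_closed Theta_mult)

lemma order_T: "g \<in> eF_Gamma_eF n \<sigma> \<Longrightarrow> g \<in> T"
  unfolding eF_Gamma_iff eF_Gamma_eF_iff by blast

text \<open>The multiple by \<open>p\<close> of the matrix unit at (e,e'); it exists in the algebra
  under the divisibility in \<open>elem\<close>.\<close>

definition elem :: "edge \<Rightarrow> edge \<Rightarrow> ('k::field) poly \<Rightarrow> 'k kq set" where
  "elem e e' p = Theta_inv (\<lambda>d d'. if d = e \<and> d' = e' then p else 0)"

lemma elem: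
  assumes "e \<in> E" "e' \<in> E" "monom 1 (ddeg e e') dvd p"
  shows "elem e e' p \<in> carrier G" "Theta (elem e e' p) d d' = (if d = e \<and> d' = e' then p else 0)"
proof -
  have "(\<lambda>d d'. if d = e \<and> d' = e' then p else 0) \<in> edge_matrices"
    unfolding edge_matrices_def mem_Collect_eq
  proof (intro allI conjI impI)
    fix d d' assume "d \<notin> E \<or> d' \<notin> E"
    then show "(if d = e \<and> d' = e' then p else 0) = 0" using assms by auto
  next
    fix d d'
    show "monom 1 (ddeg d d') dvd (if d = e \<and> d' = e' then p else 0)"
      using assms(3) by (cases "d = e \<and> d' = e'") (simp, simp only: if_False dvd_0_right)
  qed
  note I = Theta_inv[OF this]
  show "elem e e' p \<in> carrier G" unfolding elem_def by (rule I)
  show "Theta (elem e e' p) d d' = (if d = e \<and> d' = e' then p else 0)" unfolding elem_def I(2) ..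
qed

lemma elem_T:
  assumes "e \<in> sides n" "e' \<in> E" "monom 1 (ddeg e e') dvd p"
  shows "elem e e' p \<in> T"
proof -
  have e: "e \<in> E" using assms sides_subset by blast
  show ?thesis unfolding eF_Gamma_iff using elem[OF e assms(2,3)] assms(1) by auto
qed

lemma elem_order:
  assumes "e \<in> sides n" "e' \<in> sides n" "monom 1 (ddeg e e') dvd p"
  shows "elem e e' p \<in> eF_Gamma_eF n \<sigma>"
proof -
  have e: "e \<in> E" "e' \<in> E" using assms sides_subset by blast+
  show ?thesis unfolding eF_Gamma_eF_iff using elem[OF e assms(3)] assms(1,2) by auto
qed

lemma Theta_elem_mult:
  assumes "e \<in> E" "e' \<in> E" "monom 1 (ddeg e e') dvd p" "g \<in> carrier G"
  shows "Theta (elem e e' p \<otimes>\<^bsub>G\<^esub> g) d d' = (if d = e then p * Theta g e' d' else 0)"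
proof -
  have "Theta (elem e e' p \<otimes>\<^bsub>G\<^esub> g) d d' = (\<Sum>c\<in>E. if c = e' then (if d = e then p * Theta g e' d' else 0) else 0)"
    unfolding Theta_mult[OF elem(1)[OF assms(1-3)] assms(4)] elem(2)[OF assms(1-3)] by (rule sum.cong) auto
  also have "\<dots> = (if d = e then p * Theta g e' d' else 0)" using finite_E assms(2) by (simp add: sum.delta)
  finally show ?thesis .
qed

text \<open>For each edge \<open>e\<close>, row \<open>side 1\<close> of T contains a nonzero
  multiple of a unit in column \<open>e\<close>, and multiplying by it reads off row
  \<open>e\<close> up to a power of x.\<close>

lemma T_faithful:
  assumes "g \<in> carrier G" "h \<in> carrier (G :: 'k::field kq set ring)"
    "\<And>t. t \<in> T \<Longrightarrow> t \<otimes>\<^bsub>G\<^esub> g = t \<otimes>\<^bsub>G\<^esub> h"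
  shows "g = h"
proof (rule Theta_eqI[OF assms(1,2)])
  fix e e'
  show "Theta g e e' = Theta h e e'"
  proof (cases "e \<in> E")
    case True
    have s: "side 1 \<in> sides n" using side_in(1)[of 1] n3 by simp
    then have sE: "side 1 \<in> E" using sides_subset by blast
    let ?x = "monom (1::'k) (ddeg (side 1) e)"
    have "elem (side 1) e ?x \<otimes>\<^bsub>G\<^esub> g = elem (side 1) e ?x \<otimes>\<^bsub>G\<^esub> h"
      by (rule assms(3)[OF elem_T[OF s True]]) simp
    then have "?x * Theta g e e' = ?x * Theta h e e'"
      using Theta_elem_mult[OF sE True, of ?x _ "side 1" e'] assms(1,2) by (metis dvd_refl)
    then show ?thesis by simp
  next
    case False
    then show ?thesis using Theta_outside assms(1,2) by metis
  qed
qed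

text \<open>Units from row \<open>s\<close> to row \<open>r\<close> bring every row of an element to
  row \<open>r\<close>, where linearity reduces \<open>f\<close> to its values on the vectors
  \<open>te e\<close>; the entries of \<open>g\<close> are quotients of these values. The difficulty
  is their divisibility by x^(\<open>ddeg e e'\<close>): row \<open>r\<close> itself yields only
  x^(\<open>ddeg r e'\<close>), so the bound is taken from a side at which the degree is
  attained.\<close>

lemma endo_is_right_mult:
  fixes f :: "('k::field) kq set \<Rightarrow> 'k kq set"
  assumes fT: "\<And>t. t \<in> T \<Longrightarrow> f t \<in> T"
    and fadd: "\<And>a b. a \<in> T \<Longrightarrow> b \<in> T \<Longrightarrow> f (a \<oplus>\<^bsub>G\<^esub> b) = f a \<oplus>\<^bsub>G\<^esub> f b"
    and flin: "\<And>u a. u \<in> eF_Gamma_eF n \<sigma> \<Longrightarrow> a \<in> T \<Longrightarrow> f (u \<otimes>\<^bsub>G\<^esub> a) = u \<otimes>\<^bsub>G\<^esub> f a"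
  shows "\<exists>g\<in>carrier G. \<forall>t\<in>T. f t = t \<otimes>\<^bsub>G\<^esub> g"
proof -
  define r where "r = side 1"
  have r: "r \<in> sides n" "r \<in> E" using side_in[of 1] n3 by (auto simp: r_def)
  define x where "x k = monom (1::'k) k" for k
  have x_mult: "x a * x b = x (a + b)" for a b by (simp add: x_def mult_monom)
  have x_nz: "x a \<noteq> 0" for a by (simp add: x_def)
  have x_dvd: "x a dvd x b" if "a \<le> b" for a b
    using x_mult[of a "b - a"] that by (metis dvd_triv_left le_add_diff_inverse)
  define te where "te e = elem r e (x (ddeg r e))" for e
  have te: "te e \<in> T" if "e \<in> E" for e
    unfolding te_def using that r by (intro elem_T) (simp_all add: x_def)
  have rr: "elem r r p \<in> eF_Gamma_eF n \<sigma>" for p :: "'k poly"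
    using r by (intro elem_order) (simp_all add: monom_0 one_pCons[symmetric])
  have dr: "monom 1 (ddeg r r) dvd p" for p :: "'k poly" using r by (simp add: monom_0 one_pCons[symmetric])
  have Theta_rr: "Theta (elem r r p \<otimes>\<^bsub>G\<^esub> t) d d' = (if d = r then p * Theta t r d' else 0)"
    if "t \<in> carrier G" for p d d' and t :: "'k kq set"
    by (rule Theta_elem_mult[OF r(2) r(2) dr that])
  \<comment> \<open>If \<open>f\<close> is right multiplication by \<open>g\<close>, this is
    x^(\<open>ddeg r e\<close>) times the entry of \<open>g\<close> at (e,e').\<close>
  define F where "F e e' = Theta (f (te e)) r e'" for e e'
  define U where "U s = elem r s (x (ddeg r s))" for s
  have U: "U s \<in> eF_Gamma_eF n \<sigma>" if "s \<in> sides n" for s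
    unfolding U_def using that r by (intro elem_order) (simp_all add: x_def)
  have Theta_U: "Theta (U s \<otimes>\<^bsub>G\<^esub> t) d d' = (if d = r then x (ddeg r s) * Theta t s d' else 0)"
    if "s \<in> sides n" "t \<in> carrier G" for s d d' and t :: "'k kq set"
    unfolding U_def
    by (rule Theta_elem_mult[OF r(2) _ _ that(2)]) (use that(1) sides_subset in \<open>auto simp: x_def\<close>)
  \<comment> \<open>Additivity alone suffices: t + t = t forces the image of 0 to be 0.\<close>
  have f0: "Theta (f t) r d = 0" if "t \<in> T" "\<And>e e'. Theta t e e' = 0" for t d
  proof -
    have "t \<oplus>\<^bsub>G\<^esub> t = t"
      using that by (intro Theta_eqI G_add_closed) (simp_all add: Theta_add T_carrier)
    then have "f t \<oplus>\<^bsub>G\<^esub> f t = f t" using fadd[OF that(1) that(1)] by simp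
    then have "Theta (f t) r d + Theta (f t) r d = Theta (f t) r d"
      using Theta_add[of "f t" "f t" r d] T_carrier[OF fT[OF that(1)]] by simp
    then show ?thesis by (simp only: add_cancel_left_left)
  qed
  \<comment> \<open>Columns are removed one at a time; multiplication by a polynomial in row
    \<open>r\<close> is multiplication by \<open>elem r r\<close>, which lies in the corner, so
    \<open>f\<close> commutes with it.\<close>
  have F_row: "Theta (f t) r d = (\<Sum>e\<in>A. q e * F e d)"
    if "finite A" "A \<subseteq> E" "t \<in> T" "\<And>e. e \<in> A \<Longrightarrow> Theta t r e = q e * x (ddeg r e)"
      "\<And>e e'. e \<noteq> r \<or> e' \<notin> A \<Longrightarrow> Theta t e e' = 0" for A t q d
    using that
  proof (induction A arbitrary: t rule: finite_induct)
    case empty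
    then show ?case using f0 by simp
  next
    case (insert a A)
    have aE: "a \<in> E" using insert by simp
    have tc: "t \<in> carrier G" using T_carrier insert by blast
    obtain t' :: "'k kq set" where t': "t' \<in> carrier G"
      "\<And>e e'. e \<in> E \<Longrightarrow> e' \<in> E \<Longrightarrow> Theta t' e e' = (if e' \<in> A then Theta t e e' else 0)"
      using edge_matrix_exists[where 'k = 'k and Q = "\<lambda>e e' p. p = (if e' \<in> A then Theta t e e' else 0)"] Theta_dvd[OF tc]
      by fastforce
    have t'T: "Theta t' e e' = (if e' \<in> A then Theta t e e' else 0)" for e e'
      using t'(2)[of e e'] Theta_outside[OF t'(1), of e e'] Theta_outside[OF tc, of e e'] by (cases "e \<in> E \<and> e' \<in> E") auto
    have "t' \<in> T" unfolding eF_Gamma_iff using t'(1) t'T T_zero[OF insert.prems(2)] by simp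
    have ta: "elem r r (q a) \<otimes>\<^bsub>G\<^esub> te a \<in> T"
      by (rule T_mult[OF order_T[OF rr] T_carrier[OF te[OF aE]]])
    have Tta: "Theta (elem r r (q a) \<otimes>\<^bsub>G\<^esub> te a) e e' = (if e = r \<and> e' = a then q a * x (ddeg r a) else 0)" for e e'
    proof -
      have "Theta (te a) r c = (if c = a then x (ddeg r a) else 0)" for c
        unfolding te_def using elem(2)[OF r(2) aE, of "x (ddeg r a)" r c] by (simp add: x_def)
      then show ?thesis using Theta_rr[OF T_carrier[OF te[OF aE]], of "q a" e e'] by simp
    qed
    have teq: "t = t' \<oplus>\<^bsub>G\<^esub> (elem r r (q a) \<otimes>\<^bsub>G\<^esub> te a)"
    proof (rule Theta_eqI[OF tc G_add_closed[OF t'(1) T_carrier[OF ta]]])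
      fix e e'
      show "Theta t e e' = Theta (t' \<oplus>\<^bsub>G\<^esub> (elem r r (q a) \<otimes>\<^bsub>G\<^esub> te a)) e e'"
        unfolding Theta_add[OF t'(1) T_carrier[OF ta]] t'T Tta
        using insert.prems(3)[of a] insert.prems(4)[of e e'] insert.hyps(2)
        by (cases "e = r"; cases "e' = a"; cases "e' \<in> A") auto
    qed
    have "Theta (f t') r d = (\<Sum>e\<in>A. q e * F e d)"
    proof (rule insert.IH[OF _ \<open>t' \<in> T\<close>])
      show "Theta t' r e = q e * x (ddeg r e)" if "e \<in> A" for e using insert.prems(3)[of e] t'T that by simp
      show "Theta t' e e' = 0" if "e \<noteq> r \<or> e' \<notin> A" for e e'
        using insert.prems(4)[of e e'] t'T[of e e'] that by auto
    qed (use insert.prems in simp)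
    moreover have "Theta (f (elem r r (q a) \<otimes>\<^bsub>G\<^esub> te a)) r d = q a * F a d"
      unfolding flin[OF rr te[OF aE]] F_def using Theta_rr[OF T_carrier[OF fT[OF te[OF aE]]]] by simp
    ultimately show ?case
      using fadd[OF \<open>t' \<in> T\<close> ta] Theta_add[OF T_carrier[OF fT[OF \<open>t' \<in> T\<close>]] T_carrier[OF fT[OF ta]]] insert.hyps
      unfolding teq[symmetric] by simp
  qed
  have F_dvd: "x (ddeg r e + ddeg e e') dvd F e e'" if ee: "e \<in> E" "e' \<in> E" for e e'
  proof -
    obtain s where s: "s \<in> sides n" "ddeg s e' = ddeg s e + ddeg e e'" using ddeg_attained[OF ee] by blast
    have sE: "s \<in> E" using s(1) sides_subset by blast
    define v where "v = elem s e (x (ddeg s e))"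
    have v: "v \<in> T" unfolding v_def using s(1) ee by (intro elem_T) (simp_all add: x_def)
    have Tv: "Theta v d d' = (if d = s \<and> d' = e then x (ddeg s e) else 0)" for d d'
      unfolding v_def using elem(2)[OF sE ee(1), of "x (ddeg s e)"] by (simp add: x_def)
    \<comment> \<open>The unit \<open>v\<close> of row \<open>s\<close>, moved to row
      \<open>r\<close> by \<open>U s\<close>, becomes x^k times \<open>te e\<close>. Comparing both
      computations of its image and cancelling x^k gives the bound.\<close>
    obtain k where k: "ddeg r s + ddeg s e = k + ddeg r e"
      using ddeg_tri[OF r(2) sE ee(1)] by (metis le_add_diff_inverse2)
    have UvT: "U s \<otimes>\<^bsub>G\<^esub> v \<in> T" by (rule T_mult[OF order_T[OF U[OF s(1)]] T_carrier[OF v]])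
    have "Theta (f (U s \<otimes>\<^bsub>G\<^esub> v)) r e' = (\<Sum>e\<in>{e}. x k * F e e')"
    proof (rule F_row[OF _ _ UvT])
      show "Theta (U s \<otimes>\<^bsub>G\<^esub> v) r d = x k * x (ddeg r d)" if "d \<in> {e}" for d
        using that k unfolding Theta_U[OF s(1) T_carrier[OF v]] Tv x_mult by (simp add: x_mult)
      show "Theta (U s \<otimes>\<^bsub>G\<^esub> v) d d' = 0" if "d \<noteq> r \<or> d' \<notin> {e}" for d d'
        using that unfolding Theta_U[OF s(1) T_carrier[OF v]] Tv by auto
    qed (use ee in auto)
    moreover have "Theta (f (U s \<otimes>\<^bsub>G\<^esub> v)) r e' = x (ddeg r s) * Theta (f v) s e'"
      unfolding flin[OF U[OF s(1)] v] Theta_U[OF s(1) T_carrier[OF fT[OF v]]] by simp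
    moreover obtain w where "Theta (f v) s e' = x (ddeg s e') * w"
      using Theta_dvd[OF T_carrier[OF fT[OF v]], of s e'] unfolding x_def by (rule dvdE)
    ultimately have "x k * F e e' = x (ddeg r s) * (x (ddeg s e + ddeg e e') * w)" using s(2) by simp
    also have "\<dots> = x (ddeg r s + ddeg s e + ddeg e e') * w" by (simp add: x_mult[symmetric] mult.assoc)
    also have "\<dots> = x k * (x (ddeg r e + ddeg e e') * w)" 
      unfolding k by (simp add: x_mult[symmetric] mult.assoc)
    finally have "F e e' = x (ddeg r e + ddeg e e') * w" using x_nz by simp
    then show ?thesis by simp
  qed
  have "\<exists>p. monom 1 (ddeg e e') dvd p \<and> F e e' = x (ddeg r e) * p" if ee: "e \<in> E" "e' \<in> E" for e e'
  proof -
    obtain w where "F e e' = x (ddeg r e + ddeg e e') * w" using F_dvd[OF ee] by (rule dvdE)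
    then have "F e e' = x (ddeg r e) * (x (ddeg e e') * w)" by (simp add: x_mult[symmetric] mult.assoc)
    then show ?thesis by (intro exI[of _ "x (ddeg e e') * w"]) (simp add: x_def)
  qed
  then obtain g :: "'k kq set" where g: "g \<in> carrier G"
    "\<And>e e'. e \<in> E \<Longrightarrow> e' \<in> E \<Longrightarrow> F e e' = x (ddeg r e) * Theta g e e'"
    using edge_matrix_exists[where Q = "\<lambda>e e' p. F e e' = x (ddeg r e) * p"] by blast
  have "f t = t \<otimes>\<^bsub>G\<^esub> g" if t: "t \<in> T" for t
  proof (rule Theta_eqI[OF T_carrier[OF fT[OF t]] T_carrier[OF T_mult[OF t g(1)]]])
    fix s e'
    note tc = T_carrier[OF t] and ftc = T_carrier[OF fT[OF t]]
    show "Theta (f t) s e' = Theta (t \<otimes>\<^bsub>G\<^esub> g) s e'"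
    proof (cases "s \<in> sides n \<and> e' \<in> E")
      case True
      then have s: "s \<in> sides n" "s \<in> E" "e' \<in> E" using sides_subset by auto
      \<comment> \<open>By the triangle inequality row \<open>s\<close>, once moved to row
        \<open>r\<close>, is a combination of the vectors \<open>te e\<close>; \<open>q\<close>
        collects the coefficients, as \<open>F_row\<close> requires.\<close>
      have "\<exists>q. x (ddeg r s) * Theta t s e = q * x (ddeg r e)" if "e \<in> E" for e
      proof -
        obtain w where "Theta t s e = x (ddeg s e) * w" using Theta_dvd[OF tc, of s e] unfolding x_def by (rule dvdE)
        then have "x (ddeg r s) * Theta t s e = x (ddeg r s + ddeg s e) * w" by (simp add: x_mult[symmetric] mult.assoc)
        moreover have "x (ddeg r e) dvd x (ddeg r s + ddeg s e)" using ddeg_tri[OF r(2) s(2) that] by (rule x_dvd)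
        ultimately have "x (ddeg r e) dvd x (ddeg r s) * Theta t s e" by simp
        then show ?thesis by (metis dvd_def mult.commute)
      qed
      then obtain q where q: "\<And>e. e \<in> E \<Longrightarrow> x (ddeg r s) * Theta t s e = q e * x (ddeg r e)" by metis
      have UtT: "U s \<otimes>\<^bsub>G\<^esub> t \<in> T" by (rule T_mult[OF order_T[OF U[OF s(1)]] tc])
      have "Theta (f (U s \<otimes>\<^bsub>G\<^esub> t)) r e' = (\<Sum>e\<in>E. q e * F e e')"
      proof (rule F_row[OF finite_E subset_refl UtT])
        show "Theta (U s \<otimes>\<^bsub>G\<^esub> t) r d = q d * x (ddeg r d)" if "d \<in> E" for d
          unfolding Theta_U[OF s(1) tc] using q[OF that] by simp
        show "Theta (U s \<otimes>\<^bsub>G\<^esub> t) d d' = 0" if "d \<noteq> r \<or> d' \<notin> E" for d d'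
          unfolding Theta_U[OF s(1) tc] using that Theta_outside[OF tc, of s d'] by auto
      qed
      also have "\<dots> = (\<Sum>e\<in>E. x (ddeg r s) * (Theta t s e * Theta g e e'))"
      proof (rule sum.cong)
        fix e assume "e \<in> E"
        then show "q e * F e e' = x (ddeg r s) * (Theta t s e * Theta g e e')"
          using g(2)[OF _ s(3), of e] q[of e] by (simp add: mult.assoc[symmetric])
      qed simp
      also have "\<dots> = x (ddeg r s) * Theta (t \<otimes>\<^bsub>G\<^esub> g) s e'"
        by (simp add: Theta_mult[OF tc g(1)] sum_distrib_left)
      finally have "Theta (f (U s \<otimes>\<^bsub>G\<^esub> t)) r e' = x (ddeg r s) * Theta (t \<otimes>\<^bsub>G\<^esub> g) s e'" .
      moreover have "Theta (f (U s \<otimes>\<^bsub>G\<^esub> t)) r e' = x (ddeg r s) * Theta (f t) s e'"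
        unfolding flin[OF U[OF s(1)] t] Theta_U[OF s(1) ftc] by simp
      ultimately show ?thesis using x_nz by simp
    next
      case False
      then show ?thesis
        using T_zero[OF fT[OF t], of s e'] T_zero[OF T_mult[OF t g(1)], of s e']
          Theta_outside[OF ftc, of s e'] Theta_outside[OF T_carrier[OF T_mult[OF t g(1)]], of s e'] by auto
    qed
  qed
  then show ?thesis using g(1) by blast
qed

lemma rmult_op_iso_order_map: "rmult_op_iso n \<sigma> (order_map :: ('k::field) mat \<Rightarrow> 'k kq set)"
proof -
  interpret R: ring "G :: 'k kq set ring" by (rule ring_G)
  have ord: "order_map ` Lambda n = (eF_Gamma_eF n \<sigma> :: 'k kq set set)"
    by (rule bij_betw_imp_surj_on[OF order_map_bij])
  \<comment> \<open>As \<open>order_map\<close> is onto the corner, linearity over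
    \<open>Lambda\<close> is linearity over the corner ring.\<close>
  have End: "f \<in> End_T n \<sigma> order_map \<longleftrightarrow> f \<in> extensional T \<and> f \<in> T \<rightarrow> T
     \<and> (\<forall>a\<in>T. \<forall>b\<in>T. f (a \<oplus>\<^bsub>G\<^esub> b) = f a \<oplus>\<^bsub>G\<^esub> f b)
     \<and> (\<forall>u\<in>eF_Gamma_eF n \<sigma>. \<forall>a\<in>T. f (u \<otimes>\<^bsub>G\<^esub> a) = u \<otimes>\<^bsub>G\<^esub> f a)" for f :: "'k kq set \<Rightarrow> 'k kq set"
    unfolding End_T_def ord[symmetric] by simp
  have bij: "bij_betw (rmult n \<sigma>) (carrier G) (End_T n \<sigma> (order_map :: 'k mat \<Rightarrow> 'k kq set))"
    unfolding bij_betw_def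
  proof
    show "inj_on (rmult n \<sigma>) (carrier (G :: 'k kq set ring))"
    proof (rule inj_onI)
      fix g h :: "'k kq set" assume gh: "g \<in> carrier G" "h \<in> carrier G" and eq: "rmult n \<sigma> g = rmult n \<sigma> h"
      show "g = h"
      proof (rule T_faithful[OF gh])
        fix t :: "'k kq set" assume "t \<in> T"
        then show "t \<otimes>\<^bsub>G\<^esub> g = t \<otimes>\<^bsub>G\<^esub> h" using fun_cong[OF eq, of t] by (simp add: rmult_def)
      qed
    qed
    show "rmult n \<sigma> ` carrier G = End_T n \<sigma> (order_map :: 'k mat \<Rightarrow> 'k kq set)"
    proof (intro equalityI subsetI)
      fix f :: "'k kq set \<Rightarrow> 'k kq set" assume "f \<in> rmult n \<sigma> ` carrier G"
      then obtain g where g: "g \<in> carrier G" "f = rmult n \<sigma> g" by blast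
      show "f \<in> End_T n \<sigma> order_map"
        unfolding End g(2) rmult_def
        by (intro conjI ballI restrict_extensional)
          (simp_all add: R.l_distr R.m_assoc T_add T_mult T_carrier order_T g(1))
    next
      fix f :: "'k kq set \<Rightarrow> 'k kq set" assume f: "f \<in> End_T n \<sigma> order_map"
      have F: "f \<in> extensional T" "\<And>t. t \<in> T \<Longrightarrow> f t \<in> T"
        "\<And>a b. a \<in> T \<Longrightarrow> b \<in> T \<Longrightarrow> f (a \<oplus>\<^bsub>G\<^esub> b) = f a \<oplus>\<^bsub>G\<^esub> f b"
        "\<And>u a. u \<in> eF_Gamma_eF n \<sigma> \<Longrightarrow> a \<in> T \<Longrightarrow> f (u \<otimes>\<^bsub>G\<^esub> a) = u \<otimes>\<^bsub>G\<^esub> f a"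
        using f unfolding End by blast+
      obtain g where g: "g \<in> carrier G" "\<And>t. t \<in> T \<Longrightarrow> f t = t \<otimes>\<^bsub>G\<^esub> g"
        using endo_is_right_mult[of f, OF F(2-4)] by blast
      have "f = rmult n \<sigma> g"
      proof
        fix t show "f t = rmult n \<sigma> g t"
          using g(2)[of t] extensional_arb[OF F(1), of t] unfolding rmult_def by (cases "t \<in> T") simp_all
      qed
      then show "f \<in> rmult n \<sigma> ` carrier G" using g(1) by blast
    qed
  qed
  show ?thesis unfolding rmult_op_iso_def
  proof (intro conjI ballI allI)
    fix g h :: "'k kq set" assume gh: "g \<in> carrier G" "h \<in> carrier G"
    show "rmult n \<sigma> (g \<oplus>\<^bsub>G\<^esub> h) = (\<lambda>t\<in>T. rmult n \<sigma> g t \<oplus>\<^bsub>G\<^esub> rmult n \<sigma> h t)"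
      unfolding rmult_def by (rule restrict_ext) (simp add: R.r_distr gh T_carrier)
    show "rmult n \<sigma> (g \<otimes>\<^bsub>G\<^esub> h) = compose T (rmult n \<sigma> h) (rmult n \<sigma> g)"
      unfolding rmult_def compose_def by (rule restrict_ext) (simp add: R.m_assoc gh T_carrier T_mult)
  next
    show "rmult n \<sigma> \<one>\<^bsub>Gamma n \<sigma> :: 'k kq set ring\<^esub> = (\<lambda>t\<in>T. t)"
      unfolding rmult_def by (rule restrict_ext) (simp add: T_carrier)
  next
    fix q :: "'k poly" and g :: "'k kq set" assume g: "g \<in> carrier G"
    note q = polyact_properties(1)[of q]
    show "rmult n \<sigma> (polyact n \<sigma> q \<otimes>\<^bsub>G\<^esub> g) = (\<lambda>t\<in>T. polyact n \<sigma> q \<otimes>\<^bsub>G\<^esub> rmult n \<sigma> g t)"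
      unfolding rmult_def
    proof (rule restrict_ext)
      fix t :: "'k kq set" assume t: "t \<in> T"
      show "t \<otimes>\<^bsub>G\<^esub> (polyact n \<sigma> q \<otimes>\<^bsub>G\<^esub> g) = polyact n \<sigma> q \<otimes>\<^bsub>G\<^esub> (\<lambda>t\<in>T. t \<otimes>\<^bsub>G\<^esub> g) t"
        using t R.m_assoc[OF T_carrier[OF t] q g] R.m_assoc[OF q T_carrier[OF t] g]
          polyact_central[OF T_carrier[OF t], of q] by simp
    qed
  qed (rule bij)
qed

end

theorem theorem3p9:
  fixes n :: nat and \<sigma> :: "edge set"
  assumes "n \<ge> 3" and "triangulation n \<sigma>"
  shows "\<exists>\<phi> :: ('k::field) mat \<Rightarrow> 'k kq set.
           order_iso n \<sigma> \<phi> \<and> (\<exists>\<psi>. module_iso n \<sigma> \<phi> \<psi>) \<and> rmult_op_iso n \<sigma> \<phi>"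
proof -
  interpret triangulated_polygon n \<sigma> using assms by unfold_locales
  show ?thesis using order_iso_order_map module_iso_to_vec rmult_op_iso_order_map by blast
qed

end
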